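(* Let $E\subset\mathbb{P}^2_{\mathbb{C}}$ be an irreducible nodal cubic curve (i.e. an irreducible plane cubic whose only singularity is one node). Then $E$ has exactly three sextactic points, hence exactly three hyperosculating conics $Q_1,Q_2,Q_3$, and: (a) for each $i$, the arrangement $E\cup Q_i$ (degree $5$) is free with exponents $(2,2)$; (b) for each $i\neq j$, the arrangement $E\cup Q_i\cup Q_j$ (degree $7$) is free with exponents $(3,3)$; (c) the arrangement $E\cup Q_1\cup Q_2\cup Q_3$ (degree $9$) is a $4$-syzygy curve with exponents $(5,5,5,5)$. *)

theory Defs
  imports "HOL-Analysis.Analysis"
begin

text \<open>Polynomials in C[x,y,z] are represented by their polynomial functions
  C^3 -> C (faithful since C is infinite). Points of C^3 are triples;
  a point of P^2 is a nonzero triple up to nonzero scaling.\<close>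

type_synonym cpoly = "complex \<Rightarrow> complex \<Rightarrow> complex \<Rightarrow> complex"
type_synonym cpt = "complex \<times> complex \<times> complex"
type_synonym csyz = "cpoly \<times> cpoly \<times> cpoly"

definition is_poly :: "cpoly \<Rightarrow> bool" where
  "is_poly P \<longleftrightarrow> (\<exists>S c. finite S \<and>
     (\<forall>x y z. P x y z = (\<Sum>(i,j,k)\<in>S. c (i,j,k) * x^i * y^j * z^k)))"

text \<open>homogeneous of degree d (the zero polynomial is homogeneous of every degree)\<close>
definition hom_poly :: "nat \<Rightarrow> cpoly \<Rightarrow> bool" where
  "hom_poly d P \<longleftrightarrow> (\<exists>c. \<forall>x y z.
     P x y z = (\<Sum>(i,j)\<in>{(i,j). i + j \<le> d}. c i j * x^i * y^j * z^(d-i-j)))"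

definition zero_poly :: cpoly where "zero_poly = (\<lambda>_ _ _. 0)"

definition pmult :: "cpoly \<Rightarrow> cpoly \<Rightarrow> cpoly" where
  "pmult P Q = (\<lambda>x y z. P x y z * Q x y z)"

definition pscale :: "complex \<Rightarrow> cpoly \<Rightarrow> cpoly" where
  "pscale c P = (\<lambda>x y z. c * P x y z)"

definition dX :: "cpoly \<Rightarrow> cpoly" where "dX P = (\<lambda>x y z. deriv (\<lambda>t. P t y z) x)"
definition dY :: "cpoly \<Rightarrow> cpoly" where "dY P = (\<lambda>x y z. deriv (\<lambda>t. P x t z) y)"
definition dZ :: "cpoly \<Rightarrow> cpoly" where "dZ P = (\<lambda>x y z. deriv (\<lambda>t. P x y t) z)"

definition ev :: "cpoly \<Rightarrow> cpt \<Rightarrow> complex" where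
  "ev P p = P (fst p) (fst (snd p)) (snd (snd p))"

definition proportional :: "cpt \<Rightarrow> cpt \<Rightarrow> bool" where
  "proportional p q \<longleftrightarrow> (\<exists>c. c \<noteq> 0 \<and>
     q = (c * fst p, c * fst (snd p), c * snd (snd p)))"

definition is_syz :: "cpoly \<Rightarrow> csyz \<Rightarrow> bool" where
  "is_syz f \<rho> \<longleftrightarrow> (case \<rho> of (a,b,c) \<Rightarrow> is_poly a \<and> is_poly b \<and> is_poly c \<and>
     (\<forall>x y z. a x y z * dX f x y z + b x y z * dY f x y z + c x y z * dZ f x y z = 0))"

definition hom_syz :: "nat \<Rightarrow> csyz \<Rightarrow> bool" where
  "hom_syz k \<rho> \<longleftrightarrow> (case \<rho> of (a,b,c) \<Rightarrow> hom_poly k a \<and> hom_poly k b \<and> hom_poly k c)"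

definition combo :: "nat \<Rightarrow> (nat \<Rightarrow> cpoly) \<Rightarrow> (nat \<Rightarrow> csyz) \<Rightarrow> csyz" where
  "combo m p \<rho> =
    ((\<lambda>x y z. \<Sum>i<m. p i x y z * fst (\<rho> i) x y z),
     (\<lambda>x y z. \<Sum>i<m. p i x y z * fst (snd (\<rho> i)) x y z),
     (\<lambda>x y z. \<Sum>i<m. p i x y z * snd (snd (\<rho> i)) x y z))"

definition generates_AR :: "cpoly \<Rightarrow> nat \<Rightarrow> (nat \<Rightarrow> csyz) \<Rightarrow> bool" where
  "generates_AR f m \<rho> \<longleftrightarrow> (\<forall>\<sigma>. is_syz f \<sigma> \<longrightarrow>
     (\<exists>p. (\<forall>i<m. is_poly (p i)) \<and> \<sigma> = combo m p \<rho>))"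

definition free_with_exponents :: "cpoly \<Rightarrow> nat list \<Rightarrow> bool" where
  "free_with_exponents f ds \<longleftrightarrow> (\<exists>\<rho>.
     (\<forall>i<length ds. is_syz f (\<rho> i) \<and> hom_syz (ds ! i) (\<rho> i)) \<and>
     generates_AR f (length ds) \<rho> \<and>
     (\<forall>p. (\<forall>i<length ds. is_poly (p i)) \<and>
          combo (length ds) p \<rho> = (zero_poly, zero_poly, zero_poly) \<longrightarrow>
          (\<forall>i<length ds. p i = zero_poly)))"

definition msyzygy_with_exponents :: "cpoly \<Rightarrow> nat list \<Rightarrow> bool" where
  "msyzygy_with_exponents f ds \<longleftrightarrow> (\<exists>\<rho>.
     (\<forall>i<length ds. is_syz f (\<rho> i) \<and> hom_syz (ds ! i) (\<rho> i)) \<and>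
     generates_AR f (length ds) \<rho> \<and>
     (\<forall>j<length ds. \<not> (\<exists>p. (\<forall>i<length ds. is_poly (p i)) \<and> p j = zero_poly \<and>
          \<rho> j = combo (length ds) p \<rho>)))"

definition is_constant :: "cpoly \<Rightarrow> bool" where
  "is_constant g \<longleftrightarrow> (\<exists>c. g = (\<lambda>_ _ _. c))"

definition irreducible_poly :: "cpoly \<Rightarrow> bool" where
  "irreducible_poly f \<longleftrightarrow> \<not> is_constant f \<and>
     (\<forall>g h. is_poly g \<and> is_poly h \<and> f = pmult g h \<longrightarrow> is_constant g \<or> is_constant h)"

definition singular_pt :: "cpoly \<Rightarrow> cpt \<Rightarrow> bool" where
  "singular_pt f p \<longleftrightarrow> p \<noteq> (0,0,0) \<and> ev f p = 0 \<and>
     ev (dX f) p = 0 \<and> ev (dY f) p = 0 \<and> ev (dZ f) p = 0"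

definition smooth_pt :: "cpoly \<Rightarrow> cpt \<Rightarrow> bool" where
  "smooth_pt f p \<longleftrightarrow> p \<noteq> (0,0,0) \<and> ev f p = 0 \<and>
     \<not> (ev (dX f) p = 0 \<and> ev (dY f) p = 0 \<and> ev (dZ f) p = 0)"

text \<open>quadratic part (Hessian form) of f at p, i.e. the tangent cone at a double point\<close>
definition hess_form :: "cpoly \<Rightarrow> cpt \<Rightarrow> cpoly" where
  "hess_form f p = (\<lambda>u v w.
      ev (dX (dX f)) p * u * u + ev (dX (dY f)) p * u * v + ev (dX (dZ f)) p * u * w
    + ev (dY (dX f)) p * v * u + ev (dY (dY f)) p * v * v + ev (dY (dZ f)) p * v * w
    + ev (dZ (dX f)) p * w * u + ev (dZ (dY f)) p * w * v + ev (dZ (dZ f)) p * w * w)"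

definition node_pt :: "cpoly \<Rightarrow> cpt \<Rightarrow> bool" where
  "node_pt f p \<longleftrightarrow> singular_pt f p \<and>
     (\<exists>l1 l2. hom_poly 1 l1 \<and> hom_poly 1 l2 \<and> l2 \<noteq> zero_poly \<and>
        (\<forall>c. l1 \<noteq> pscale c l2) \<and> hess_form f p = pmult l1 l2)"

definition irreducible_nodal_cubic :: "cpoly \<Rightarrow> bool" where
  "irreducible_nodal_cubic f \<longleftrightarrow> hom_poly 3 f \<and> irreducible_poly f \<and>
     (\<exists>p. node_pt f p \<and> (\<forall>q. singular_pt f q \<longrightarrow> proportional p q))"

text \<open>local analytic branch of f = 0 through p, immersive in P^2\<close>
definition local_branch :: "cpoly \<Rightarrow> cpt \<Rightarrow> (complex \<Rightarrow> complex) \<Rightarrow>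
    (complex \<Rightarrow> complex) \<Rightarrow> (complex \<Rightarrow> complex) \<Rightarrow> bool" where
  "local_branch f p g1 g2 g3 \<longleftrightarrow> (\<exists>r>0.
     g1 holomorphic_on ball 0 r \<and> g2 holomorphic_on ball 0 r \<and> g3 holomorphic_on ball 0 r \<and>
     (g1 0, g2 0, g3 0) = p \<and>
     (\<forall>t\<in>ball 0 r. f (g1 t) (g2 t) (g3 t) = 0) \<and>
     (\<forall>c. (deriv g1 0, deriv g2 0, deriv g3 0) \<noteq> (c * fst p, c * fst (snd p), c * snd (snd p))))"

text \<open>intersection multiplicity of the curve q = 0 with f = 0 at the smooth point p is at least k\<close>
definition contact_ge :: "cpoly \<Rightarrow> cpoly \<Rightarrow> cpt \<Rightarrow> nat \<Rightarrow> bool" where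
  "contact_ge f q p k \<longleftrightarrow> (\<exists>g1 g2 g3. local_branch f p g1 g2 g3 \<and>
     (\<forall>j<k. (deriv ^^ j) (\<lambda>t. q (g1 t) (g2 t) (g3 t)) 0 = 0))"

definition flex_pt :: "cpoly \<Rightarrow> cpt \<Rightarrow> bool" where
  "flex_pt f p \<longleftrightarrow> smooth_pt f p \<and>
     (\<exists>l. hom_poly 1 l \<and> l \<noteq> zero_poly \<and> contact_ge f l p 3)"

definition sextactic_pt :: "cpoly \<Rightarrow> cpt \<Rightarrow> bool" where
  "sextactic_pt f p \<longleftrightarrow> smooth_pt f p \<and> \<not> flex_pt f p \<and>
     (\<exists>q. hom_poly 2 q \<and> q \<noteq> zero_poly \<and> contact_ge f q p 6)"

definition hyperosculating :: "cpoly \<Rightarrow> cpt \<Rightarrow> cpoly \<Rightarrow> bool" where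
  "hyperosculating f p q \<longleftrightarrow> sextactic_pt f p \<and>
     hom_poly 2 q \<and> q \<noteq> zero_poly \<and> contact_ge f q p 6"

end

(* A nodal cubic is projectively equivalent to x y z + x^3 + y^3, whose smooth locus is parametrized by
   u |-> (u, u^2, -(1 + u^3)), u <> 0.  Restricting a conic to it gives a polynomial of degree 6 in u with
   equal first and last coefficients, so contact of order 6 at u forces u^6 = 1; flexes are the points with
   u^3 = -1, and the cube roots of unity remain.  They are permuted by the symmetries
   (x, y, z) |-> (w^2 x, w y, z), w^3 = 1, of the cubic, which reduces the three freeness questions to
   one explicit curve each.

   If rho, sigma are syzygies of grad F and the partials of F have no common factor, then
   rho x sigma = h grad F with h polynomial.  When h is a nonzero constant, Cramer's rule expresses every
   syzygy through rho and sigma (Saito's criterion); this settles degrees 5 and 7.  In degree 9 there are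
   four syzygies with two linear relations, and the coefficients of an arbitrary syzygy are found by
   dividing its cross products with the four generators modulo the regular sequence x, y. *)

theory Submission
  imports Defs "HOL-Complex_Analysis.Complex_Analysis"
begin

section \<open>Polynomial functions\<close>

text \<open>Degrees show where the difficulty lies. For \<open>f\<close> of degree d, syzygies of
  degrees a and b have cross product h grad f with deg h = a + b - (d - 1). This is 0 for 2 + 2
  against 4 and for 3 + 3 against 6, but 5 + 5 against 8 leaves a quadric, so Cramer's rule alone
  does not suffice for the nonic. For the generators P and Q it is h = -91 x y; Cramer's rule then
  writes x y sigma through P and Q, and the relations x A + y Q = z P and y B + z Q = 49 x P are
  what makes the factor x y cancel. Polynomials are functions here, so divisibility always means an
  exhibited cofactor, and cancelling a polynomial needs a point where it is nonzero. The explicit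
  syzygies and cofactors solve linear systems over Q in a fixed degree; once written down they are
  verified as polynomial identities. The node enters through its two distinct tangent lines, which
  become x = 0 and y = 0 in the normal form; irreducibility makes the coefficients of x^3 and y^3
  nonzero.\<close>

inductive pdeg :: "nat \<Rightarrow> cpoly \<Rightarrow> bool" where
  pdeg_zero: "pdeg d (\<lambda>_ _ _. 0)"
| pdeg_add_monom: "pdeg d P \<Longrightarrow> i + j + k \<le> d \<Longrightarrow>
    pdeg d (\<lambda>x y z. P x y z + c * x^i * y^j * z^k)"

lemma pdeg_mono: "pdeg d P \<Longrightarrow> d \<le> e \<Longrightarrow> pdeg e P"
  by (induction rule: pdeg.induct) (auto intro: pdeg.intros)

lemma pdeg_monom: "i + j + k \<le> d \<Longrightarrow> pdeg d (\<lambda>x y z. c * x^i * y^j * z^k)"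
  using pdeg_add_monom[OF pdeg_zero, of i j k d c] by simp

lemma pdeg_add: "pdeg d Q \<Longrightarrow> pdeg d P \<Longrightarrow> pdeg d (\<lambda>x y z. P x y z + Q x y z)"
proof (induction rule: pdeg.induct)
  case (pdeg_add_monom d Q i j k c)
  from pdeg.pdeg_add_monom[OF pdeg_add_monom.IH[OF pdeg_add_monom.prems] pdeg_add_monom.hyps(2), of c]
  show ?case by (simp add: add.assoc)
qed simp

lemma pdeg_mult_monom:
  "pdeg d P \<Longrightarrow> pdeg (d + (i + j + k)) (\<lambda>x y z. P x y z * (c * x^i * y^j * z^k))"
proof (induction rule: pdeg.induct)
  case (pdeg_zero d)
  then show ?case by (simp add: pdeg.pdeg_zero)
next
  case (pdeg_add_monom d P i' j' k' c')
  have "(i' + i) + (j' + j) + (k' + k) \<le> d + (i + j + k)" using pdeg_add_monom.hyps by simp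
  from pdeg.pdeg_add_monom[OF pdeg_add_monom.IH this, of "c' * c"]
  show ?case by (simp add: algebra_simps power_add)
qed

lemma pdeg_mult: "pdeg e Q \<Longrightarrow> pdeg d P \<Longrightarrow> pdeg (d + e) (\<lambda>x y z. P x y z * Q x y z)"
proof (induction rule: pdeg.induct)
  case (pdeg_zero e)
  then show ?case by (simp add: pdeg.pdeg_zero)
next
  case (pdeg_add_monom e Q i j k c)
  have "pdeg (d + e) (\<lambda>x y z. P x y z * (c * x^i * y^j * z^k))"
    by (rule pdeg_mono[OF pdeg_mult_monom[OF pdeg_add_monom.prems]]) (use pdeg_add_monom.hyps in simp)
  from pdeg_add[OF this pdeg_add_monom.IH[OF pdeg_add_monom.prems]]
  show ?case by (simp add: algebra_simps)
qed

text \<open>\<open>is_poly\<close> allows an arbitrary finite set of exponents, while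
  \<open>pdeg\<close> adds one monomial at a time under a degree bound. The second form supports
  induction and lets the divisions below recurse on the degree.\<close>

lemma is_poly_iff_pdeg: "is_poly P \<longleftrightarrow> (\<exists>d. pdeg d P)"
proof
  assume "is_poly P"
  then obtain S and c :: "nat \<times> nat \<times> nat \<Rightarrow> complex" where S: "finite S"
    and P: "\<And>x y z. P x y z = (\<Sum>(i,j,k)\<in>S. c (i,j,k) * x^i * y^j * z^k)"
    unfolding is_poly_def by blast
  have *: "pdeg (\<Sum>(i,j,k)\<in>T. i + j + k) (\<lambda>x y z. \<Sum>(i,j,k)\<in>T. c (i,j,k) * x^i * y^j * z^k)"
    if "finite T" for T
    using that
  proof (induction T)
    case empty
    show ?case by (simp add: pdeg_zero)
  next
    case (insert s T)
    obtain i j k where s: "s = (i,j,k)" by (metis prod_cases3)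
    let ?d = "\<Sum>(i,j,k)\<in>insert s T. i + j + k"
    have d: "?d = i + j + k + (\<Sum>(i,j,k)\<in>T. i + j + k)" using insert.hyps s by simp
    have "pdeg ?d (\<lambda>x y z. \<Sum>(i,j,k)\<in>T. c (i,j,k) * x^i * y^j * z^k)"
      by (rule pdeg_mono[OF insert.IH]) (use d in simp)
    moreover have "pdeg ?d (\<lambda>x y z. c (i,j,k) * x^i * y^j * z^k)"
      by (rule pdeg_monom) (use d in simp)
    ultimately have "pdeg ?d (\<lambda>x y z. c (i,j,k) * x^i * y^j * z^k
        + (\<Sum>(i,j,k)\<in>T. c (i,j,k) * x^i * y^j * z^k))"
      by (rule pdeg_add)
    then show ?case using insert.hyps s by simp
  qed
  have "P = (\<lambda>x y z. \<Sum>(i,j,k)\<in>S. c (i,j,k) * x^i * y^j * z^k)" using P by (intro ext) simp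
  then show "\<exists>d. pdeg d P" using *[OF S] by metis
next
  assume "\<exists>d. pdeg d P"
  then obtain d where "pdeg d P" by blast
  then show "is_poly P"
  proof (induction rule: pdeg.induct)
    case (pdeg_zero d)
    show ?case unfolding is_poly_def by (rule exI[of _ "{}"]) simp
  next
    case (pdeg_add_monom d P i j k c0)
    then obtain S and c :: "nat \<times> nat \<times> nat \<Rightarrow> complex" where S: "finite S"
      and P: "\<And>x y z. P x y z = (\<Sum>(i,j,k)\<in>S. c (i,j,k) * x^i * y^j * z^k)"
      unfolding is_poly_def by blast
    define c' where "c' s = (if s \<in> S then c s else 0) + (if s = (i,j,k) then c0 else 0)" for s
    have "P x y z + c0 * x^i * y^j * z^k
        = (\<Sum>(i,j,k)\<in>insert (i,j,k) S. c' (i,j,k) * x^i * y^j * z^k)" for x y z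
    proof -
      define m where "m s = (case s of (i,j,k) \<Rightarrow> x^i * y^j * z^k)" for s :: "nat \<times> nat \<times> nat"
      have "(\<Sum>(i,j,k)\<in>insert (i,j,k) S. c' (i,j,k) * x^i * y^j * z^k)
          = (\<Sum>s\<in>insert (i,j,k) S. c' s * m s)"
        by (rule sum.cong) (auto simp: m_def)
      also have "\<dots> = (\<Sum>s\<in>insert (i,j,k) S. (if s \<in> S then c s * m s else 0))
          + (\<Sum>s\<in>insert (i,j,k) S. (if s = (i,j,k) then c0 * m s else 0))"
        unfolding sum.distrib[symmetric] by (rule sum.cong) (auto simp: c'_def algebra_simps)
      also have "(\<Sum>s\<in>insert (i,j,k) S. (if s \<in> S then c s * m s else 0)) = (\<Sum>s\<in>S. c s * m s)"
        by (rule sum.mono_neutral_cong_right) (use S in auto)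
      also have "(\<Sum>s\<in>insert (i,j,k) S. (if s = (i,j,k) then c0 * m s else 0)) = c0 * m (i,j,k)"
        using S by (subst sum.delta) auto
      also have "(\<Sum>s\<in>S. c s * m s) = P x y z"
        unfolding P by (rule sum.cong) (auto simp: m_def)
      finally show ?thesis by (simp add: m_def)
    qed
    then show ?case unfolding is_poly_def using S
      by (intro exI[of _ "insert (i,j,k) S"] exI[of _ c']) auto
  qed
qed

lemma is_poly_const [intro]: "is_poly (\<lambda>x y z. c)"
  using pdeg_monom[of 0 0 0 0 c] is_poly_iff_pdeg by auto

lemma is_poly_X [intro]: "is_poly (\<lambda>x y z. x)"
  using pdeg_monom[of 1 0 0 1 1] is_poly_iff_pdeg by auto

lemma is_poly_Y [intro]: "is_poly (\<lambda>x y z. y)"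
  using pdeg_monom[of 0 1 0 1 1] is_poly_iff_pdeg by auto

lemma is_poly_Z [intro]: "is_poly (\<lambda>x y z. z)"
  using pdeg_monom[of 0 0 1 1 1] is_poly_iff_pdeg by auto

lemma is_poly_add [intro]:
  assumes "is_poly P" "is_poly Q" shows "is_poly (\<lambda>x y z. P x y z + Q x y z)"
proof -
  obtain d e where "pdeg d P" "pdeg e Q" using assms is_poly_iff_pdeg by auto
  then have "pdeg (max d e) P" "pdeg (max d e) Q" by (auto intro: pdeg_mono)
  then show ?thesis using pdeg_add is_poly_iff_pdeg by blast
qed

lemma is_poly_mult [intro]:
  assumes "is_poly P" "is_poly Q" shows "is_poly (\<lambda>x y z. P x y z * Q x y z)"
  using assms pdeg_mult unfolding is_poly_iff_pdeg by blast

lemma is_poly_uminus [intro]: "is_poly P \<Longrightarrow> is_poly (\<lambda>x y z. - P x y z)"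
  using is_poly_mult[OF is_poly_const[of "-1"], of P] by simp

lemma is_poly_diff [intro]:
  "is_poly P \<Longrightarrow> is_poly Q \<Longrightarrow> is_poly (\<lambda>x y z. P x y z - Q x y z)"
  using is_poly_add[OF _ is_poly_uminus, of P Q] by simp

lemma is_poly_divide_const [intro]: "is_poly P \<Longrightarrow> is_poly (\<lambda>x y z. P x y z / c)"
  using is_poly_mult[OF _ is_poly_const[of "inverse c"], of P] by (simp add: field_simps)

lemma is_poly_power [intro]: "is_poly P \<Longrightarrow> is_poly (\<lambda>x y z. P x y z ^ n)"
  by (induction n) auto

lemma is_poly_sum [intro]:
  "(\<And>i. i \<in> I \<Longrightarrow> is_poly (p i)) \<Longrightarrow> is_poly (\<lambda>x y z. \<Sum>i\<in>I. p i x y z)"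
  by (induction I rule: infinite_finite_induct) auto

lemmas is_poly_intros = is_poly_const is_poly_X is_poly_Y is_poly_Z is_poly_add is_poly_mult
  is_poly_uminus is_poly_diff is_poly_divide_const is_poly_power

text \<open>Substitution, restriction to lines and differentiation are compatible with sums and
  products, so a structural induction over the ring operations suits them better than one over
  monomials.\<close>

lemma is_poly_induct [consumes 1, case_names const X Y Z add mult]:
  assumes "is_poly P"
    and const: "\<And>c. R (\<lambda>x y z. c)"
    and X: "R (\<lambda>x y z. x)" and Y: "R (\<lambda>x y z. y)" and Z: "R (\<lambda>x y z. z)"
    and add: "\<And>P Q. is_poly P \<Longrightarrow> is_poly Q \<Longrightarrow> R P \<Longrightarrow> R Q \<Longrightarrow> R (\<lambda>x y z. P x y z + Q x y z)"
    and mult: "\<And>P Q. is_poly P \<Longrightarrow> is_poly Q \<Longrightarrow> R P \<Longrightarrow> R Q \<Longrightarrow> R (\<lambda>x y z. P x y z * Q x y z)"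
  shows "R P"
proof -
  have pow: "R (\<lambda>x y z. P x y z ^ n)" if "is_poly P" "R P" for P n
    by (induction n) (use that const mult in \<open>auto intro!: is_poly_power\<close>)
  have mon: "R (\<lambda>x y z. c * x^i * y^j * z^k)" for c i j k
    by (intro mult pow const X Y Z is_poly_intros)
  obtain d where "pdeg d P" using assms(1) is_poly_iff_pdeg by blast
  then show ?thesis
  proof (induction rule: pdeg.induct)
    case (pdeg_add_monom d P i j k c)
    have "is_poly P" using pdeg_add_monom.hyps is_poly_iff_pdeg by blast
    then show ?case by (intro add mon is_poly_intros pdeg_add_monom.IH)
  qed (rule const)
qed

lemma is_poly_subst:
  assumes "is_poly P" "is_poly U" "is_poly V" "is_poly W"
  shows "is_poly (\<lambda>x y z. P (U x y z) (V x y z) (W x y z))"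
  using assms(1) by (induction rule: is_poly_induct) (use assms(2-) in \<open>auto\<close>)

lemma is_poly_line:
  assumes "is_poly P"
  shows "\<exists>p. \<forall>t. P (a + t * a') (b + t * b') (c + t * c') = poly p t"
  using assms
proof (induction rule: is_poly_induct)
  case (const k) show ?case by (rule exI[of _ "[:k:]"]) simp
next
  case X show ?case by (rule exI[of _ "[:a,a':]"]) simp
next
  case Y show ?case by (rule exI[of _ "[:b,b':]"]) simp
next
  case Z show ?case by (rule exI[of _ "[:c,c':]"]) simp
next
  case (add P Q) then show ?case by (metis poly_add)
next
  case (mult P Q) then show ?case by (metis poly_mult)
qed

text \<open>Join a point where \<open>P\<close> is nonzero to one where \<open>Q\<close> is nonzero.
  On that line both become nonzero univariate polynomials, whose product cannot vanish
  identically.\<close>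

lemma is_poly_no_zero_divisors:
  assumes "is_poly P" "is_poly Q" and 0: "\<And>x y z. P x y z * Q x y z = 0"
  shows "(\<forall>x y z. P x y z = 0) \<or> (\<forall>x y z. Q x y z = 0)"
proof (rule ccontr)
  assume "\<not> ?thesis"
  then obtain a b c a' b' c' where ne: "P a b c \<noteq> 0" "Q a' b' c' \<noteq> 0" by blast
  obtain p where p: "\<And>t. P (a + t * (a' - a)) (b + t * (b' - b)) (c + t * (c' - c)) = poly p t"
    using is_poly_line[OF assms(1)] by blast
  obtain q where q: "\<And>t. Q (a + t * (a' - a)) (b + t * (b' - b)) (c + t * (c' - c)) = poly q t"
    using is_poly_line[OF assms(2)] by blast
  have "poly (p * q) t = 0" for t using 0 by (simp flip: p q)
  then have "p * q = 0" by (metis poly_all_0_iff_0)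
  moreover have "p \<noteq> 0" using p[of 0] ne by auto
  moreover have "q \<noteq> 0" using q[of 1] ne by auto
  ultimately show False by simp
qed

text \<open>\<open>N\<close> may vanish at the point in question, so the cancellation is not
  pointwise; it takes place in the integral domain of polynomials, where one nonzero value of
  \<open>N\<close> suffices.\<close>

lemma is_poly_cancel:
  assumes "is_poly N" "is_poly P" "is_poly Q" "N a b c \<noteq> 0"
    and "\<And>x y z. N x y z * P x y z = N x y z * Q x y z"
  shows "P x y z = Q x y z"
proof -
  have "is_poly (\<lambda>x y z. P x y z - Q x y z)" using assms by blast
  from is_poly_no_zero_divisors[OF assms(1) this] show ?thesis
    using assms(4,5) by (auto simp: algebra_simps)
qed

text \<open>The quotient loses one degree. As \<open>d - 1\<close> is truncated,
  \<open>d = 0\<close> needs the separate clause that the quotient is zero.\<close>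

lemma pdeg_factor_X:
  "pdeg d P \<Longrightarrow> \<exists>R. pdeg (d - 1) R \<and> (d = 0 \<longrightarrow> (\<forall>x y z. R x y z = 0)) \<and>
    (\<forall>x y z. P x y z = P 0 y z + x * R x y z)"
proof (induction rule: pdeg.induct)
  case (pdeg_zero d)
  show ?case by (rule exI[of _ "\<lambda>_ _ _. 0"]) (simp add: pdeg.pdeg_zero)
next
  case (pdeg_add_monom d P i j k c)
  then obtain R where R: "pdeg (d - 1) R" "d = 0 \<longrightarrow> (\<forall>x y z. R x y z = 0)"
    "\<And>x y z. P x y z = P 0 y z + x * R x y z" by blast
  show ?case
  proof (cases i)
    case 0
    have "P x y z + c * x^i * y^j * z^k = P 0 y z + c * 0^i * y^j * z^k + x * R x y z" for x y z
      using R(3)[of x y z] by (simp add: 0)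
    then show ?thesis using R(1,2) by blast
  next
    case (Suc i')
    have "pdeg (d - 1) (\<lambda>x y z. R x y z + c * x^i' * y^j * z^k)"
      by (rule pdeg.pdeg_add_monom[OF R(1)]) (use pdeg_add_monom.hyps Suc in simp)
    moreover have "P x y z + c * x^i * y^j * z^k
        = P 0 y z + c * 0^i * y^j * z^k + x * (R x y z + c * x^i' * y^j * z^k)" for x y z
      using R(3)[of x y z] by (simp add: Suc algebra_simps)
    moreover have "d \<noteq> 0" using pdeg_add_monom.hyps Suc by simp
    ultimately show ?thesis by blast
  qed
qed

lemma pdeg_factor_Z:
  "pdeg d P \<Longrightarrow> \<exists>R. pdeg (d - 1) R \<and> (d = 0 \<longrightarrow> (\<forall>x y z. R x y z = 0)) \<and>
    (\<forall>x y z. P x y z = P x y 0 + z * R x y z)"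
proof (induction rule: pdeg.induct)
  case (pdeg_zero d)
  show ?case by (rule exI[of _ "\<lambda>_ _ _. 0"]) (simp add: pdeg.pdeg_zero)
next
  case (pdeg_add_monom d P i j k c)
  then obtain R where R: "pdeg (d - 1) R" "d = 0 \<longrightarrow> (\<forall>x y z. R x y z = 0)"
    "\<And>x y z. P x y z = P x y 0 + z * R x y z" by blast
  show ?case
  proof (cases k)
    case 0
    have "P x y z + c * x^i * y^j * z^k = P x y 0 + c * x^i * y^j * 0^k + z * R x y z" for x y z
      using R(3)[of x y z] by (simp add: 0)
    then show ?thesis using R(1,2) by blast
  next
    case (Suc k')
    have "pdeg (d - 1) (\<lambda>x y z. R x y z + c * x^i * y^j * z^k')"
      by (rule pdeg.pdeg_add_monom[OF R(1)]) (use pdeg_add_monom.hyps Suc in simp)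
    moreover have "P x y z + c * x^i * y^j * z^k
        = P x y 0 + c * x^i * y^j * 0^k + z * (R x y z + c * x^i * y^j * z^k')" for x y z
      using R(3)[of x y z] by (simp add: Suc algebra_simps)
    moreover have "d \<noteq> 0" using pdeg_add_monom.hyps Suc by simp
    ultimately show ?thesis by blast
  qed
qed

lemma is_poly_factor_X:
  assumes "is_poly P"
  shows "\<exists>R. is_poly R \<and> (\<forall>x y z. P x y z = P 0 y z + x * R x y z)"
  using assms pdeg_factor_X unfolding is_poly_iff_pdeg by blast

lemma is_poly_factor_Y:
  assumes "is_poly P"
  shows "\<exists>R. is_poly R \<and> (\<forall>x y z. P x y z = P x 0 z + y * R x y z)"
proof -
  have "is_poly (\<lambda>x y z. P y x z)"
    by (rule is_poly_subst[OF assms is_poly_Y is_poly_X is_poly_Z])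
  then obtain R where R: "is_poly R" "\<And>x y z. P y x z = P y 0 z + x * R x y z"
    using is_poly_factor_X by blast
  have "is_poly (\<lambda>x y z. R y x z)"
    by (rule is_poly_subst[OF R(1) is_poly_Y is_poly_X is_poly_Z])
  moreover have "P x y z = P x 0 z + y * R y x z" for x y z by (rule R(2))
  ultimately show ?thesis by blast
qed

text \<open>Chain rule. The partials are defined through \<open>deriv\<close>, which says nothing
  before differentiability is known; carrying arbitrary curves through the induction and
  specializing them to coordinate lines provides it.\<close>

lemma is_poly_has_field_derivative:
  assumes "is_poly P"
    and "(u has_field_derivative u') (at t)" "(v has_field_derivative v') (at t)"
      "(w has_field_derivative w') (at t)"
  shows "((\<lambda>t. P (u t) (v t) (w t)) has_field_derivative
    dX P (u t) (v t) (w t) * u' + dY P (u t) (v t) (w t) * v' + dZ P (u t) (v t) (w t) * w') (at t)"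
  using assms
proof (induction arbitrary: u v w u' v' w' t rule: is_poly_induct)
  case (const c)
  show ?case by (simp add: dX_def dY_def dZ_def)
next
  case X
  then show ?case by (simp add: dX_def dY_def dZ_def)
next
  case Y
  then show ?case by (simp add: dX_def dY_def dZ_def)
next
  case Z
  then show ?case by (simp add: dX_def dY_def dZ_def)
next
  case (add P Q)
  have x: "((\<lambda>t. R t y z) has_field_derivative dX R x y z) (at x)"
    "((\<lambda>t. R x t z) has_field_derivative dY R x y z) (at y)"
    "((\<lambda>t. R x y t) has_field_derivative dZ R x y z) (at z)" if "R = P \<or> R = Q" for R x y z
    using that
      add.IH(1)[where u="\<lambda>t. t" and v="\<lambda>_. y" and w="\<lambda>_. z" and t=x, OF DERIV_ident DERIV_const DERIV_const]
      add.IH(1)[where u="\<lambda>_. x" and v="\<lambda>t. t" and w="\<lambda>_. z" and t=y, OF DERIV_const DERIV_ident DERIV_const]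
      add.IH(1)[where u="\<lambda>_. x" and v="\<lambda>_. y" and w="\<lambda>t. t" and t=z, OF DERIV_const DERIV_const DERIV_ident]
      add.IH(2)[where u="\<lambda>t. t" and v="\<lambda>_. y" and w="\<lambda>_. z" and t=x, OF DERIV_ident DERIV_const DERIV_const]
      add.IH(2)[where u="\<lambda>_. x" and v="\<lambda>t. t" and w="\<lambda>_. z" and t=y, OF DERIV_const DERIV_ident DERIV_const]
      add.IH(2)[where u="\<lambda>_. x" and v="\<lambda>_. y" and w="\<lambda>t. t" and t=z, OF DERIV_const DERIV_const DERIV_ident]
    by auto
  have d: "dX (\<lambda>x y z. P x y z + Q x y z) x y z = dX P x y z + dX Q x y z"
    "dY (\<lambda>x y z. P x y z + Q x y z) x y z = dY P x y z + dY Q x y z"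
    "dZ (\<lambda>x y z. P x y z + Q x y z) x y z = dZ P x y z + dZ Q x y z" for x y z
    using x by (auto simp: dX_def[of "\<lambda>x y z. P x y z + Q x y z"] dY_def[of "\<lambda>x y z. P x y z + Q x y z"]
       dZ_def[of "\<lambda>x y z. P x y z + Q x y z"] intro!: DERIV_imp_deriv DERIV_add)
  show ?case unfolding d
    using DERIV_add[OF add.IH(1)[OF add.prems] add.IH(2)[OF add.prems]] by (simp add: algebra_simps)
next
  case (mult P Q)
  have x: "((\<lambda>t. R t y z) has_field_derivative dX R x y z) (at x)"
    "((\<lambda>t. R x t z) has_field_derivative dY R x y z) (at y)"
    "((\<lambda>t. R x y t) has_field_derivative dZ R x y z) (at z)" if "R = P \<or> R = Q" for R x y z
    using that
      mult.IH(1)[where u="\<lambda>t. t" and v="\<lambda>_. y" and w="\<lambda>_. z" and t=x, OF DERIV_ident DERIV_const DERIV_const]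
      mult.IH(1)[where u="\<lambda>_. x" and v="\<lambda>t. t" and w="\<lambda>_. z" and t=y, OF DERIV_const DERIV_ident DERIV_const]
      mult.IH(1)[where u="\<lambda>_. x" and v="\<lambda>_. y" and w="\<lambda>t. t" and t=z, OF DERIV_const DERIV_const DERIV_ident]
      mult.IH(2)[where u="\<lambda>t. t" and v="\<lambda>_. y" and w="\<lambda>_. z" and t=x, OF DERIV_ident DERIV_const DERIV_const]
      mult.IH(2)[where u="\<lambda>_. x" and v="\<lambda>t. t" and w="\<lambda>_. z" and t=y, OF DERIV_const DERIV_ident DERIV_const]
      mult.IH(2)[where u="\<lambda>_. x" and v="\<lambda>_. y" and w="\<lambda>t. t" and t=z, OF DERIV_const DERIV_const DERIV_ident]
    by auto
  have d: "dX (\<lambda>x y z. P x y z * Q x y z) x y z = dX P x y z * Q x y z + dX Q x y z * P x y z"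
    "dY (\<lambda>x y z. P x y z * Q x y z) x y z = dY P x y z * Q x y z + dY Q x y z * P x y z"
    "dZ (\<lambda>x y z. P x y z * Q x y z) x y z = dZ P x y z * Q x y z + dZ Q x y z * P x y z" for x y z
    using x by (auto simp: dX_def[of "\<lambda>x y z. P x y z * Q x y z"] dY_def[of "\<lambda>x y z. P x y z * Q x y z"]
       dZ_def[of "\<lambda>x y z. P x y z * Q x y z"] intro!: DERIV_imp_deriv DERIV_mult)
  show ?case unfolding d
    using DERIV_mult[OF mult.IH(1)[OF mult.prems] mult.IH(2)[OF mult.prems]] by (simp add: algebra_simps)
qed

section \<open>Homogeneity and the scaling law\<close>

lemma hom_poly_imp_is_poly:
  assumes "hom_poly d P" shows "is_poly P"
proof -
  obtain c where c: "\<And>x y z. P x y z = (\<Sum>(i,j)\<in>{(i,j). i + j \<le> d}. c i j * x^i * y^j * z^(d-i-j))"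
    using assms unfolding hom_poly_def by blast
  have "is_poly (\<lambda>x y z. \<Sum>s\<in>{(i,j). i + j \<le> d}. c (fst s) (snd s) * x^fst s * y^snd s * z^(d-fst s-snd s))"
    by (intro is_poly_sum is_poly_intros)
  moreover have "P = (\<lambda>x y z. \<Sum>s\<in>{(i,j). i + j \<le> d}. c (fst s) (snd s) * x^fst s * y^snd s * z^(d-fst s-snd s))"
    unfolding c[abs_def] by (simp add: case_prod_unfold)
  ultimately show ?thesis by simp
qed

lemma hom_poly_scaling:
  assumes "hom_poly d P" shows "P (t * x) (t * y) (t * z) = t ^ d * P x y z"
proof -
  obtain c where c: "\<And>x y z. P x y z = (\<Sum>(i,j)\<in>{(i,j). i + j \<le> d}. c i j * x^i * y^j * z^(d-i-j))"
    using assms unfolding hom_poly_def by blast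
  have "t^i * (t^j * t^(d-i-j)) = t^d" if "i + j \<le> d" for i j
    using that by (simp flip: power_add)
  then show ?thesis unfolding c sum_distrib_left
    by (intro sum.cong) (auto simp: power_mult_distrib algebra_simps)
qed

text \<open>On the ray t(x,y,z) the polynomial is a univariate polynomial in t equal to t^d
  P(x,y,z). Comparing coefficients of t^d leaves only the monomials of total degree d. This turns
  homogeneity into a single ring identity.\<close>

lemma hom_polyI:
  assumes "is_poly P" and scaling: "\<And>t x y z. P (t * x) (t * y) (t * z) = t ^ d * P x y z"
  shows "hom_poly d P"
proof -
  obtain S and c :: "nat \<times> nat \<times> nat \<Rightarrow> complex" where S: "finite S"
    and P: "\<And>x y z. P x y z = (\<Sum>(i,j,k)\<in>S. c (i,j,k) * x^i * y^j * z^k)"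
    using assms(1) unfolding is_poly_def by blast
  define T where "T = {(i,j). i + j \<le> d}"
  define e where "e s = (fst s, snd s, d - fst s - snd s)" for s :: "nat \<times> nat"
  have finT: "finite T" by (rule finite_subset[of _ "{..d} \<times> {..d}"]) (auto simp: T_def)
  have eq: "P x y z = (\<Sum>(i,j)\<in>T. (if (i,j,d-i-j) \<in> S then c (i,j,d-i-j) else 0) * x^i * y^j * z^(d-i-j))"
    for x y z
  proof -
    define m where "m s = (case s of (i,j,k) \<Rightarrow> c (i,j,k) * x^i * y^j * z^k)" for s
    define g where "g s = (case s of (i,j,k) \<Rightarrow> i + j + k)" for s :: "nat \<times> nat \<times> nat"
    define p where "p = (\<Sum>s\<in>S. monom (m s) (g s))"
    have "poly p t = poly (monom (P x y z) d) t" for t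
    proof -
      have "poly p t = (\<Sum>s\<in>S. m s * t ^ g s)" by (simp add: p_def poly_sum poly_monom)
      also have "\<dots> = P (t * x) (t * y) (t * z)" unfolding P
        by (rule sum.cong) (auto simp: m_def g_def power_mult_distrib power_add algebra_simps)
      finally show ?thesis using scaling by (simp add: poly_monom mult.commute)
    qed
    then have "p = monom (P x y z) d" using poly_eq_poly_eq_iff by blast
    then have "P x y z = coeff p d" by simp
    also have "\<dots> = (\<Sum>s\<in>S. if g s = d then m s else 0)"
      unfolding p_def by (simp add: coeff_sum)
    also have "\<dots> = (\<Sum>s\<in>S \<inter> e ` T. m s)"
    proof (rule sum.mono_neutral_cong_right)
      show "\<forall>i\<in>S - S \<inter> e ` T. (if g i = d then m i else 0) = 0"
      proof
        fix s assume s: "s \<in> S - S \<inter> e ` T"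
        obtain i j k where ijk: "s = (i,j,k)" by (metis prod_cases3)
        have "g s \<noteq> d"
        proof
          assume "g s = d"
          then have "s = e (i,j)" "(i,j) \<in> T" using ijk by (auto simp: e_def g_def T_def)
          then show False using s by blast
        qed
        then show "(if g s = d then m s else 0) = 0" by simp
      qed
    qed (use S in \<open>auto simp: e_def g_def T_def\<close>)
    also have "\<dots> = (\<Sum>s\<in>e ` T. if s \<in> S then m s else 0)"
      using finT by (subst sum.inter_restrict[symmetric]) (auto simp: Int_commute)
    also have "\<dots> = (\<Sum>s\<in>T. if e s \<in> S then m (e s) else 0)"
      by (rule sum.reindex_cong[of e]) (auto simp: e_def inj_on_def)
    also have "\<dots> = (\<Sum>(i,j)\<in>T. (if (i,j,d-i-j) \<in> S then c (i,j,d-i-j) else 0) * x^i * y^j * z^(d-i-j))"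
      by (rule sum.cong) (auto simp: e_def m_def)
    finally show ?thesis .
  qed
  show ?thesis unfolding hom_poly_def
    by (rule exI[of _ "\<lambda>i j. if (i,j,d-i-j) \<in> S then c (i,j,d-i-j) else 0"])
      (use eq in \<open>simp add: T_def\<close>)
qed

section \<open>Syzygies of the gradient\<close>

lemma is_poly_DERIV:
  assumes "is_poly P"
  shows "((\<lambda>t. P t y z) has_field_derivative dX P x y z) (at x)"
    "((\<lambda>t. P x t z) has_field_derivative dY P x y z) (at y)"
    "((\<lambda>t. P x y t) has_field_derivative dZ P x y z) (at z)"
  using is_poly_has_field_derivative[OF assms, where u="\<lambda>t. t" and v="\<lambda>_. y" and w="\<lambda>_. z" and t=x, OF DERIV_ident DERIV_const DERIV_const]
    is_poly_has_field_derivative[OF assms, where u="\<lambda>_. x" and v="\<lambda>t. t" and w="\<lambda>_. z" and t=y, OF DERIV_const DERIV_ident DERIV_const]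
    is_poly_has_field_derivative[OF assms, where u="\<lambda>_. x" and v="\<lambda>_. y" and w="\<lambda>t. t" and t=z, OF DERIV_const DERIV_const DERIV_ident]
  by simp_all

lemma partials_mult:
  assumes "is_poly P" "is_poly Q"
  shows "dX (\<lambda>x y z. P x y z * Q x y z) = (\<lambda>x y z. dX P x y z * Q x y z + dX Q x y z * P x y z)"
    "dY (\<lambda>x y z. P x y z * Q x y z) = (\<lambda>x y z. dY P x y z * Q x y z + dY Q x y z * P x y z)"
    "dZ (\<lambda>x y z. P x y z * Q x y z) = (\<lambda>x y z. dZ P x y z * Q x y z + dZ Q x y z * P x y z)"
  unfolding dX_def[of "\<lambda>x y z. P x y z * Q x y z"] dY_def[of "\<lambda>x y z. P x y z * Q x y z"]
    dZ_def[of "\<lambda>x y z. P x y z * Q x y z"]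
  by (intro ext DERIV_imp_deriv DERIV_mult is_poly_DERIV assms)+

lemma partials_add:
  assumes "is_poly P" "is_poly Q"
  shows "dX (\<lambda>x y z. P x y z + Q x y z) = (\<lambda>x y z. dX P x y z + dX Q x y z)"
    "dY (\<lambda>x y z. P x y z + Q x y z) = (\<lambda>x y z. dY P x y z + dY Q x y z)"
    "dZ (\<lambda>x y z. P x y z + Q x y z) = (\<lambda>x y z. dZ P x y z + dZ Q x y z)"
  unfolding dX_def[of "\<lambda>x y z. P x y z + Q x y z"] dY_def[of "\<lambda>x y z. P x y z + Q x y z"]
    dZ_def[of "\<lambda>x y z. P x y z + Q x y z"]
  by (intro ext DERIV_imp_deriv DERIV_add is_poly_DERIV assms)+

lemma is_poly_partials:
  assumes "is_poly P"
  shows "is_poly (dX P)" "is_poly (dY P)" "is_poly (dZ P)"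
proof -
  have "is_poly (dX P) \<and> is_poly (dY P) \<and> is_poly (dZ P)"
    using assms
  proof (induction rule: is_poly_induct)
    case (add P Q)
    then show ?case by (auto simp: partials_add)
  next
    case (mult P Q)
    then show ?case by (auto simp: partials_mult)
  qed (auto simp: dX_def dY_def dZ_def)
  then show "is_poly (dX P)" "is_poly (dY P)" "is_poly (dZ P)" by auto
qed

text \<open>Powers of \<open>x\<close> and \<open>y\<close> are coprime: putting x = 0 kills the
  cofactor found so far, which therefore contains another factor x. The bound \<open>d - n\<close>
  on the quotient is recorded because \<open>coprime_division\<close> must not raise the
  degree.\<close>

lemma power_division:
  assumes "pdeg d P" "is_poly Q" "\<And>x y z. y^m * P x y z = x^n * Q x y z"
  shows "(\<forall>x y z. P x y z = 0) \<or> (n \<le> d \<and> (\<exists>w. pdeg (d - n) w \<and> (\<forall>x y z. P x y z = x^n * w x y z)))"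
  using assms
proof (induction n arbitrary: Q)
  case 0
  then show ?case by auto
next
  case (Suc n)
  have "is_poly (\<lambda>x y z. x * Q x y z)" by (intro is_poly_intros Suc.prems)
  from Suc.IH[OF Suc.prems(1) this] Suc.prems(3)
  consider "\<forall>x y z. P x y z = 0" | w where "n \<le> d" "pdeg (d - n) w" "\<And>x y z. P x y z = x^n * w x y z"
    by (auto simp: algebra_simps)
  then show ?case
  proof cases
    case 2
    have w: "is_poly w" using 2 is_poly_iff_pdeg by blast
    have yw: "y^m * w x y z = x * Q x y z" for x y z
      by (rule is_poly_cancel[of "\<lambda>x y z. x^n" "\<lambda>x y z. y^m * w x y z" "\<lambda>x y z. x * Q x y z" 1 0 0])
        (use Suc.prems 2 w in \<open>auto simp: algebra_simps intro!: is_poly_intros\<close>)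
    have "is_poly (\<lambda>x y z. w 0 y z)"
      by (rule is_poly_subst[OF w is_poly_const is_poly_Y is_poly_Z])
    moreover have "y^m * w 0 y z = y^m * 0" for y z using yw[of y 0 z] by simp
    ultimately have w0: "w 0 y z = 0" for y z
      by (intro is_poly_cancel[of "\<lambda>x y z. y^m" "\<lambda>x y z. w 0 y z" "\<lambda>x y z. 0" 0 1 0 0 y z])
        (auto intro!: is_poly_intros)
    obtain R where R: "pdeg (d - n - 1) R" "d - n = 0 \<longrightarrow> (\<forall>x y z. R x y z = 0)"
      "\<forall>x y z. w x y z = w 0 y z + x * R x y z" using pdeg_factor_X[OF 2(2)] by (elim exE conjE) (rule that)
    show ?thesis
    proof (cases "d - n = 0")
      case True
      then have "P x y z = 0" for x y z using R(2) R(3)[rule_format, of x y z] 2(3)[of x y z] w0 by simp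
      then show ?thesis by blast
    next
      case False
      have "P x y z = x ^ Suc n * R x y z" for x y z using R(3)[rule_format, of x y z] 2(3)[of x y z] w0 by simp
      moreover have "pdeg (d - Suc n) R" using R(1) by simp
      ultimately show ?thesis using False by auto
    qed
  qed blast
qed

text \<open>\<open>A\<close>, \<open>B\<close> and \<open>z\<close> form a regular sequence of homogeneous elements, so \<open>A\<close> and \<open>B\<close>
  have no common factor; the division is carried out \<open>z\<close>-adically and stops for degree reasons.\<close>

lemma coprime_division:
  assumes A: "pdeg n A" "\<And>x y. A x y 0 = x^n" and B: "is_poly B" "\<And>x y. B x y 0 = y^n"
    and "n > 0" and "pdeg d P" "is_poly Q" "\<And>x y z. B x y z * P x y z = A x y z * Q x y z"
  shows "\<exists>W. is_poly W \<and> (\<forall>x y z. P x y z = A x y z * W x y z)"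
  using assms(6-8)
proof (induction d arbitrary: P Q)
  case 0
  have const: "P x y z = P 0 y 0" for x y z
    using pdeg_factor_X[OF 0(1)] pdeg_factor_Z[OF 0(1)] by (metis add.right_neutral mult_zero_right)
  \<comment> \<open>A constant \<open>P\<close> is determined on the line x = z = 0. There
    \<open>A\<close> vanishes because n > 0, while \<open>B\<close> is y^n.\<close>
  have "P x y z = 0" for x y z
  proof -
    have c: "is_poly P" using 0(1) is_poly_iff_pdeg by blast
    have "is_poly (\<lambda>x y z. P 0 y 0)"
      by (rule is_poly_subst[OF c is_poly_const is_poly_Y is_poly_const])
    moreover have "y^n * P 0 y 0 = y^n * 0" for y
      using 0(3)[of 0 y 0] A(2) B(2) \<open>n > 0\<close> by simp
    ultimately have "P 0 y 0 = 0" for y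
      by (intro is_poly_cancel[of "\<lambda>x y z. y^n" "\<lambda>x y z. P 0 y 0" "\<lambda>x y z. 0" 0 1 0 0 y 0])
        (auto intro!: is_poly_intros)
    then show ?thesis using const by metis
  qed
  then show ?case by (intro exI[of _ "\<lambda>_ _ _. 0"]) auto
next
  case (Suc d)
  have polyA: "is_poly A" using A is_poly_iff_pdeg by blast
  have polyP: "is_poly P" using Suc.prems is_poly_iff_pdeg by blast
  obtain R where R: "pdeg d R" "\<And>x y z. P x y z = P x y 0 + z * R x y z"
    using pdeg_factor_Z[OF Suc.prems(1)] by auto
  have polyR: "is_poly R" using R is_poly_iff_pdeg by blast
  have "pdeg (Suc d) (\<lambda>x y z. P x y 0)"
  proof -
    have *: "pdeg (1 + d) (\<lambda>x y z. z * R x y z)"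
      by (rule pdeg_mult[OF R(1)]) (use pdeg_monom[of 0 0 1 1 1] in simp)
    have "pdeg (0 + (1 + d)) (\<lambda>x y z. -1 * (z * R x y z))"
      by (rule pdeg_mult[OF *]) (use pdeg_monom[of 0 0 0 0 "-1"] in simp)
    from pdeg_add[OF this, of P] Suc.prems(1) have "pdeg (Suc d) (\<lambda>x y z. P x y z - z * R x y z)"
      by simp
    moreover have "P x y z - z * R x y z = P x y 0" for x y z using R(2)[of x y z] by simp
    ultimately show ?thesis by simp
  qed
  moreover have "is_poly (\<lambda>x y z. Q x y 0)"
    by (rule is_poly_subst[OF Suc.prems(2) is_poly_X is_poly_Y is_poly_const])
  moreover have Q0: "y^n * P x y 0 = x^n * Q x y 0" for x y using Suc.prems(3)[of x y 0] A(2) B(2) by simp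
  ultimately consider "\<forall>x y. P x y 0 = 0" | w where "n \<le> Suc d" "pdeg (Suc d - n) w" "\<And>x y z. P x y 0 = x^n * w x y z"
    using power_division[of "Suc d" "\<lambda>x y z. P x y 0" "\<lambda>x y z. Q x y 0" n n] by auto
  \<comment> \<open>On z = 0 the hypothesis reads y^n P = x^n Q, so P = x^n w there. Since w has
    degree at most \<open>Suc d - n\<close>, the product A w stays within degree
    \<open>Suc d\<close>.\<close>
  then obtain w where w: "is_poly w" "pdeg (Suc d) (\<lambda>x y z. A x y z * w x y z)" "\<And>x y z. P x y 0 = x^n * w x y z"
  proof cases
    case 1
    show ?thesis by (rule that[of "\<lambda>_ _ _. 0"]) (use 1 in \<open>auto intro: pdeg_zero\<close>)
  next
    case 2
    show ?thesis
      by (rule that[of w]) (use 2 pdeg_mult[OF 2(2) A(1)] is_poly_iff_pdeg in \<open>auto\<close>)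
  qed
  have Qw: "Q x y 0 = y^n * w x y 0" for x y
  proof -
    have "is_poly (\<lambda>x y z. Q x y 0)" "is_poly (\<lambda>x y z. w x y 0)"
      by (rule is_poly_subst[OF Suc.prems(2) is_poly_X is_poly_Y is_poly_const]
          is_poly_subst[OF w(1) is_poly_X is_poly_Y is_poly_const])+
    then show ?thesis
      by (intro is_poly_cancel[of "\<lambda>x y z. x^n" "\<lambda>x y z. Q x y 0" "\<lambda>x y z. y^n * w x y 0" 1 0 0 x y 0])
        (use Q0 w(3) in \<open>simp_all add: is_poly_intros algebra_simps flip: Q0\<close>)
  qed
  \<comment> \<open>Both P - A w and Q - B w vanish on z = 0. Dividing them by z gives
    \<open>P'\<close> and \<open>Q'\<close> with the same relation, and \<open>P'\<close> has degree
    at most d.\<close>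
  have "pdeg (Suc d) (\<lambda>x y z. P x y z - A x y z * w x y z)"
  proof -
    have "pdeg (0 + Suc d) (\<lambda>x y z. -1 * (A x y z * w x y z))"
      by (rule pdeg_mult[OF w(2)]) (use pdeg_monom[of 0 0 0 0 "-1"] in simp)
    from pdeg_add[OF this, of P] Suc.prems(1) show ?thesis by simp
  qed
  from pdeg_factor_Z[OF this] obtain P' where P': "pdeg d P'"
    "\<And>x y z. P x y z - A x y z * w x y z = P x y 0 - A x y 0 * w x y 0 + z * P' x y z" by auto
  have P'': "P x y z = A x y z * w x y z + z * P' x y z" for x y z
    using P'(2)[of x y z] w(3)[of x y 0] A(2)[of x y] by (simp add: algebra_simps)
  have polyP': "is_poly P'" using P' is_poly_iff_pdeg by blast
  have "is_poly (\<lambda>x y z. Q x y z - B x y z * w x y z)"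
    by (intro is_poly_intros w(1) Suc.prems(2) B(1))
  then obtain d' where "pdeg d' (\<lambda>x y z. Q x y z - B x y z * w x y z)"
    using is_poly_iff_pdeg by blast
  from pdeg_factor_Z[OF this] obtain Q' where Q': "is_poly Q'"
    "\<And>x y z. Q x y z - B x y z * w x y z = Q x y 0 - B x y 0 * w x y 0 + z * Q' x y z"
    using is_poly_iff_pdeg by blast
  have Q'': "Q x y z = B x y z * w x y z + z * Q' x y z" for x y z
    using Q'(2)[of x y z] Qw[of x y] B(2)[of x y] by (simp add: algebra_simps)
  have "B x y z * P' x y z = A x y z * Q' x y z" for x y z
  proof (rule is_poly_cancel[of "\<lambda>x y z. z" "\<lambda>x y z. B x y z * P' x y z" "\<lambda>x y z. A x y z * Q' x y z" 0 0 1])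
    show "z * (B x y z * P' x y z) = z * (A x y z * Q' x y z)" for x y z
      using Suc.prems(3)[of x y z] P''[of x y z] Q''[of x y z] by algebra
  qed (use polyA polyP' B Q' in \<open>auto intro!: is_poly_intros\<close>)
  from Suc.IH[OF P'(1) Q'(1) this] obtain W where W: "is_poly W" "\<And>x y z. P' x y z = A x y z * W x y z"
    by blast
  have "P x y z = A x y z * (w x y z + z * W x y z)" for x y z
    using P''[of x y z] W(2)[of x y z] by (simp add: algebra_simps)
  moreover have "is_poly (\<lambda>x y z. w x y z + z * W x y z)"
    using w(1) W(1) by (intro is_poly_intros)
  ultimately show ?case by blast
qed

text \<open>A certificate that the partial derivatives of \<open>f\<close> have no common factor: they have no
  common zero on the line \<open>z = 0\<close>.\<close>

definition grad_regular :: "cpoly \<Rightarrow> bool" where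
  "grad_regular f \<longleftrightarrow> (\<exists>n U V U' V'. n > 0 \<and> is_poly U \<and> is_poly V \<and> is_poly U' \<and> is_poly V' \<and>
     pdeg n (\<lambda>x y z. U x y z * dX f x y z + V x y z * dY f x y z) \<and>
     (\<forall>x y. U x y 0 * dX f x y 0 + V x y 0 * dY f x y 0 = x^n) \<and>
     (\<forall>x y. U' x y 0 * dX f x y 0 + V' x y 0 * dY f x y 0 = y^n))"

text \<open>A pair proportional to two coprime partials is a polynomial multiple of them. The
  quotient is P / A in the notation of the proof, because A c1 = P f_x and A c2 = P f_y.\<close>

lemma grad_regular_multiple:
  assumes "grad_regular f" "is_poly f" and c: "is_poly c1" "is_poly c2"
    "\<And>x y z. c1 x y z * dY f x y z = c2 x y z * dX f x y z"
  shows "\<exists>h. is_poly h \<and> (\<forall>x y z. c1 x y z = h x y z * dX f x y z \<and> c2 x y z = h x y z * dY f x y z)"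
proof -
  obtain n U V U' V' where n: "n > 0" and poly: "is_poly U" "is_poly V" "is_poly U'" "is_poly V'"
    and deg: "pdeg n (\<lambda>x y z. U x y z * dX f x y z + V x y z * dY f x y z)"
    and x: "\<And>x y. U x y 0 * dX f x y 0 + V x y 0 * dY f x y 0 = x^n"
    and y: "\<And>x y. U' x y 0 * dX f x y 0 + V' x y 0 * dY f x y 0 = y^n"
    using assms(1) unfolding grad_regular_def by blast
  note N = is_poly_partials[OF assms(2)]
  define A B P Q where "A = (\<lambda>x y z. U x y z * dX f x y z + V x y z * dY f x y z)"
    and "B = (\<lambda>x y z. U' x y z * dX f x y z + V' x y z * dY f x y z)"
    and "P = (\<lambda>x y z. U x y z * c1 x y z + V x y z * c2 x y z)"
    and "Q = (\<lambda>x y z. U' x y z * c1 x y z + V' x y z * c2 x y z)"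
  have polys: "is_poly A" "is_poly B" "is_poly P" "is_poly Q"
    unfolding A_def B_def P_def Q_def by (intro is_poly_intros poly c N)+
  obtain d where d: "pdeg d P" using polys is_poly_iff_pdeg by blast
  \<comment> \<open>P / A and Q / B are two expressions for the same ratio c1 / f_x;
    cross-multiplying them puts the ratio in the form that \<open>coprime_division\<close> can
    handle.\<close>
  have "B x y z * P x y z = A x y z * Q x y z" for x y z
    using c(3)[of x y z] unfolding A_def B_def P_def Q_def by algebra
  from coprime_division[OF deg[folded A_def] _ polys(2) _ n d polys(4) this] x y
  obtain W where W: "is_poly W" "\<And>x y z. P x y z = A x y z * W x y z"
    unfolding A_def B_def by blast
  have A1: "A 1 0 0 \<noteq> 0" using x[of 1 0] by (simp add: A_def)
  have "c1 x y z = W x y z * dX f x y z" for x y z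
  proof (rule is_poly_cancel[of "A" "\<lambda>x y z. c1 x y z" "\<lambda>x y z. W x y z * dX f x y z" 1 0 0])
    show "A x y z * c1 x y z = A x y z * (W x y z * dX f x y z)" for x y z
      using W(2)[of x y z] c(3)[of x y z] unfolding A_def P_def by algebra
  qed (use A1 polys W c N in \<open>auto intro!: is_poly_intros\<close>)
  moreover have "c2 x y z = W x y z * dY f x y z" for x y z
  proof (rule is_poly_cancel[of "A" "\<lambda>x y z. c2 x y z" "\<lambda>x y z. W x y z * dY f x y z" 1 0 0])
    show "A x y z * c2 x y z = A x y z * (W x y z * dY f x y z)" for x y z
      using W(2)[of x y z] c(3)[of x y z] unfolding A_def P_def by algebra
  qed (use A1 polys W c N in \<open>auto intro!: is_poly_intros\<close>)
  ultimately show ?thesis using W(1) by blast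
qed

section \<open>Cross products of syzygies and Saito's criterion\<close>

definition cross_grad :: "cpoly \<Rightarrow> csyz \<Rightarrow> csyz \<Rightarrow> cpoly \<Rightarrow> bool" where
  "cross_grad f \<sigma> \<tau> h \<longleftrightarrow> (case \<sigma> of (a,b,c) \<Rightarrow> case \<tau> of (a',b',c') \<Rightarrow> \<forall>x y z.
     b x y z * c' x y z - c x y z * b' x y z = h x y z * dX f x y z \<and>
     c x y z * a' x y z - a x y z * c' x y z = h x y z * dY f x y z \<and>
     a x y z * b' x y z - b x y z * a' x y z = h x y z * dZ f x y z)"

text \<open>At (1,0,0) the first combination in \<open>grad_regular\<close> equals 1. This yields
  the nonzero value that cancelling a partial requires.\<close>

lemma grad_regular_nonzero:
  assumes "grad_regular f"
  obtains "dX f 1 0 0 \<noteq> 0" | "dY f 1 0 0 \<noteq> 0"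
  using assms unfolding grad_regular_def by (metis add_cancel_right_right mult_zero_right power_one zero_neq_one)

lemma ex_cross_grad:
  assumes f: "grad_regular f" "is_poly f" and "is_syz f \<sigma>" "is_syz f \<tau>"
  shows "\<exists>h. is_poly h \<and> cross_grad f \<sigma> \<tau> h"
proof -
  obtain a b c a' b' c' where [simp]: "\<sigma> = (a,b,c)" "\<tau> = (a',b',c')" by (metis prod_cases3)
  have p: "is_poly a" "is_poly b" "is_poly c" "is_poly a'" "is_poly b'" "is_poly c'"
    and s: "\<And>x y z. a x y z * dX f x y z + b x y z * dY f x y z + c x y z * dZ f x y z = 0"
      "\<And>x y z. a' x y z * dX f x y z + b' x y z * dY f x y z + c' x y z * dZ f x y z = 0"
    using assms by (auto simp: is_syz_def)
  note N = is_poly_partials[OF f(2)]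
  obtain h where h: "is_poly h"
    "\<And>x y z. b x y z * c' x y z - c x y z * b' x y z = h x y z * dX f x y z"
    "\<And>x y z. c x y z * a' x y z - a x y z * c' x y z = h x y z * dY f x y z"
  proof -
    have *: "(b x y z * c' x y z - c x y z * b' x y z) * dY f x y z
        = (c x y z * a' x y z - a x y z * c' x y z) * dX f x y z" for x y z
      using s(1)[of x y z] s(2)[of x y z] by algebra
    have "is_poly (\<lambda>x y z. b x y z * c' x y z - c x y z * b' x y z)"
      "is_poly (\<lambda>x y z. c x y z * a' x y z - a x y z * c' x y z)" by (intro is_poly_intros p)+
    from grad_regular_multiple[OF f this *] show ?thesis using that by blast
  qed
  \<comment> \<open>The quotient \<open>h\<close> was found from the first two components. The third
    follows from orthogonality to the gradient after multiplying by whichever of f_x, f_y can be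
    cancelled.\<close>
  have "a x y z * b' x y z - b x y z * a' x y z = h x y z * dZ f x y z" for x y z
    using f(1)
  proof (cases rule: grad_regular_nonzero)
    case 1
    show ?thesis
    proof (rule is_poly_cancel[of "dX f" "\<lambda>x y z. a x y z * b' x y z - b x y z * a' x y z" "\<lambda>x y z. h x y z * dZ f x y z" 1 0 0])
      show "dX f x y z * (a x y z * b' x y z - b x y z * a' x y z) = dX f x y z * (h x y z * dZ f x y z)"
        for x y z using s(1)[of x y z] s(2)[of x y z] h(2)[of x y z] by algebra
    qed (use 1 p h N in \<open>auto intro!: is_poly_intros\<close>)
  next
    case 2
    show ?thesis
    proof (rule is_poly_cancel[of "dY f" "\<lambda>x y z. a x y z * b' x y z - b x y z * a' x y z" "\<lambda>x y z. h x y z * dZ f x y z" 1 0 0])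
      show "dY f x y z * (a x y z * b' x y z - b x y z * a' x y z) = dY f x y z * (h x y z * dZ f x y z)"
        for x y z using s(1)[of x y z] s(2)[of x y z] h(3)[of x y z] by algebra
    qed (use 2 p h N in \<open>auto intro!: is_poly_intros\<close>)
  qed
  with h show ?thesis unfolding cross_grad_def by auto
qed

text \<open>Three syzygies lie in the plane orthogonal to the gradient, so they are dependent with
  their pairwise cross products as coefficients. All of these are multiples of the gradient, and
  dividing by one of its components leaves a relation between the \<open>h\<close>s.\<close>

lemma cross_grad_cramer:
  assumes f: "grad_regular f" "is_poly f"
    and s: "is_syz f (a0,b0,c0)" "is_syz f (a1,b1,c1)" "is_syz f (a2,b2,c2)"
    and h: "is_poly h01" "is_poly h02" "is_poly h12"
      "cross_grad f (a0,b0,c0) (a1,b1,c1) h01" "cross_grad f (a0,b0,c0) (a2,b2,c2) h02"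
      "cross_grad f (a1,b1,c1) (a2,b2,c2) h12"
  shows "a0 x y z * h12 x y z = a1 x y z * h02 x y z - a2 x y z * h01 x y z"
    "b0 x y z * h12 x y z = b1 x y z * h02 x y z - b2 x y z * h01 x y z"
    "c0 x y z * h12 x y z = c1 x y z * h02 x y z - c2 x y z * h01 x y z"
proof -
  note N = is_poly_partials[OF f(2)]
  obtain n where n: "is_poly n" "n 1 0 0 \<noteq> 0" "n = dX f \<or> n = dY f"
    using grad_regular_nonzero[OF f(1)] N by metis
  have p: "is_poly a0" "is_poly b0" "is_poly c0" "is_poly a1" "is_poly b1" "is_poly c1"
    "is_poly a2" "is_poly b2" "is_poly c2"
    using s by (auto simp: is_syz_def)
  have e: "a0 x y z * dX f x y z + b0 x y z * dY f x y z + c0 x y z * dZ f x y z = 0"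
    "b1 x y z * c2 x y z - c1 x y z * b2 x y z = h12 x y z * dX f x y z"
    "c1 x y z * a2 x y z - a1 x y z * c2 x y z = h12 x y z * dY f x y z"
    "a1 x y z * b2 x y z - b1 x y z * a2 x y z = h12 x y z * dZ f x y z"
    "b0 x y z * c2 x y z - c0 x y z * b2 x y z = h02 x y z * dX f x y z"
    "c0 x y z * a2 x y z - a0 x y z * c2 x y z = h02 x y z * dY f x y z"
    "a0 x y z * b2 x y z - b0 x y z * a2 x y z = h02 x y z * dZ f x y z"
    "b0 x y z * c1 x y z - c0 x y z * b1 x y z = h01 x y z * dX f x y z"
    "c0 x y z * a1 x y z - a0 x y z * c1 x y z = h01 x y z * dY f x y z"
    "a0 x y z * b1 x y z - b0 x y z * a1 x y z = h01 x y z * dZ f x y z" for x y z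
    using s h by (auto simp: is_syz_def cross_grad_def)
  have "n x y z * (a0 x y z * h12 x y z) = n x y z * (a1 x y z * h02 x y z - a2 x y z * h01 x y z) \<and>
    n x y z * (b0 x y z * h12 x y z) = n x y z * (b1 x y z * h02 x y z - b2 x y z * h01 x y z) \<and>
    n x y z * (c0 x y z * h12 x y z) = n x y z * (c1 x y z * h02 x y z - c2 x y z * h01 x y z)" for x y z
    using n(3)
  proof
    assume [simp]: "n = dX f"
    show ?thesis using e[of x y z] by (simp, intro conjI; algebra)
  next
    assume [simp]: "n = dY f"
    show ?thesis using e[of x y z] by (simp, intro conjI; algebra)
  qed
  note nz = this
  show "a0 x y z * h12 x y z = a1 x y z * h02 x y z - a2 x y z * h01 x y z"
    by (rule is_poly_cancel[of n "\<lambda>x y z. a0 x y z * h12 x y z"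
          "\<lambda>x y z. a1 x y z * h02 x y z - a2 x y z * h01 x y z" 1 0 0])
      (use nz n p h in \<open>auto intro!: is_poly_intros\<close>)
  show "b0 x y z * h12 x y z = b1 x y z * h02 x y z - b2 x y z * h01 x y z"
    by (rule is_poly_cancel[of n "\<lambda>x y z. b0 x y z * h12 x y z"
          "\<lambda>x y z. b1 x y z * h02 x y z - b2 x y z * h01 x y z" 1 0 0])
      (use nz n p h in \<open>auto intro!: is_poly_intros\<close>)
  show "c0 x y z * h12 x y z = c1 x y z * h02 x y z - c2 x y z * h01 x y z"
    by (rule is_poly_cancel[of n "\<lambda>x y z. c0 x y z * h12 x y z"
          "\<lambda>x y z. c1 x y z * h02 x y z - c2 x y z * h01 x y z" 1 0 0])
      (use nz n p h in \<open>auto intro!: is_poly_intros\<close>)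
qed

text \<open>For explicit syzygies this reduces the computation of the cross product to one
  polynomial identity: the factor is unique because \<open>dZ f\<close> is not the zero
  polynomial.\<close>

lemma cross_grad_third:
  assumes f: "grad_regular f" "is_poly f" "dZ f u v w \<noteq> 0" and s: "is_syz f (a,b,c)" "is_syz f (a',b',c')"
    and h: "is_poly h" "\<And>x y z. a x y z * b' x y z - b x y z * a' x y z = h x y z * dZ f x y z"
  shows "cross_grad f (a,b,c) (a',b',c') h"
proof -
  obtain h' where h': "is_poly h'" "cross_grad f (a,b,c) (a',b',c') h'"
    using ex_cross_grad[OF f(1,2) s] by blast
  have "h' x y z = h x y z" for x y z
    by (rule is_poly_cancel[OF is_poly_partials(3)[OF f(2)] h'(1) h(1) f(3)])
      (use h' h(2) in \<open>auto simp: cross_grad_def mult.commute\<close>)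
  then have "h' = h" by (intro ext)
  then show ?thesis using h' by simp
qed

lemma free_if_cross_constant:
  assumes f: "grad_regular f" "is_poly f" and nz: "dZ f u v w \<noteq> 0"
    and s: "is_syz f (a,b,c)" "is_syz f (a',b',c')"
    and hom: "hom_syz d1 (a,b,c)" "hom_syz d2 (a',b',c')"
    and k: "k \<noteq> 0" "\<And>x y z. a x y z * b' x y z - b x y z * a' x y z = k * dZ f x y z"
  shows "free_with_exponents f [d1, d2]"
proof -
  define \<rho> where "\<rho> i = (if i = 0 then (a,b,c) else (a',b',c'))" for i :: nat
  have cr: "cross_grad f (a,b,c) (a',b',c') (\<lambda>x y z. k)"
    by (rule cross_grad_third[OF f nz s is_poly_const k(2)])
  have "generates_AR f 2 \<rho>"
    unfolding generates_AR_def
  proof (intro allI impI)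
    fix \<sigma> assume "is_syz f \<sigma>"
    obtain a0 b0 c0 where \<sigma>: "\<sigma> = (a0,b0,c0)" by (metis prod_cases3)
    with \<open>is_syz f \<sigma>\<close> have s0: "is_syz f (a0,b0,c0)" by simp
    obtain h1 where h1: "is_poly h1" "cross_grad f (a0,b0,c0) (a,b,c) h1"
      using ex_cross_grad[OF f s0 s(1)] by blast
    obtain h2 where h2: "is_poly h2" "cross_grad f (a0,b0,c0) (a',b',c') h2"
      using ex_cross_grad[OF f s0 s(2)] by blast
    note e = cross_grad_cramer[OF f s0 s h1(1) h2(1) is_poly_const h1(2) h2(2) cr]
    \<comment> \<open>By Cramer, k sigma = h2 rho_0 - h1 rho_1; k is a nonzero constant, so division
      by it stays polynomial.\<close>
    define p where "p i = (if i = 0 then (\<lambda>x y z. h2 x y z / k) else (\<lambda>x y z. - h1 x y z / k))" for i :: nat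
    have "\<sigma> = combo 2 p \<rho>"
      unfolding \<sigma> combo_def
      by (simp add: p_def \<rho>_def numeral_2_eq_2 fun_eq_iff) (use e k(1) in \<open>auto simp: field_simps\<close>)
    moreover have "\<forall>i<2. is_poly (p i)" using h1 h2 by (auto simp: p_def)
    ultimately show "\<exists>p. (\<forall>i<2. is_poly (p i)) \<and> \<sigma> = combo 2 p \<rho>" by blast
  qed
  moreover have "\<forall>i<2. p i = zero_poly"
    if p: "\<forall>i<2. is_poly (p i)" "combo 2 p \<rho> = (zero_poly, zero_poly, zero_poly)" for p
  proof -
    have e: "p 0 x y z * a x y z + p (Suc 0) x y z * a' x y z = 0"
      "p 0 x y z * b x y z + p (Suc 0) x y z * b' x y z = 0" for x y z
      using p(2) by (simp_all add: combo_def \<rho>_def numeral_2_eq_2 fun_eq_iff zero_poly_def)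
    \<comment> \<open>Eliminating either coefficient from the first two components multiplies the
      other one by their determinant, which is k f_z.\<close>
    have "p 0 x y z * k * dZ f x y z = 0" "p (Suc 0) x y z * k * dZ f x y z = 0" for x y z
      using e[of x y z] k(2)[of x y z] by algebra+
    then have "p i x y z = 0" if "i < 2" for i x y z
    proof -
      have "dZ f x y z * p i x y z = dZ f x y z * 0" for x y z
        using \<open>p 0 x y z * k * dZ f x y z = 0\<close> \<open>p (Suc 0) x y z * k * dZ f x y z = 0\<close> k(1) \<open>i < 2\<close>
        by (cases i) auto
      then show ?thesis
        using is_poly_cancel[OF is_poly_partials(3)[OF f(2)] _ is_poly_const nz, of "p i" 0 x y z] p(1) that by blast
    qed
    then show ?thesis by (auto simp: zero_poly_def fun_eq_iff)
  qed
  moreover have "\<forall>i<2. is_syz f (\<rho> i) \<and> hom_syz ([d1, d2] ! i) (\<rho> i)"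
    using s hom by (simp add: \<rho>_def nth_Cons')
  moreover have "length [d1, d2] = 2" by simp
  ultimately show ?thesis unfolding free_with_exponents_def by metis
qed

section \<open>Division modulo x and y\<close>

lemma is_poly_vanish_on_z_axis:
  assumes "is_poly P" "\<And>z. P 0 0 z = 0"
  obtains p q where "is_poly p" "is_poly q" "\<And>x y z. P x y z = x * p x y z + y * q x y z"
proof -
  obtain p where p: "is_poly p" "\<And>x y z. P x y z = P 0 y z + x * p x y z"
    using is_poly_factor_X[OF assms(1)] by blast
  have "is_poly (\<lambda>x y z. P 0 y z)"
    by (rule is_poly_subst[OF assms(1) is_poly_const is_poly_Y is_poly_Z])
  then obtain q where q: "is_poly q" "\<And>x y z. P 0 y z = P 0 0 z + y * q x y z"
    using is_poly_factor_Y[of "\<lambda>x y z. P 0 y z"] by blast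
  show ?thesis
  proof (rule that[OF p(1) q(1)])
    show "P x y z = x * p x y z + y * q x y z" for x y z
      using p(2)[of x y z] q(2)[of y z x] assms(2) by simp
  qed
qed

text \<open>Only Koszul relations exist between x and y: on y = 0 the equation forces U = 0, so y
  divides U, and cancelling y gives V.\<close>

lemma xy_division:
  assumes "is_poly U" "is_poly V" "\<And>x y z. x * U x y z = y * V x y z"
  obtains T where "is_poly T" "\<And>x y z. U x y z = y * T x y z" "\<And>x y z. V x y z = x * T x y z"
proof -
  obtain T where T: "is_poly T" "\<And>x y z. U x y z = U x 0 z + y * T x y z"
    using is_poly_factor_Y[OF assms(1)] by blast
  have "is_poly (\<lambda>x y z. U x 0 z)"
    by (rule is_poly_subst[OF assms(1) is_poly_X is_poly_const is_poly_Z])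
  moreover have "x * U x 0 z = x * 0" for x z using assms(3)[of x 0 z] by simp
  ultimately have "U x 0 z = 0" for x z
    by (intro is_poly_cancel[of "\<lambda>x y z. x" "\<lambda>x y z. U x 0 z" "\<lambda>x y z. 0" 1 0 0 x 0 z])
      (auto intro!: is_poly_intros)
  then have U: "U x y z = y * T x y z" for x y z using T(2)[of x y z] by simp
  moreover have "V x y z = x * T x y z" for x y z
  proof (rule is_poly_cancel[of "\<lambda>x y z. y" V "\<lambda>x y z. x * T x y z" 0 1 0])
    show "y * V x y z = y * (x * T x y z)" for x y z
      using assms(3)[of x y z] U[of x y z] by algebra
  qed (use assms T(1) in \<open>auto intro!: is_poly_intros\<close>)
  ultimately show ?thesis using that T(1) by blast
qed

text \<open>At z = 0 the hypothesis is void; the value there follows because a polynomial on the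
  axis cannot vanish away from the origin alone.\<close>

lemma is_poly_axis_cancel:
  assumes "is_poly P" "\<And>z. z * P 0 0 z = 0"
  shows "P 0 0 z = 0"
  using is_poly_cancel[of "\<lambda>x y z. z" "\<lambda>x y z. P 0 0 z" "\<lambda>x y z. 0" 0 0 1 0 0 z] assms
    is_poly_subst[OF assms(1) is_poly_const is_poly_const is_poly_Z] by (auto intro!: is_poly_intros)

text \<open>The functions \<open>hA, hB, hP, hQ\<close> will be the cross products of an arbitrary syzygy with four
  given ones; their relations are those of the four syzygies.\<close>

lemma koszul_solution:
  assumes "is_poly hA" "is_poly hB" "is_poly hP" "is_poly hQ"
    and 1: "\<And>x y z. x * hA x y z + y * hQ x y z = z * hP x y z"
    and 2: "\<And>x y z. y * hB x y z + z * hQ x y z = m * (x * hP x y z)" and "m \<noteq> 0"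
  obtains \<alpha> \<beta> \<gamma> \<delta> where "is_poly \<alpha>" "is_poly \<beta>" "is_poly \<gamma>" "is_poly \<delta>"
    "\<And>x y z. hP x y z = y^2 * \<alpha> x y z + x * z * \<beta> x y z - x * y * \<delta> x y z"
    "\<And>x y z. hQ x y z = y * z * \<alpha> x y z + m * x^2 * \<beta> x y z + x * y * \<gamma> x y z"
proof -
  \<comment> \<open>On the axis x = y = 0 the first relation reduces to z hP = 0 and the second to z
    hQ = 0. Hence both lie in the ideal (x, y), and collecting multiples of x and of y in each
    relation gives an instance of \<open>xy_division\<close>.\<close>
  have "z * hP 0 0 z = 0" for z using 1[of 0 0 z] by simp
  from is_poly_vanish_on_z_axis[OF assms(3) is_poly_axis_cancel[OF assms(3) this]]
  obtain p1 p2 where p: "is_poly p1" "is_poly p2" "\<And>x y z. hP x y z = x * p1 x y z + y * p2 x y z"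
    by blast
  have "z * hQ 0 0 z = 0" for z using 2[of 0 0 z] by simp
  from is_poly_vanish_on_z_axis[OF assms(4) is_poly_axis_cancel[OF assms(4) this]]
  obtain q1 q2 where q: "is_poly q1" "is_poly q2" "\<And>x y z. hQ x y z = x * q1 x y z + y * q2 x y z"
    by blast
  have *: "x * (hA x y z + y * q1 x y z - z * p1 x y z) = y * (z * p2 x y z - y * q2 x y z)" for x y z
    using 1[of x y z] p(3)[of x y z] q(3)[of x y z] by algebra
  have "is_poly (\<lambda>x y z. hA x y z + y * q1 x y z - z * p1 x y z)" "is_poly (\<lambda>x y z. z * p2 x y z - y * q2 x y z)"
    by (intro is_poly_intros p q assms(1-4))+
  then obtain t where t': "is_poly t"
    "\<And>x y z. hA x y z + y * q1 x y z - z * p1 x y z = y * t x y z"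
    "\<And>x y z. z * p2 x y z - y * q2 x y z = x * t x y z"
    by (rule xy_division[OF _ _ *]) (rule that)
  note t = t'(1,3)
  have *: "x * (m * (x * p1 x y z) - z * q1 x y z) = y * (hB x y z + z * q2 x y z - m * (x * p2 x y z))" for x y z
    using 2[of y x z] p(3)[of x y z] q(3)[of x y z] by algebra
  have "is_poly (\<lambda>x y z. m * (x * p1 x y z) - z * q1 x y z)" "is_poly (\<lambda>x y z. hB x y z + z * q2 x y z - m * (x * p2 x y z))"
    by (intro is_poly_intros p q assms(1-4))+
  then obtain s where s': "is_poly s"
    "\<And>x y z. m * (x * p1 x y z) - z * q1 x y z = y * s x y z"
    "\<And>x y z. hB x y z + z * q2 x y z - m * (x * p2 x y z) = x * s x y z"
    by (rule xy_division[OF _ _ *]) (rule that)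
  note s = s'(1,2)
  \<comment> \<open>The relation z p2 - y q2 = x t has the same shape as the original ones, so one
    further round of division determines p2 and q2 up to b, a and g.\<close>
  have "z * p2 0 0 z = 0" for z using t(2)[of z 0 0] by simp
  from is_poly_vanish_on_z_axis[OF p(2) is_poly_axis_cancel[OF p(2) this]]
  obtain a b where ab: "is_poly a" "is_poly b" "\<And>x y z. p2 x y z = x * a x y z + y * b x y z"
    by blast
  have *: "x * (z * a x y z - t x y z) = y * (q2 x y z - z * b x y z)" for x y z
    using t(2)[of z x y] ab(3)[of x y z] by algebra
  have "is_poly (\<lambda>x y z. z * a x y z - t x y z)" "is_poly (\<lambda>x y z. q2 x y z - z * b x y z)"
    by (intro is_poly_intros ab q t)+
  then obtain g where g': "is_poly g"
    "\<And>x y z. z * a x y z - t x y z = y * g x y z"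
    "\<And>x y z. q2 x y z - z * b x y z = x * g x y z"
    by (rule xy_division[OF _ _ *]) (rule that)
  note g = g'(1,3)
  \<comment> \<open>The same round for m x p1 - z q1 = y s, now determining q1 and p1 up to d, e and
    n.\<close>
  have "z * q1 0 0 z = 0" for z using s(2)[of 0 0 z] by simp
  from is_poly_vanish_on_z_axis[OF q(1) is_poly_axis_cancel[OF q(1) this]]
  obtain d e where de: "is_poly d" "is_poly e" "\<And>x y z. q1 x y z = x * d x y z + y * e x y z"
    by blast
  have *: "x * (z * d x y z - m * p1 x y z) = y * (- s x y z - z * e x y z)" for x y z
    using s(2)[of x y z] de(3)[of x y z] by algebra
  have "is_poly (\<lambda>x y z. z * d x y z - m * p1 x y z)" "is_poly (\<lambda>x y z. - s x y z - z * e x y z)"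
    by (intro is_poly_intros de p s)+
  then obtain n where n': "is_poly n"
    "\<And>x y z. z * d x y z - m * p1 x y z = y * n x y z"
    "\<And>x y z. - s x y z - z * e x y z = x * n x y z"
    by (rule xy_division[OF _ _ *]) (rule that)
  note n = n'(1,2)
  \<comment> \<open>Substituting p2 = x a + y b, q2 = z b + x g, q1 = x d + y e and m p1 = z d - y n
    into hP and hQ gives the four coefficients; the division by m comes from p1.\<close>
  show ?thesis
  proof (rule that[of b "\<lambda>x y z. d x y z / m" "\<lambda>x y z. e x y z + g x y z" "\<lambda>x y z. n x y z / m - a x y z"])
    show "hP x y z = y^2 * b x y z + x * z * (d x y z / m) - x * y * (n x y z / m - a x y z)" for x y z
    proof -
      obtain D N where D: "D = d x y z / m" "N = n x y z / m" by blast
      then have *: "d x y z = m * D" "n x y z = m * N" using \<open>m \<noteq> 0\<close> by simp_all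
      have "m * hP x y z = m * y^2 * b x y z + x * z * d x y z - x * y * (n x y z - m * a x y z)"
        using p(3)[of x y z] ab(3)[of x y z] n(2)[of z x y] by algebra
      also have "\<dots> = m * (y^2 * b x y z + x * z * D - x * y * (N - a x y z))"
        unfolding * by (simp add: algebra_simps)
      finally show ?thesis using \<open>m \<noteq> 0\<close> by (simp add: D)
    qed
    show "hQ x y z = y * z * b x y z + m * x^2 * (d x y z / m) + x * y * (e x y z + g x y z)" for x y z
      using q(3)[of x y z] de(3)[of x y z] g(2)[of x y z] \<open>m \<noteq> 0\<close>
      by (simp add: algebra_simps power2_eq_square)
  qed (use ab de g n in \<open>auto\<close>)
qed

section \<open>Three explicit arrangements\<close>

lemma hom_poly_imp_pdeg:
  assumes "hom_poly d P" shows "pdeg d P"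
proof -
  obtain c where c: "\<And>x y z. P x y z = (\<Sum>(i,j)\<in>{(i,j). i + j \<le> d}. c i j * x^i * y^j * z^(d-i-j))"
    using assms unfolding hom_poly_def by blast
  have "pdeg d (\<lambda>x y z. \<Sum>(i,j)\<in>T. c i j * x^i * y^j * z^(d-i-j))"
    if "finite T" "T \<subseteq> {(i,j). i + j \<le> d}" for T
    using that
  proof (induction T)
    case empty
    show ?case by (simp add: pdeg_zero)
  next
    case (insert s T)
    obtain i j where s: "s = (i,j)" by (cases s)
    have "pdeg d (\<lambda>x y z. c i j * x^i * y^j * z^(d-i-j))"
      by (rule pdeg_monom) (use insert.prems s in auto)
    moreover have "pdeg d (\<lambda>x y z. \<Sum>(i,j)\<in>T. c i j * x^i * y^j * z^(d-i-j))"
      using insert by simp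
    ultimately have "pdeg d (\<lambda>x y z. c i j * x^i * y^j * z^(d-i-j)
        + (\<Sum>(i,j)\<in>T. c i j * x^i * y^j * z^(d-i-j)))" by (intro pdeg_add)
    then show ?case using insert.hyps s by simp
  qed
  moreover have "finite {(i,j). i + j \<le> d}"
    by (rule finite_subset[of _ "{..d} \<times> {..d}"]) auto
  ultimately have "pdeg d (\<lambda>x y z. \<Sum>(i,j)\<in>{(i,j). i + j \<le> d}. c i j * x^i * y^j * z^(d-i-j))"
    by blast
  moreover have "P = (\<lambda>x y z. \<Sum>(i,j)\<in>{(i,j). i + j \<le> d}. c i j * x^i * y^j * z^(d-i-j))"
    by (intro ext) (rule c)
  ultimately show ?thesis by (simp only:)
qed

text \<open>The denominator of the rational cofactors is cleared by \<kappa>, so that certificates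
  can be given with integer coefficients.\<close>

lemma grad_regularI:
  assumes "n > 0" "\<kappa> \<noteq> 0" "is_poly U" "is_poly V" "is_poly U'" "is_poly V'"
    and "hom_poly k U" "hom_poly k V" "hom_poly l (dX f)" "hom_poly l (dY f)" "k + l = n"
    and x: "\<And>x y. U x y 0 * dX f x y 0 + V x y 0 * dY f x y 0 = \<kappa> * x^n"
    and y: "\<And>x y. U' x y 0 * dX f x y 0 + V' x y 0 * dY f x y 0 = \<kappa> * y^n"
  shows "grad_regular f"
proof -
  have hom: "hom_poly k (\<lambda>x y z. P x y z / \<kappa>)" if "hom_poly k P" for P
    by (rule hom_polyI) (use that in \<open>auto simp: hom_poly_scaling hom_poly_imp_is_poly\<close>)
  have "pdeg n (\<lambda>x y z. U x y z / \<kappa> * dX f x y z + V x y z / \<kappa> * dY f x y z)"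
    unfolding \<open>k + l = n\<close>[symmetric]
    by (rule pdeg_add; rule pdeg_mult; rule hom_poly_imp_pdeg) (intro assms hom)+
  moreover have "U x y 0 / \<kappa> * dX f x y 0 + V x y 0 / \<kappa> * dY f x y 0 = x^n"
    "U' x y 0 / \<kappa> * dX f x y 0 + V' x y 0 / \<kappa> * dY f x y 0 = y^n" for x y
    using x[of x y] y[of x y] \<open>\<kappa> \<noteq> 0\<close> by (simp_all add: field_simps)
  ultimately show ?thesis unfolding grad_regular_def
    by (intro exI[of _ n] exI[of _ "\<lambda>x y z. U x y z / \<kappa>"] exI[of _ "\<lambda>x y z. V x y z / \<kappa>"]
        exI[of _ "\<lambda>x y z. U' x y z / \<kappa>"] exI[of _ "\<lambda>x y z. V' x y z / \<kappa>"]
        conjI allI is_poly_divide_const assms)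
qed

text \<open>The cross product of the third and fourth generators is \<kappa> x y grad f, so Cramer's
  rule gives \<kappa> x y sigma = hQ rho_3 - hP rho_4. The relations rewrite the right-hand side
  with the four generators and an explicit factor x y.\<close>

lemma generated_by_four:
  fixes m \<kappa> :: complex
  assumes \<rho>: "\<rho> = (\<lambda>i::nat. [(a1,b1,c1), (a2,b2,c2), (a3,b3,c3), (a4,b4,c4)] ! i)"
    and f: "grad_regular f" "is_poly f" and nz: "dZ f u v w \<noteq> 0"
    and s: "is_syz f (a1,b1,c1)" "is_syz f (a2,b2,c2)" "is_syz f (a3,b3,c3)" "is_syz f (a4,b4,c4)"
    and rel1: "\<And>x y z. x * a1 x y z + y * a4 x y z = z * a3 x y z"
      "\<And>x y z. x * b1 x y z + y * b4 x y z = z * b3 x y z"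
      "\<And>x y z. x * c1 x y z + y * c4 x y z = z * c3 x y z"
    and rel2: "\<And>x y z. y * a2 x y z + z * a4 x y z = m * (x * a3 x y z)"
      "\<And>x y z. y * b2 x y z + z * b4 x y z = m * (x * b3 x y z)"
      "\<And>x y z. y * c2 x y z + z * c4 x y z = m * (x * c3 x y z)"
    and cr: "\<And>x y z. a3 x y z * b4 x y z - b3 x y z * a4 x y z = \<kappa> * x * y * dZ f x y z"
    and "m \<noteq> 0" "\<kappa> \<noteq> 0"
  shows "generates_AR f 4 \<rho>"
  unfolding generates_AR_def
proof (intro allI impI)
  fix \<sigma> assume \<sigma>0: "is_syz f \<sigma>"
  obtain a b c where \<sigma>: "\<sigma> = (a,b,c)" by (metis prod_cases3)
  with \<sigma>0 have s0: "is_syz f (a,b,c)" by simp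
  obtain hA where hA: "is_poly hA" "cross_grad f (a,b,c) (a1,b1,c1) hA"
    using ex_cross_grad[OF f s0 s(1)] by blast
  obtain hB where hB: "is_poly hB" "cross_grad f (a,b,c) (a2,b2,c2) hB"
    using ex_cross_grad[OF f s0 s(2)] by blast
  obtain hP where hP: "is_poly hP" "cross_grad f (a,b,c) (a3,b3,c3) hP"
    using ex_cross_grad[OF f s0 s(3)] by blast
  obtain hQ where hQ: "is_poly hQ" "cross_grad f (a,b,c) (a4,b4,c4) hQ"
    using ex_cross_grad[OF f s0 s(4)] by blast
  have "is_poly (\<lambda>x y z. \<kappa> * x * y)" by (intro is_poly_intros)
  note k = this
  from cross_grad_third[OF f nz s(3,4) this cr]
  have cr': "cross_grad f (a3,b3,c3) (a4,b4,c4) (\<lambda>x y z. \<kappa> * x * y)" .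
  have cramer:
    "a x y z * (\<kappa> * x * y) = a3 x y z * hQ x y z - a4 x y z * hP x y z"
    "b x y z * (\<kappa> * x * y) = b3 x y z * hQ x y z - b4 x y z * hP x y z"
    "c x y z * (\<kappa> * x * y) = c3 x y z * hQ x y z - c4 x y z * hP x y z" for x y z
    by (rule cross_grad_cramer[OF f s0 s(3,4) hP(1) hQ(1) k hP(2) hQ(2) cr'])+
  note N = is_poly_partials[OF f(2)]
  have third: "a x y z * b1 x y z - b x y z * a1 x y z = hA x y z * dZ f x y z"
    "a x y z * b2 x y z - b x y z * a2 x y z = hB x y z * dZ f x y z"
    "a x y z * b3 x y z - b x y z * a3 x y z = hP x y z * dZ f x y z"
    "a x y z * b4 x y z - b x y z * a4 x y z = hQ x y z * dZ f x y z" for x y z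
    using hA(2) hB(2) hP(2) hQ(2) by (auto simp: cross_grad_def)
  \<comment> \<open>Taking the cross product of sigma with a linear relation between the generators
    turns it into the same relation between the factors.\<close>
  have h1: "x * hA x y z + y * hQ x y z = z * hP x y z" for x y z
  proof (rule is_poly_cancel[of "dZ f" "\<lambda>x y z. x * hA x y z + y * hQ x y z" "\<lambda>x y z. z * hP x y z" u v w])
    show "dZ f x y z * (x * hA x y z + y * hQ x y z) = dZ f x y z * (z * hP x y z)" for x y z
      using third[of x y z] rel1[of x y z] by algebra
  qed (use N nz hA hP hQ in \<open>auto intro!: is_poly_intros\<close>)
  have h2: "y * hB x y z + z * hQ x y z = m * (x * hP x y z)" for x y z
  proof (rule is_poly_cancel[of "dZ f" "\<lambda>x y z. y * hB x y z + z * hQ x y z" "\<lambda>x y z. m * (x * hP x y z)" u v w])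
    show "dZ f x y z * (y * hB x y z + z * hQ x y z) = dZ f x y z * (m * (x * hP x y z))" for x y z
      using third[of x y z] rel2(1)[of y x z] rel2(2)[of y x z] by algebra
  qed (use N nz hB hP hQ in \<open>auto intro!: is_poly_intros\<close>)
  obtain \<alpha> \<beta> \<gamma> \<delta> where p: "is_poly \<alpha>" "is_poly \<beta>" "is_poly \<gamma>" "is_poly \<delta>"
    and P: "\<And>x y z. hP x y z = y^2 * \<alpha> x y z + x * z * \<beta> x y z - x * y * \<delta> x y z"
    and Q: "\<And>x y z. hQ x y z = y * z * \<alpha> x y z + m * x^2 * \<beta> x y z + x * y * \<gamma> x y z"
    by (rule koszul_solution[OF hA(1) hB(1) hP(1) hQ(1) h1 h2 \<open>m \<noteq> 0\<close>]) (rule that)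
  have ps: "is_poly a" "is_poly b" "is_poly c" "is_poly a1" "is_poly b1" "is_poly c1"
    "is_poly a2" "is_poly b2" "is_poly c2" "is_poly a3" "is_poly b3" "is_poly c3"
    "is_poly a4" "is_poly b4" "is_poly c4"
    using s s0 by (auto simp: is_syz_def)
  have comb: "\<kappa> * e x y z = \<alpha> x y z * e1 x y z + \<beta> x y z * e2 x y z + \<gamma> x y z * e3 x y z + \<delta> x y z * e4 x y z"
    if e: "is_poly e" "is_poly e1" "is_poly e2" "is_poly e3" "is_poly e4"
      and r: "\<And>x y z. x * e1 x y z + y * e4 x y z = z * e3 x y z"
        "\<And>x y z. y * e2 x y z + z * e4 x y z = m * (x * e3 x y z)"
        "\<And>x y z. e x y z * (\<kappa> * x * y) = e3 x y z * hQ x y z - e4 x y z * hP x y z"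
    for e e1 e2 e3 e4 and x y z
  proof (rule is_poly_cancel[of "\<lambda>x y z. x * y" "\<lambda>x y z. \<kappa> * e x y z"
        "\<lambda>x y z. \<alpha> x y z * e1 x y z + \<beta> x y z * e2 x y z + \<gamma> x y z * e3 x y z + \<delta> x y z * e4 x y z" 1 1 0])
    show "x * y * (\<kappa> * e x y z)
        = x * y * (\<alpha> x y z * e1 x y z + \<beta> x y z * e2 x y z + \<gamma> x y z * e3 x y z + \<delta> x y z * e4 x y z)" for x y z
    proof -
      have "x * y * (\<kappa> * e x y z) = e3 x y z * hQ x y z - e4 x y z * hP x y z"
        using r(3)[of x y z] by (simp add: ac_simps)
      \<comment> \<open>The \<alpha>-terms collect to z rho_3 - y rho_4 = x rho_1 and the
        \<beta>-terms to m x rho_3 - z rho_4 = y rho_2, so every summand acquires the factor x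
        y.\<close>
      also have "\<dots> = y * \<alpha> x y z * (z * e3 x y z - y * e4 x y z)
          + x * \<beta> x y z * (m * (x * e3 x y z) - z * e4 x y z)
          + x * y * (\<gamma> x y z * e3 x y z + \<delta> x y z * e4 x y z)"
        unfolding P Q by algebra
      also have "z * e3 x y z - y * e4 x y z = x * e1 x y z" using r(1)[of x y z] by algebra
      also have "m * (x * e3 x y z) - z * e4 x y z = y * e2 x y z" using r(2)[of y x z] by algebra
      finally show ?thesis by algebra
    qed
  qed (use e p in \<open>auto intro!: is_poly_intros\<close>)
  define q where "q = (\<lambda>i::nat. \<lambda>x y z. ([\<alpha>, \<beta>, \<gamma>, \<delta>] ! i) x y z / \<kappa>)"
  have four: "{..<4::nat} = {0, 1, 2, 3}" by auto
  have "\<forall>i<4. is_poly (q i)"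
    using p by (auto simp: q_def nth_Cons' intro!: is_poly_intros)
  moreover have "\<sigma> = combo 4 q \<rho>"
    using comb[OF ps(1,4,7,10,13) rel1(1) rel2(1) cramer(1)]
      comb[OF ps(2,5,8,11,14) rel1(2) rel2(2) cramer(2)]
      comb[OF ps(3,6,9,12,15) rel1(3) rel2(3) cramer(3)] \<open>\<kappa> \<noteq> 0\<close>
    unfolding \<sigma> combo_def four \<rho> q_def
    by (simp add: fun_eq_iff) (simp add: field_simps)
  ultimately show "\<exists>p. (\<forall>i<4. is_poly (p i)) \<and> \<sigma> = combo 4 p \<rho>" by blast
qed

text \<open>All forms have the same degree k, so along t(x,y,z) both sides carry t^k. Cancelling it
  as a polynomial in t and then setting t = 0 replaces each coefficient by its constant
  term.\<close>

lemma hom_poly_combination_constant: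
  assumes "\<And>i. i < m \<Longrightarrow> hom_poly k (r i)" "hom_poly k s" "\<And>i. i < m \<Longrightarrow> is_poly (p i)"
    and eq: "\<And>x y z. s x y z = (\<Sum>i<m. p i x y z * r i x y z)"
  shows "s x y z = (\<Sum>i<m. p i 0 0 0 * r i x y z)"
proof -
  have "is_poly (\<lambda>x' y' z'. (\<Sum>i<m. p i x' y' z' * r i x y z) - s x y z)"
    using assms(3) by (intro is_poly_intros is_poly_sum) auto
  from is_poly_line[OF this, of 0 x 0 y 0 z]
  obtain q where q: "\<And>t. (\<Sum>i<m. p i (t * x) (t * y) (t * z) * r i x y z) - s x y z = poly q t"
    by auto
  have "poly (monom 1 k * q) t = 0" for t
  proof -
    have "t^k * s x y z = (\<Sum>i<m. p i (t * x) (t * y) (t * z) * (t^k * r i x y z))"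
    proof -
      have "t^k * s x y z = (\<Sum>i<m. p i (t * x) (t * y) (t * z) * r i (t * x) (t * y) (t * z))"
        unfolding eq[symmetric] by (rule hom_poly_scaling[OF assms(2), symmetric])
      also have "\<dots> = (\<Sum>i<m. p i (t * x) (t * y) (t * z) * (t^k * r i x y z))"
        by (rule sum.cong) (simp_all add: hom_poly_scaling[OF assms(1)])
      finally show ?thesis .
    qed
    also have "\<dots> = t^k * (\<Sum>i<m. p i (t * x) (t * y) (t * z) * r i x y z)"
      by (simp add: sum_distrib_left algebra_simps)
    finally have "t^k * (\<Sum>i<m. p i (t * x) (t * y) (t * z) * r i x y z) = t^k * s x y z" by (rule sym)
    then show ?thesis
      by (simp only: poly_mult poly_monom q[symmetric] right_diff_distrib) simp
  qed
  then have "monom 1 k * q = 0" using poly_all_0_iff_0 by blast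
  then have "q = 0" by (simp add: monom_eq_0_iff)
  with q[of 0] show ?thesis by simp
qed

text \<open>For generators of equal degree, redundancy over the polynomial ring is linear dependence
  over the complex numbers. Two of the three components are enough to exclude it here.\<close>

lemma minimal_if_independent:
  assumes hom: "\<And>i. i < m \<Longrightarrow> hom_syz k (\<rho> i)"
    and indep: "\<And>c. (\<And>x y z. (\<Sum>i<m. c i * fst (\<rho> i) x y z) = 0) \<Longrightarrow>
      (\<And>x y z. (\<Sum>i<m. c i * snd (snd (\<rho> i)) x y z) = 0) \<Longrightarrow> \<forall>i<m. c i = 0"
    and j: "j < m" and p: "\<forall>i<m. is_poly (p i)" "p j = zero_poly"
  shows "\<rho> j \<noteq> combo m p \<rho>"
proof
  assume eq: "\<rho> j = combo m p \<rho>"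
  \<comment> \<open>Since \<open>p j\<close> is zero, \<open>c j\<close> equals -1, so the vanishing
    of all \<open>c i\<close> is absurd.\<close>
  define c where "c i = p i 0 0 0 - (if i = j then 1 else 0)" for i
  have c: "(\<Sum>i<m. c i * r i) = (\<Sum>i<m. p i 0 0 0 * r i) - r j" for r
    using j by (simp add: c_def left_diff_distrib sum_subtractf if_distrib[of "\<lambda>u. u * _"] cong: if_cong)
  have h: "hom_poly k (fst (\<rho> i))" "hom_poly k (snd (snd (\<rho> i)))" if "i < m" for i
    using hom[OF that] by (simp_all add: hom_syz_def case_prod_unfold)
  have e: "fst (\<rho> j) x y z = (\<Sum>i<m. p i x y z * fst (\<rho> i) x y z)"
    "snd (snd (\<rho> j)) x y z = (\<Sum>i<m. p i x y z * snd (snd (\<rho> i)) x y z)" for x y z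
    by (subst eq, simp add: combo_def)+
  have "fst (\<rho> j) x y z = (\<Sum>i<m. p i 0 0 0 * fst (\<rho> i) x y z)" for x y z
    by (rule hom_poly_combination_constant[where r="\<lambda>i. fst (\<rho> i)", OF h(1) h(1)[OF j] _ e(1)]) (use p in simp_all)
  moreover have "snd (snd (\<rho> j)) x y z = (\<Sum>i<m. p i 0 0 0 * snd (snd (\<rho> i)) x y z)" for x y z
    by (rule hom_poly_combination_constant[where r="\<lambda>i. snd (snd (\<rho> i))", OF h(2) h(2)[OF j] _ e(2)]) (use p in simp_all)
  ultimately have "\<forall>i<m. c i = 0" by (intro indep) (simp_all add: c)
  then show False using j p(2) by (auto simp: c_def zero_poly_def)
qed

definition std_cubic :: cpoly where "std_cubic = (\<lambda>x y z. x*y*z + x^3 + y^3)"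

text \<open>The quadratic, quartic and sextic factors below are the products of the hyperosculating conics
  at the parameters \<open>1\<close>, at the two primitive cube roots of unity, and at all three.\<close>

definition quintic :: cpoly where
  "quintic = (\<lambda>x y z. std_cubic x y z * (21*x^2 - 22*x*y + 6*x*z + 21*y^2 + 6*y*z + z^2))"

lemma is_poly_quintic: "is_poly quintic"
  unfolding quintic_def std_cubic_def by (intro is_poly_intros)

lemma partials_quintic:
  "dX quintic = (\<lambda>x y z. 105*x^4 - 88*x^3*y + 24*x^3*z + 63*x^2*y^2 + 81*x^2*y*z + 3*x^2*z^2 + 42*x*y^3 - 44*x*y^2*z + 12*x*y*z^2 - 22*y^4 + 27*y^3*z + 6*y^2*z^2 + y*z^3)"
  "dY quintic = (\<lambda>x y z. -22*x^4 + 42*x^3*y + 27*x^3*z + 63*x^2*y^2 - 44*x^2*y*z + 6*x^2*z^2 - 88*x*y^3 + 81*x*y^2*z + 12*x*y*z^2 + x*z^3 + 105*y^4 + 24*y^3*z + 3*y^2*z^2)"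
  "dZ quintic = (\<lambda>x y z. 6*x^4 + 27*x^3*y + 2*x^3*z - 22*x^2*y^2 + 12*x^2*y*z + 27*x*y^3 + 12*x*y^2*z + 3*x*y*z^2 + 6*y^4 + 2*y^3*z)"
proof -
  show "dX quintic = (\<lambda>x y z. 105*x^4 - 88*x^3*y + 24*x^3*z + 63*x^2*y^2 + 81*x^2*y*z + 3*x^2*z^2 + 42*x*y^3 - 44*x*y^2*z + 12*x*y*z^2 - 22*y^4 + 27*y^3*z + 6*y^2*z^2 + y*z^3)"
    unfolding dX_def quintic_def std_cubic_def
    by (intro ext DERIV_imp_deriv) (rule derivative_eq_intros refl | simp; algebra)+
  show "dY quintic = (\<lambda>x y z. -22*x^4 + 42*x^3*y + 27*x^3*z + 63*x^2*y^2 - 44*x^2*y*z + 6*x^2*z^2 - 88*x*y^3 + 81*x*y^2*z + 12*x*y*z^2 + x*z^3 + 105*y^4 + 24*y^3*z + 3*y^2*z^2)"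
    unfolding dY_def quintic_def std_cubic_def
    by (intro ext DERIV_imp_deriv) (rule derivative_eq_intros refl | simp; algebra)+
  show "dZ quintic = (\<lambda>x y z. 6*x^4 + 27*x^3*y + 2*x^3*z - 22*x^2*y^2 + 12*x^2*y*z + 27*x*y^3 + 12*x*y^2*z + 3*x*y*z^2 + 6*y^4 + 2*y^3*z)"
    unfolding dZ_def quintic_def std_cubic_def
    by (intro ext DERIV_imp_deriv) (rule derivative_eq_intros refl | simp; algebra)+
qed

text \<open>On z = 0 the partials f_x, f_y are coprime binary forms of degree l, and such forms
  generate all forms of degree 2l - 1 with cofactors of degree l - 1 (the Sylvester matrix is
  invertible). Here l = 4; the other two arrangements use l = 6 and l = 8. Exchanging x and y
  preserves the curve, so U' and V' are V and U with x and y swapped.\<close>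

lemma grad_regular_quintic: "grad_regular quintic"
proof (rule grad_regularI[where n=7 and \<kappa>=614400 and k=3 and l=4
      and U="\<lambda>x y z. -656754*x^3 + 1800960*x^2*y + 2090101*x*y^2 - 5774685*y^3"
      and V="\<lambda>x y z. -3162435*x^3 + 5185131*x^2*y + 1733760*x*y^2 - 1209934*y^3"
      and U'="\<lambda>x y z. -1209934*x^3 + 1733760*x^2*y + 5185131*x*y^2 - 3162435*y^3"
      and V'="\<lambda>x y z. -5774685*x^3 + 2090101*x^2*y + 1800960*x*y^2 - 656754*y^3"])
  show "hom_poly 3 (\<lambda>x y z. -656754*x^3 + 1800960*x^2*y + 2090101*x*y^2 - 5774685*y^3)" "hom_poly 3 (\<lambda>x y z. -3162435*x^3 + 5185131*x^2*y + 1733760*x*y^2 - 1209934*y^3)"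
    by (rule hom_polyI, intro is_poly_intros, algebra)+
  show "hom_poly 4 (dX quintic)" "hom_poly 4 (dY quintic)"
    unfolding partials_quintic by (rule hom_polyI, intro is_poly_intros, algebra)+
qed ((intro is_poly_intros | simp add: partials_quintic); algebra?)+

lemma dZ_quintic_nonzero: "dZ quintic 1 0 0 \<noteq> 0"
  by (simp add: partials_quintic)

text \<open>The curve is invariant under exchanging x and y. The first generator is anti-invariant
  under this swap, the second invariant.\<close>

lemma free_quintic: "free_with_exponents quintic [2, 2]"
proof (rule free_if_cross_constant[where k="-30"
      and a="\<lambda>x y z. -4*x^2 - x*y + 5*x*z + 15*y^2" and b="\<lambda>x y z. -15*x^2 + x*y + 4*y^2 - 5*y*z" and c="\<lambda>x y z. 15*x^2 - 9*x*z - 15*y^2 + 9*y*z" and a'="\<lambda>x y z. -8*x^2 - 73*x*y - 9*x*z + 15*y^2" and b'="\<lambda>x y z. 15*x^2 - 73*x*y - 8*y^2 - 9*y*z" and c'="\<lambda>x y z. 195*x^2 - 90*x*y + 57*x*z + 195*y^2 + 57*y*z + 6*z^2",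
      OF grad_regular_quintic is_poly_quintic dZ_quintic_nonzero])
qed (intro is_poly_intros conjI allI hom_polyI
    | simp only: is_syz_def hom_syz_def prod.case partials_quintic
    | algebra | simp)+

section \<open>Degree seven: the cubic with two conics\<close>

definition septic :: cpoly where
  "septic = (\<lambda>x y z. std_cubic x y z * (441*x^4 + 462*x^3*y - 126*x^3*z + 43*x^2*y^2 + 384*x^2*y*z + 15*x^2*z^2 + 462*x*y^3 + 384*x*y^2*z - 80*x*y*z^2 - 6*x*z^3 + 441*y^4 - 126*y^3*z + 15*y^2*z^2 - 6*y*z^3 + z^4))"

lemma is_poly_septic: "is_poly septic"
  unfolding septic_def std_cubic_def by (intro is_poly_intros)

lemma partials_septic:
  "dX septic = (\<lambda>x y z. 3087*x^6 + 2772*x^5*y - 756*x^5*z + 215*x^4*y^2 + 4125*x^4*y*z + 75*x^4*z^2 + 3612*x^3*y^3 + 3384*x^3*y^2*z - 824*x^3*y*z^2 - 24*x^3*z^3 + 2709*x^2*y^4 - 627*x^2*y^3*z + 1197*x^2*y^2*z^2 + 27*x^2*y*z^3 + 3*x^2*z^4 + 86*x*y^5 + 1692*x*y^4*z + 798*x*y^3*z^2 - 160*x*y^2*z^3 - 12*x*y*z^4 + 462*y^6 + 825*y^5*z - 206*y^4*z^2 + 9*y^3*z^3 - 6*y^2*z^4 + y*z^5)"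
  "dY septic = (\<lambda>x y z. 462*x^6 + 86*x^5*y + 825*x^5*z + 2709*x^4*y^2 + 1692*x^4*y*z - 206*x^4*z^2 + 3612*x^3*y^3 - 627*x^3*y^2*z + 798*x^3*y*z^2 + 9*x^3*z^3 + 215*x^2*y^4 + 3384*x^2*y^3*z + 1197*x^2*y^2*z^2 - 160*x^2*y*z^3 - 6*x^2*z^4 + 2772*x*y^5 + 4125*x*y^4*z - 824*x*y^3*z^2 + 27*x*y^2*z^3 - 12*x*y*z^4 + x*z^5 + 3087*y^6 - 756*y^5*z + 75*y^4*z^2 - 24*y^3*z^3 + 3*y^2*z^4)"
  "dZ septic = (\<lambda>x y z. -126*x^6 + 825*x^5*y + 30*x^5*z + 846*x^4*y^2 - 412*x^4*y*z - 18*x^4*z^2 - 209*x^3*y^3 + 798*x^3*y^2*z + 27*x^3*y*z^2 + 4*x^3*z^3 + 846*x^2*y^4 + 798*x^2*y^3*z - 240*x^2*y^2*z^2 - 24*x^2*y*z^3 + 825*x*y^5 - 412*x*y^4*z + 27*x*y^3*z^2 - 24*x*y^2*z^3 + 5*x*y*z^4 - 126*y^6 + 30*y^5*z - 18*y^4*z^2 + 4*y^3*z^3)"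
proof -
  show "dX septic = (\<lambda>x y z. 3087*x^6 + 2772*x^5*y - 756*x^5*z + 215*x^4*y^2 + 4125*x^4*y*z + 75*x^4*z^2 + 3612*x^3*y^3 + 3384*x^3*y^2*z - 824*x^3*y*z^2 - 24*x^3*z^3 + 2709*x^2*y^4 - 627*x^2*y^3*z + 1197*x^2*y^2*z^2 + 27*x^2*y*z^3 + 3*x^2*z^4 + 86*x*y^5 + 1692*x*y^4*z + 798*x*y^3*z^2 - 160*x*y^2*z^3 - 12*x*y*z^4 + 462*y^6 + 825*y^5*z - 206*y^4*z^2 + 9*y^3*z^3 - 6*y^2*z^4 + y*z^5)"
    unfolding dX_def septic_def std_cubic_def
    by (intro ext DERIV_imp_deriv) (rule derivative_eq_intros refl | simp; algebra)+
  show "dY septic = (\<lambda>x y z. 462*x^6 + 86*x^5*y + 825*x^5*z + 2709*x^4*y^2 + 1692*x^4*y*z - 206*x^4*z^2 + 3612*x^3*y^3 - 627*x^3*y^2*z + 798*x^3*y*z^2 + 9*x^3*z^3 + 215*x^2*y^4 + 3384*x^2*y^3*z + 1197*x^2*y^2*z^2 - 160*x^2*y*z^3 - 6*x^2*z^4 + 2772*x*y^5 + 4125*x*y^4*z - 824*x*y^3*z^2 + 27*x*y^2*z^3 - 12*x*y*z^4 + x*z^5 + 3087*y^6 - 756*y^5*z + 75*y^4*z^2 - 24*y^3*z^3 + 3*y^2*z^4)"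
    unfolding dY_def septic_def std_cubic_def
    by (intro ext DERIV_imp_deriv) (rule derivative_eq_intros refl | simp; algebra)+
  show "dZ septic = (\<lambda>x y z. -126*x^6 + 825*x^5*y + 30*x^5*z + 846*x^4*y^2 - 412*x^4*y*z - 18*x^4*z^2 - 209*x^3*y^3 + 798*x^3*y^2*z + 27*x^3*y*z^2 + 4*x^3*z^3 + 846*x^2*y^4 + 798*x^2*y^3*z - 240*x^2*y^2*z^2 - 24*x^2*y*z^3 + 825*x*y^5 - 412*x*y^4*z + 27*x*y^3*z^2 - 24*x*y^2*z^3 + 5*x*y*z^4 - 126*y^6 + 30*y^5*z - 18*y^4*z^2 + 4*y^3*z^3)"
    unfolding dZ_def septic_def std_cubic_def
    by (intro ext DERIV_imp_deriv) (rule derivative_eq_intros refl | simp; algebra)+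
qed

lemma grad_regular_septic: "grad_regular septic"
proof (rule grad_regularI[where n=11 and \<kappa>=701382205440 and k=5 and l=6
      and U="\<lambda>x y z. -7687634894732*x^5 + 6236645343390*x^4*y - 51303552637050*x^3*y^2 - 8924489098439*x^2*y^3 + 5306732892153*x*y^4 - 51388793484021*y^5"
      and V="\<lambda>x y z. 51368896758102*x^5 - 5108496467629*x^4*y + 8701119003423*x^3*y^2 + 51377423926353*x^2*y^3 - 6268636992616*x*y^4 + 7690839841146*y^5"
      and U'="\<lambda>x y z. 7690839841146*x^5 - 6268636992616*x^4*y + 51377423926353*x^3*y^2 + 8701119003423*x^2*y^3 - 5108496467629*x*y^4 + 51368896758102*y^5"
      and V'="\<lambda>x y z. -51388793484021*x^5 + 5306732892153*x^4*y - 8924489098439*x^3*y^2 - 51303552637050*x^2*y^3 + 6236645343390*x*y^4 - 7687634894732*y^5"])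
  show "hom_poly 5 (\<lambda>x y z. -7687634894732*x^5 + 6236645343390*x^4*y - 51303552637050*x^3*y^2 - 8924489098439*x^2*y^3 + 5306732892153*x*y^4 - 51388793484021*y^5)" "hom_poly 5 (\<lambda>x y z. 51368896758102*x^5 - 5108496467629*x^4*y + 8701119003423*x^3*y^2 + 51377423926353*x^2*y^3 - 6268636992616*x*y^4 + 7690839841146*y^5)"
    by (rule hom_polyI, intro is_poly_intros, algebra)+
  show "hom_poly 6 (dX septic)" "hom_poly 6 (dY septic)"
    unfolding partials_septic by (rule hom_polyI, intro is_poly_intros, algebra)+
qed ((intro is_poly_intros | simp add: partials_septic); algebra?)+

lemma dZ_septic_nonzero: "dZ septic 1 0 0 \<noteq> 0"
  by (simp add: partials_septic)

text \<open>Again one generator is anti-invariant and one invariant under exchanging x and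
  y.\<close>

lemma free_septic: "free_with_exponents septic [3, 3]"
proof (rule free_if_cross_constant[where k="182"
      and a="\<lambda>x y z. 120*x^3 + 637*x^2*y + 399*x^2*z + 1833*x*y^2 + 420*x*y*z - 91*x*z^2 + 1323*y^3 - 273*y^2*z" and b="\<lambda>x y z. -1323*x^3 - 1833*x^2*y + 273*x^2*z - 637*x*y^2 - 420*x*y*z - 120*y^3 - 399*y^2*z + 91*y*z^2" and c="\<lambda>x y z. -1911*x^3 - 1890*x^2*y + 939*x^2*z + 1890*x*y^2 - 105*x*z^2 + 1911*y^3 - 939*y^2*z + 105*y*z^2" and a'="\<lambda>x y z. -4*x^3 + 187*x^2*y + 47*x^2*z + 31*x*y^2 - 44*x*y*z - 5*x*z^2 - 147*y^3 + 7*y^2*z" and b'="\<lambda>x y z. -147*x^3 + 31*x^2*y + 7*x^2*z + 187*x*y^2 - 44*x*y*z - 4*y^3 + 47*y^2*z - 5*y*z^2" and c'="\<lambda>x y z. -637*x^3 + 336*x^2*y + 87*x^2*z + 336*x*y^2 - 492*x*y*z - 9*x*z^2 - 637*y^3 + 87*y^2*z - 9*y*z^2 + 2*z^3",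
      OF grad_regular_septic is_poly_septic dZ_septic_nonzero])
qed (intro is_poly_intros conjI allI hom_polyI
    | simp only: is_syz_def hom_syz_def prod.case partials_septic
    | algebra | simp)+

section \<open>Degree nine: the cubic with all three conics\<close>

definition nonic :: cpoly where
  "nonic = (\<lambda>x y z. std_cubic x y z * (9261*x^6 + 16254*x^4*y*z + 18458*x^3*y^3 - 162*x^3*z^3 + 7041*x^2*y^2*z^2 + 16254*x*y^4*z - 174*x*y*z^4 + 9261*y^6 - 162*y^3*z^3 + z^6))"

lemma is_poly_nonic: "is_poly nonic"
  unfolding nonic_def std_cubic_def by (intro is_poly_intros)

lemma partials_nonic:
  "dX nonic = (\<lambda>x y z. 83349*x^8 + 178605*x^6*y*z + 166314*x^5*y^3 - 972*x^5*z^3 + 116475*x^4*y^2*z^2 + 203864*x^3*y^4*z - 1344*x^3*y*z^4 + 83157*x^2*y^6 + 20151*x^2*y^3*z^3 + 3*x^2*z^6 + 46590*x*y^5*z^2 - 348*x*y^2*z^5 + 25515*y^7*z - 336*y^4*z^4 + y*z^7)"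
  "dY nonic = (\<lambda>x y z. 25515*x^7*z + 83157*x^6*y^2 + 46590*x^5*y*z^2 + 203864*x^4*y^3*z - 336*x^4*z^4 + 166314*x^3*y^5 + 20151*x^3*y^2*z^3 + 116475*x^2*y^4*z^2 - 348*x^2*y*z^5 + 178605*x*y^6*z - 1344*x*y^3*z^4 + x*z^7 + 83349*y^8 - 972*y^5*z^3 + 3*y^2*z^6)"
  "dZ nonic = (\<lambda>x y z. 25515*x^7*y - 486*x^6*z^2 + 46590*x^5*y^2*z + 50966*x^4*y^4 - 1344*x^4*y*z^3 + 20151*x^3*y^3*z^2 + 6*x^3*z^5 + 46590*x^2*y^5*z - 870*x^2*y^2*z^4 + 25515*x*y^7 - 1344*x*y^4*z^3 + 7*x*y*z^6 - 486*y^6*z^2 + 6*y^3*z^5)"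
proof -
  show "dX nonic = (\<lambda>x y z. 83349*x^8 + 178605*x^6*y*z + 166314*x^5*y^3 - 972*x^5*z^3 + 116475*x^4*y^2*z^2 + 203864*x^3*y^4*z - 1344*x^3*y*z^4 + 83157*x^2*y^6 + 20151*x^2*y^3*z^3 + 3*x^2*z^6 + 46590*x*y^5*z^2 - 348*x*y^2*z^5 + 25515*y^7*z - 336*y^4*z^4 + y*z^7)"
    unfolding dX_def nonic_def std_cubic_def
    by (intro ext DERIV_imp_deriv) (rule derivative_eq_intros refl | simp; algebra)+
  show "dY nonic = (\<lambda>x y z. 25515*x^7*z + 83157*x^6*y^2 + 46590*x^5*y*z^2 + 203864*x^4*y^3*z - 336*x^4*z^4 + 166314*x^3*y^5 + 20151*x^3*y^2*z^3 + 116475*x^2*y^4*z^2 - 348*x^2*y*z^5 + 178605*x*y^6*z - 1344*x*y^3*z^4 + x*z^7 + 83349*y^8 - 972*y^5*z^3 + 3*y^2*z^6)"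
    unfolding dY_def nonic_def std_cubic_def
    by (intro ext DERIV_imp_deriv) (rule derivative_eq_intros refl | simp; algebra)+
  show "dZ nonic = (\<lambda>x y z. 25515*x^7*y - 486*x^6*z^2 + 46590*x^5*y^2*z + 50966*x^4*y^4 - 1344*x^4*y*z^3 + 20151*x^3*y^3*z^2 + 6*x^3*z^5 + 46590*x^2*y^5*z - 870*x^2*y^2*z^4 + 25515*x*y^7 - 1344*x*y^4*z^3 + 7*x*y*z^6 - 486*y^6*z^2 + 6*y^3*z^5)"
    unfolding dZ_def nonic_def std_cubic_def
    by (intro ext DERIV_imp_deriv) (rule derivative_eq_intros refl | simp; algebra)+
qed

lemma grad_regular_nonic: "grad_regular nonic"
proof (rule grad_regularI[where n=15 and \<kappa>=6312439848960 and k=7 and l=8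
      and U="\<lambda>x y z. 75735040*x^7 + 7050021050141*x^4*y^3 + 7107409580733*x*y^6"
      and V="\<lambda>x y z. -7066450212317*x^6*y - 7091037187069*x^3*y^4"
      and U'="\<lambda>x y z. -7091037187069*x^4*y^3 - 7066450212317*x*y^6"
      and V'="\<lambda>x y z. 7107409580733*x^6*y + 7050021050141*x^3*y^4 + 75735040*y^7"])
  show "hom_poly 7 (\<lambda>x y z. 75735040*x^7 + 7050021050141*x^4*y^3 + 7107409580733*x*y^6)" "hom_poly 7 (\<lambda>x y z. -7066450212317*x^6*y - 7091037187069*x^3*y^4)"
    by (rule hom_polyI, intro is_poly_intros, algebra)+
  show "hom_poly 8 (dX nonic)" "hom_poly 8 (dY nonic)"
    unfolding partials_nonic by (rule hom_polyI, intro is_poly_intros, algebra)+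
qed ((intro is_poly_intros | simp add: partials_nonic); algebra?)+

text \<open>Give x, y, z the weights 2, 1, 0 modulo 3, as in the cyclic symmetry of the curve. Each
  of the four syzygies is an eigenvector, so every component contains monomials of a single weight.
  As vector fields, A and B have weight 0, P has weight 2 and Q has weight 1, which fits the
  relations x A + y Q = z P and y B + z Q = 49 x P.\<close>

definition syz_A :: csyz where
  "syz_A =
     (\<lambda>x y z. -4095*x^3*y^2 - 237*x^2*y*z^2 - 3606*x*y^3*z + 3*x*z^4 - 3969*y^5 + 24*y^2*z^3,
      \<lambda>x y z. 1302*x^3*y*z - 238*x^2*y^3 - 15*x^2*z^3 + 842*x*y^2*z^2 + 1215*y^4*z - 10*y*z^4,
      \<lambda>x y z. 13377*x^4*y - 273*x^3*z^2 + 12013*x^2*y^2*z + 13713*x*y^4 - 314*x*y*z^3 - 141*y^3*z^2 + z^5)"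

definition syz_B :: csyz where
  "syz_B =
     (\<lambda>x y z. -8505*x^4*z + 1666*x^3*y^2 - 5894*x^2*y*z^2 - 9114*x*y^3*z + 70*x*z^4 + 105*y^2*z^3,
      \<lambda>x y z. 27783*x^5 + 25242*x^3*y*z + 28665*x^2*y^3 - 168*x^2*z^3 + 1659*x*y^2*z^2 - 21*y*z^4,
      \<lambda>x y z. -95991*x^4*y + 987*x^3*z^2 - 84091*x^2*y^2*z - 93639*x*y^4 + 2198*x*y*z^3 + 1911*y^3*z^2 - 7*z^5)"

definition syz_P :: csyz where
  "syz_P =
     (\<lambda>x y z. -90*x^3*y*z + 34*x^2*y^3 + 3*x^2*z^3 - 46*x*y^2*z^2 - 105*y^4*z,
      \<lambda>x y z. 567*x^4*y - 15*x^3*z^2 + 520*x^2*y^2*z + 585*x*y^4 - 10*x*y*z^3 + 21*y^3*z^2,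
      \<lambda>x y z. -273*x^4*z - 1959*x^3*y^2 - 265*x^2*y*z^2 - 1996*x*y^3*z + x*z^4 - 1911*y^5 + 7*y^2*z^3)"

definition syz_Q :: csyz where
  "syz_Q =
     (\<lambda>x y z. 4095*x^4*y + 147*x^3*z^2 + 3640*x^2*y^2*z + 3969*x*y^4 - 70*x*y*z^3 - 105*y^3*z^2,
      \<lambda>x y z. -735*x^4*z + 238*x^3*y^2 - 322*x^2*y*z^2 - 630*x*y^3*z + 21*y^2*z^3,
      \<lambda>x y z. -13377*x^5 - 13972*x^3*y*z - 13713*x^2*y^3 + 49*x^2*z^3 - 1855*x*y^2*z^2 - 1911*y^4*z + 7*y*z^4)"

definition syz_nonic :: "nat \<Rightarrow> csyz" where
  "syz_nonic i = [syz_A, syz_B, syz_P, syz_Q] ! i"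

lemmas syz_ABPQ_def = syz_A_def syz_B_def syz_P_def syz_Q_def

lemma syz_A: "is_syz nonic syz_A" "hom_syz 5 syz_A"
  unfolding syz_A_def is_syz_def hom_syz_def prod.case partials_nonic
  by (intro is_poly_intros conjI allI hom_polyI | algebra)+

lemma syz_B: "is_syz nonic syz_B" "hom_syz 5 syz_B"
  unfolding syz_B_def is_syz_def hom_syz_def prod.case partials_nonic
  by (intro is_poly_intros conjI allI hom_polyI | algebra)+

lemma syz_P: "is_syz nonic syz_P" "hom_syz 5 syz_P"
  unfolding syz_P_def is_syz_def hom_syz_def prod.case partials_nonic
  by (intro is_poly_intros conjI allI hom_polyI | algebra)+

lemma syz_Q: "is_syz nonic syz_Q" "hom_syz 5 syz_Q"
  unfolding syz_Q_def is_syz_def hom_syz_def prod.case partials_nonic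
  by (intro is_poly_intros conjI allI hom_polyI | algebra)+

lemma syz_nonic: "i < 4 \<Longrightarrow> is_syz nonic (syz_nonic i) \<and> hom_syz 5 (syz_nonic i)"
  using syz_A syz_B syz_P syz_Q by (simp add: syz_nonic_def nth_Cons')

text \<open>The point (1,0,0) of the lower degrees is unsuitable here, since \<open>dZ nonic\<close>
  has no x^8 term.\<close>

lemma dZ_nonic_nonzero: "dZ nonic 1 1 0 \<noteq> 0"
  by (simp add: partials_nonic)

lemma generates_nonic: "generates_AR nonic 4 syz_nonic"
proof (rule generated_by_four[OF ext[OF syz_nonic_def[unfolded syz_ABPQ_def]] grad_regular_nonic is_poly_nonic dZ_nonic_nonzero
      syz_A(1)[unfolded syz_A_def] syz_B(1)[unfolded syz_B_def]
      syz_P(1)[unfolded syz_P_def] syz_Q(1)[unfolded syz_Q_def], where m=49 and \<kappa>="-91"])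
qed (unfold partials_nonic, (algebra | simp)+)

lemma minimal_nonic:
  assumes "j < 4" "\<forall>i<4. is_poly (p i)" "p j = zero_poly"
  shows "syz_nonic j \<noteq> combo 4 p syz_nonic"
proof (rule minimal_if_independent[OF _ _ assms, of 5])
  show "hom_syz 5 (syz_nonic i)" if "i < 4" for i using syz_nonic that by blast
next
  fix c assume a: "\<And>x y z. (\<Sum>i<4. c i * fst (syz_nonic i) x y z) = 0"
    and b: "\<And>x y z. (\<Sum>i<4. c i * snd (snd (syz_nonic i)) x y z) = 0"
  have four: "{..<4::nat} = {0, 1, 2, 3}" by auto
  \<comment> \<open>At the coordinate vertices only pure fifth powers survive: y^5 occurs in the
    first component of A alone and in the third of P alone, x^5 in the third of Q alone, and z^5 in
    the third components of A and B.\<close>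
  have "c 0 = 0" using a[of 0 1 0] unfolding four by (simp add: syz_nonic_def syz_ABPQ_def)
  moreover have "c 2 = 0" using b[of 0 1 0] unfolding four by (simp add: syz_nonic_def syz_ABPQ_def)
  moreover have "c 3 = 0" using b[of 1 0 0] unfolding four by (simp add: syz_nonic_def syz_ABPQ_def)
  moreover have "c 1 = 0" using b[of 0 0 1] calculation unfolding four by (simp add: syz_nonic_def syz_ABPQ_def)
  moreover have "i = 0 \<or> i = 1 \<or> i = 2 \<or> i = 3" if "i < 4" for i :: nat using that by linarith
  ultimately show "\<forall>i<4. c i = 0" by blast
qed

lemma msyzygy_nonic: "msyzygy_with_exponents nonic [5, 5, 5, 5]"
proof -
  have "length [5, 5, 5, 5::nat] = 4" by simp
  moreover have "[5, 5, 5, 5::nat] ! i = 5" if "i < 4" for i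
    using that by (simp add: nth_Cons')
  ultimately show ?thesis unfolding msyzygy_with_exponents_def
    using syz_nonic generates_nonic minimal_nonic by metis
qed

section \<open>Linear changes of coordinates\<close>

lemma hom_poly_1E:
  assumes "hom_poly 1 l"
  obtains \<alpha> \<beta> \<gamma> where "l = (\<lambda>x y z. \<alpha> * x + \<beta> * y + \<gamma> * z)"
proof -
  obtain c where c: "\<And>x y z. l x y z = (\<Sum>(i,j)\<in>{(i,j). i + j \<le> 1}. c i j * x^i * y^j * z^(1-i-j))"
    using assms unfolding hom_poly_def by blast
  have S: "{(i,j). i + j \<le> (1::nat)} = {(0,0), (0,1), (1,0)}" by auto
  have "l = (\<lambda>x y z. c 1 0 * x + c 0 1 * y + c 0 0 * z)"
    unfolding c S by (intro ext) (simp add: algebra_simps)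
  then show ?thesis by (rule that)
qed

lemma hom_poly_linear: "hom_poly 1 (\<lambda>x y z. \<alpha> * x + \<beta> * y + \<gamma> * z)"
  by (rule hom_polyI) (auto simp: algebra_simps intro!: is_poly_intros)

text \<open>A projective coordinate change carried together with its inverse. The axioms are
  symmetric in the two, so each transport lemma also applies in the opposite direction.\<close>

locale linear_change =
  fixes l1 l2 l3 k1 k2 k3 :: cpoly
  assumes hom_l: "hom_poly 1 l1" "hom_poly 1 l2" "hom_poly 1 l3"
    and hom_k: "hom_poly 1 k1" "hom_poly 1 k2" "hom_poly 1 k3"
    and lk: "l1 (k1 x y z) (k2 x y z) (k3 x y z) = x"
      "l2 (k1 x y z) (k2 x y z) (k3 x y z) = y"
      "l3 (k1 x y z) (k2 x y z) (k3 x y z) = z"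
    and kl: "k1 (l1 x y z) (l2 x y z) (l3 x y z) = x"
      "k2 (l1 x y z) (l2 x y z) (l3 x y z) = y"
      "k3 (l1 x y z) (l2 x y z) (l3 x y z) = z"
begin

definition pull :: "cpoly \<Rightarrow> cpoly" where
  "pull P = (\<lambda>x y z. P (l1 x y z) (l2 x y z) (l3 x y z))"

text \<open>A syzygy is a vector field annihilating \<open>f\<close>; this is its transform under
  the coordinate change, with coefficients pulled back along \<open>l\<close> and the vector mapped
  by the inverse \<open>k\<close>.\<close>

definition push_syz :: "csyz \<Rightarrow> csyz" where
  "push_syz \<sigma> = (case \<sigma> of (a,b,c) \<Rightarrow>
    (\<lambda>x y z. k1 (pull a x y z) (pull b x y z) (pull c x y z),
     \<lambda>x y z. k2 (pull a x y z) (pull b x y z) (pull c x y z),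
     \<lambda>x y z. k3 (pull a x y z) (pull b x y z) (pull c x y z)))"

definition kpt :: "cpt \<Rightarrow> cpt" where
  "kpt p = (ev k1 p, ev k2 p, ev k3 p)"

lemma inverse: "linear_change k1 k2 k3 l1 l2 l3"
  by unfold_locales (rule hom_l hom_k lk kl)+

lemmas polys = hom_l[THEN hom_poly_imp_is_poly] hom_k[THEN hom_poly_imp_is_poly]

lemma is_poly_pull: "is_poly P \<Longrightarrow> is_poly (pull P)"
  unfolding pull_def by (rule is_poly_subst[OF _ polys(1-3)])

lemma hom_poly_pull:
  assumes "hom_poly d P" shows "hom_poly d (pull P)"
proof (rule hom_polyI[OF is_poly_pull[OF hom_poly_imp_is_poly[OF assms]]])
  fix t x y z
  show "pull P (t * x) (t * y) (t * z) = t ^ d * pull P x y z"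
    using hom_l[THEN hom_poly_scaling] hom_poly_scaling[OF assms] by (simp add: pull_def)
qed

lemma pull_simps:
  "pull (pmult P Q) = pmult (pull P) (pull Q)" "pull (pscale c P) = pscale c (pull P)"
  "pull zero_poly = zero_poly"
  by (auto simp: pull_def pmult_def pscale_def zero_poly_def)

text \<open>The chain rule, stated as a pairing with an arbitrary vector (u,v,w): the differential
  of f o l sends it to df applied to l(u,v,w). This form keeps the matrix entries of
  \<open>l\<close> out of later proofs.\<close>

lemma gradient_pull:
  assumes "is_poly f"
  shows "dX (pull f) x y z * u + dY (pull f) x y z * v + dZ (pull f) x y z * w =
    pull (dX f) x y z * l1 u v w + pull (dY f) x y z * l2 u v w + pull (dZ f) x y z * l3 u v w"
proof -
  obtain a1 a2 a3 where l1: "l1 = (\<lambda>x y z. a1 * x + a2 * y + a3 * z)" by (rule hom_poly_1E[OF hom_l(1)])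
  obtain b1 b2 b3 where l2: "l2 = (\<lambda>x y z. b1 * x + b2 * y + b3 * z)" by (rule hom_poly_1E[OF hom_l(2)])
  obtain c1 c2 c3 where l3: "l3 = (\<lambda>x y z. c1 * x + c2 * y + c3 * z)" by (rule hom_poly_1E[OF hom_l(3)])
  note l = l1 l2 l3
  have "dX (pull f) x y z = pull (dX f) x y z * a1 + pull (dY f) x y z * b1 + pull (dZ f) x y z * c1"
    unfolding dX_def[of "pull f"] unfolding pull_def unfolding l
    by (rule DERIV_imp_deriv, rule is_poly_has_field_derivative[OF assms]) (auto intro!: derivative_eq_intros)
  moreover have "dY (pull f) x y z = pull (dX f) x y z * a2 + pull (dY f) x y z * b2 + pull (dZ f) x y z * c2"
    unfolding dY_def[of "pull f"] unfolding pull_def unfolding l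
    by (rule DERIV_imp_deriv, rule is_poly_has_field_derivative[OF assms]) (auto intro!: derivative_eq_intros)
  moreover have "dZ (pull f) x y z = pull (dX f) x y z * a3 + pull (dY f) x y z * b3 + pull (dZ f) x y z * c3"
    unfolding dZ_def[of "pull f"] unfolding pull_def unfolding l
    by (rule DERIV_imp_deriv, rule is_poly_has_field_derivative[OF assms]) (auto intro!: derivative_eq_intros)
  ultimately show ?thesis unfolding l1[THEN fun_cong, THEN fun_cong, THEN fun_cong, of u v w]
      l2[THEN fun_cong, THEN fun_cong, THEN fun_cong, of u v w] l3[THEN fun_cong, THEN fun_cong, THEN fun_cong, of u v w] by algebra
qed

lemma is_syz_push_syz:
  assumes "is_poly f" "is_syz f \<sigma>" shows "is_syz (pull f) (push_syz \<sigma>)"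
proof -
  obtain a b c where \<sigma>: "\<sigma> = (a,b,c)" by (metis prod_cases3)
  have p: "is_poly a" "is_poly b" "is_poly c"
    and s: "a x y z * dX f x y z + b x y z * dY f x y z + c x y z * dZ f x y z = 0" for x y z
    using assms(2) by (auto simp: \<sigma> is_syz_def)
  show ?thesis
    unfolding \<sigma> push_syz_def is_syz_def prod.case
  proof (intro conjI allI)
    fix x y z
    show "k1 (pull a x y z) (pull b x y z) (pull c x y z) * dX (pull f) x y z +
       k2 (pull a x y z) (pull b x y z) (pull c x y z) * dY (pull f) x y z +
       k3 (pull a x y z) (pull b x y z) (pull c x y z) * dZ (pull f) x y z = 0"
      using gradient_pull[OF assms(1), of x y z "k1 (pull a x y z) (pull b x y z) (pull c x y z)"
          "k2 (pull a x y z) (pull b x y z) (pull c x y z)" "k3 (pull a x y z) (pull b x y z) (pull c x y z)"]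
        s[of "l1 x y z" "l2 x y z" "l3 x y z"]
      unfolding lk by (simp add: pull_def mult.commute)
  qed (rule is_poly_subst[OF polys(4)] is_poly_subst[OF polys(5)] is_poly_subst[OF polys(6)],
      (rule is_poly_pull, rule p)+)+
qed

lemma hom_syz_push_syz:
  assumes "hom_syz d \<sigma>" shows "hom_syz d (push_syz \<sigma>)"
proof -
  obtain a b c where \<sigma>: "\<sigma> = (a,b,c)" by (metis prod_cases3)
  have h: "hom_poly d (pull a)" "hom_poly d (pull b)" "hom_poly d (pull c)"
    using assms by (auto simp: \<sigma> hom_syz_def intro: hom_poly_pull)
  have "hom_poly d (\<lambda>x y z. k (pull a x y z) (pull b x y z) (pull c x y z))" if k: "hom_poly 1 k" for k
    by (rule hom_polyI, rule is_poly_subst[OF hom_poly_imp_is_poly[OF k] h[THEN hom_poly_imp_is_poly]])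
      (simp add: h[THEN hom_poly_scaling] hom_poly_scaling[OF k])
  then show ?thesis using hom_k by (simp add: \<sigma> push_syz_def hom_syz_def)
qed

text \<open>The forms \<open>k1\<close>, \<open>k2\<close>, \<open>k3\<close> are linear, so pushing
  is additive and turns polynomial coefficients into their pullbacks.\<close>

lemma push_syz_combo: "push_syz (combo m p \<rho>) = combo m (\<lambda>i. pull (p i)) (\<lambda>i. push_syz (\<rho> i))"
proof -
  have lin: "k (\<Sum>i<m. q i * r i) (\<Sum>i<m. q i * s i) (\<Sum>i<m. q i * t i) = (\<Sum>i<m. q i * k (r i) (s i) (t i))"
    if k: "hom_poly 1 k" for k and q r s t :: "nat \<Rightarrow> complex"
  proof -
    obtain \<alpha> \<beta> \<gamma> where k: "k = (\<lambda>x y z. \<alpha> * x + \<beta> * y + \<gamma> * z)" using k by (rule hom_poly_1E)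
    show ?thesis unfolding k by (simp add: sum_distrib_left algebra_simps sum.distrib)
  qed
  show ?thesis
    unfolding combo_def push_syz_def by (simp add: pull_def case_prod_unfold) (intro conjI ext lin hom_k)
qed

end

lemma (in linear_change) inverse_pull: "linear_change.pull k1 k2 k3 (pull P) = P"
proof -
  interpret inv: linear_change k1 k2 k3 l1 l2 l3 by (rule inverse)
  show ?thesis by (simp add: inv.pull_def pull_def lk)
qed

lemma (in linear_change) inverse_push_syz: "linear_change.push_syz k1 k2 k3 l1 l2 l3 (push_syz \<sigma>) = \<sigma>"
proof -
  interpret inv: linear_change k1 k2 k3 l1 l2 l3 by (rule inverse)
  show ?thesis
    by (cases \<sigma>) (simp add: inv.pull_def pull_def lk inv.push_syz_def push_syz_def)
qed

context linear_change
begin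

abbreviation "pull' \<equiv> linear_change.pull k1 k2 k3"
abbreviation "push_syz' \<equiv> linear_change.push_syz k1 k2 k3 l1 l2 l3"
abbreviation "lpt \<equiv> linear_change.kpt l1 l2 l3"

lemma pull_inverse: "pull (pull' P) = P"
  using linear_change.inverse_pull[OF inverse] .

lemma push_syz_inverse: "push_syz (push_syz' \<sigma>) = \<sigma>"
  using linear_change.inverse_push_syz[OF inverse] .

lemma generates_AR_pull:
  assumes "is_poly f" "generates_AR f m \<rho>"
  shows "generates_AR (pull f) m (\<lambda>i. push_syz (\<rho> i))"
  unfolding generates_AR_def
proof (intro allI impI)
  fix \<sigma> assume "is_syz (pull f) \<sigma>"
  from linear_change.is_syz_push_syz[OF inverse is_poly_pull[OF assms(1)] this]
  have "is_syz f (push_syz' \<sigma>)" by (simp add: inverse_pull)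
  with assms(2) obtain p where p: "\<forall>i<m. is_poly (p i)" "push_syz' \<sigma> = combo m p \<rho>"
    unfolding generates_AR_def by blast
  have "\<sigma> = combo m (\<lambda>i. pull (p i)) (\<lambda>i. push_syz (\<rho> i))"
    unfolding push_syz_combo[symmetric] p(2)[symmetric] push_syz_inverse ..
  moreover have "\<forall>i<m. is_poly (pull (p i))" using p(1) is_poly_pull by blast
  ultimately show "\<exists>p. (\<forall>i<m. is_poly (p i)) \<and> \<sigma> = combo m p (\<lambda>i. push_syz (\<rho> i))"
    by (intro exI[of _ "\<lambda>i. pull (p i)"] conjI)
qed

lemma inverse_combo:
  "push_syz' (combo m p (\<lambda>i. push_syz (\<rho> i))) = combo m (\<lambda>i. pull' (p i)) \<rho>"
  using linear_change.push_syz_combo[OF inverse] by (simp add: inverse_push_syz)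

lemma free_with_exponents_pull:
  assumes "is_poly f" "free_with_exponents f ds"
  shows "free_with_exponents (pull f) ds"
proof -
  let ?m = "length ds"
  obtain \<rho> where \<rho>: "\<forall>i<?m. is_syz f (\<rho> i) \<and> hom_syz (ds ! i) (\<rho> i)" "generates_AR f ?m \<rho>"
    and indep: "\<And>p. \<forall>i<?m. is_poly (p i) \<Longrightarrow> combo ?m p \<rho> = (zero_poly, zero_poly, zero_poly) \<Longrightarrow>
      \<forall>i<?m. p i = zero_poly"
    using assms(2) unfolding free_with_exponents_def by blast
  have "\<forall>i<?m. p i = zero_poly"
    if p: "\<forall>i<?m. is_poly (p i)" "combo ?m p (\<lambda>i. push_syz (\<rho> i)) = (zero_poly, zero_poly, zero_poly)" for p
  proof -
    interpret inv: linear_change k1 k2 k3 l1 l2 l3 by (rule inverse)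
    have "l1 0 0 0 = 0" "l2 0 0 0 = 0" "l3 0 0 0 = 0"
      using hom_l[THEN hom_poly_scaling, of 0 0 0 0] by simp_all
    then have "push_syz' (zero_poly, zero_poly, zero_poly) = (zero_poly, zero_poly, zero_poly)"
      by (simp add: inv.push_syz_def inv.pull_def zero_poly_def)
    then have "combo ?m (\<lambda>i. pull' (p i)) \<rho> = (zero_poly, zero_poly, zero_poly)"
      unfolding inverse_combo[symmetric] p(2) .
    moreover have "\<forall>i<?m. is_poly (pull' (p i))" using p(1) inv.is_poly_pull by blast
    ultimately have "\<forall>i<?m. pull' (p i) = zero_poly" using indep[of "\<lambda>i. pull' (p i)"] by blast
    then have "\<forall>i<?m. pull (pull' (p i)) = zero_poly" by (simp add: pull_simps)
    then show ?thesis by (simp add: pull_inverse)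
  qed
  moreover have "\<forall>i<?m. is_syz (pull f) (push_syz (\<rho> i)) \<and> hom_syz (ds ! i) (push_syz (\<rho> i))"
    using \<rho>(1) is_syz_push_syz[OF assms(1)] hom_syz_push_syz by blast
  ultimately show ?thesis unfolding free_with_exponents_def
    using generates_AR_pull[OF assms(1) \<rho>(2)] by (intro exI[of _ "\<lambda>i. push_syz (\<rho> i)"]) blast
qed

lemma msyzygy_with_exponents_pull:
  assumes "is_poly f" "msyzygy_with_exponents f ds"
  shows "msyzygy_with_exponents (pull f) ds"
proof -
  let ?m = "length ds"
  obtain \<rho> where \<rho>: "\<forall>i<?m. is_syz f (\<rho> i) \<and> hom_syz (ds ! i) (\<rho> i)" "generates_AR f ?m \<rho>"
    and min: "\<And>j p. j < ?m \<Longrightarrow> \<forall>i<?m. is_poly (p i) \<Longrightarrow> p j = zero_poly \<Longrightarrow> \<rho> j \<noteq> combo ?m p \<rho>"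
    using assms(2) unfolding msyzygy_with_exponents_def by blast
  have "push_syz (\<rho> j) \<noteq> combo ?m p (\<lambda>i. push_syz (\<rho> i))"
    if p: "j < ?m" "\<forall>i<?m. is_poly (p i)" "p j = zero_poly" for j p
  proof
    interpret inv: linear_change k1 k2 k3 l1 l2 l3 by (rule inverse)
    assume "push_syz (\<rho> j) = combo ?m p (\<lambda>i. push_syz (\<rho> i))"
    then have "\<rho> j = combo ?m (\<lambda>i. pull' (p i)) \<rho>"
      using inverse_push_syz[of "\<rho> j"] by (simp add: inverse_combo)
    moreover have "\<forall>i<?m. is_poly (pull' (p i))" using p(2) inv.is_poly_pull by blast
    moreover have "pull' (p j) = zero_poly" using p(3) by (simp add: inv.pull_simps)
    ultimately show False using min[OF p(1), of "\<lambda>i. pull' (p i)"] by blast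
  qed
  moreover have "\<forall>i<?m. is_syz (pull f) (push_syz (\<rho> i)) \<and> hom_syz (ds ! i) (push_syz (\<rho> i))"
    using \<rho>(1) is_syz_push_syz[OF assms(1)] hom_syz_push_syz by blast
  ultimately show ?thesis unfolding msyzygy_with_exponents_def
    using generates_AR_pull[OF assms(1) \<rho>(2)] by (intro exI[of _ "\<lambda>i. push_syz (\<rho> i)"]) blast
qed

lemma lpt_kpt: "lpt (kpt p) = p"
proof -
  interpret inv: linear_change k1 k2 k3 l1 l2 l3 by (rule inverse)
  show ?thesis by (simp add: inv.kpt_def kpt_def ev_def lk)
qed

lemma ev_pull_kpt: "ev (pull P) (kpt p) = ev P p"
  by (simp add: pull_def kpt_def ev_def lk)

lemma kpt_scale: "kpt (c * x, c * y, c * z) = (c * ev k1 (x,y,z), c * ev k2 (x,y,z), c * ev k3 (x,y,z))"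
  by (simp add: kpt_def ev_def hom_k[THEN hom_poly_scaling, simplified])

lemma proportional_kpt: "proportional p q \<Longrightarrow> proportional (kpt p) (kpt q)"
  unfolding proportional_def using kpt_scale[of _ "fst p" "fst (snd p)" "snd (snd p)"]
  by (auto simp: kpt_def ev_def)

lemma kpt_zero: "kpt (0,0,0) = (0,0,0)"
  using kpt_scale[of 0 0 0 0] by simp

lemma smooth_pt_kpt:
  assumes "is_poly f" "smooth_pt f p"
  shows "smooth_pt (pull f) (kpt p)"
proof -
  interpret inv: linear_change k1 k2 k3 l1 l2 l3 by (rule inverse)
  have "kpt p \<noteq> (0,0,0)"
    using assms(2) lpt_kpt[of p] inv.kpt_zero by (auto simp: smooth_pt_def)
  moreover have False
    if 0: "ev (dX (pull f)) (kpt p) = 0" "ev (dY (pull f)) (kpt p) = 0" "ev (dZ (pull f)) (kpt p) = 0"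
  proof -
    have g: "ev (dX f) p * u + ev (dY f) p * v + ev (dZ f) p * w = 0" for u v w
      using gradient_pull[OF assms(1), of "ev k1 p" "ev k2 p" "ev k3 p" "k1 u v w" "k2 u v w" "k3 u v w"] 0
        ev_pull_kpt[of "dX f" p] ev_pull_kpt[of "dY f" p] ev_pull_kpt[of "dZ f" p]
      unfolding lk by (simp add: kpt_def ev_def)
    show False using g[of 1 0 0] g[of 0 1 0] g[of 0 0 1] assms(2) by (simp add: smooth_pt_def)
  qed
  ultimately show ?thesis using assms(2) ev_pull_kpt[of f p] unfolding smooth_pt_def by auto
qed

text \<open>The branch is mapped by \<open>k\<close>, and the pulled-back form along the new branch
  is the same function of t as before, so all its derivatives agree.\<close>

lemma contact_ge_kpt:
  assumes "contact_ge f q p n"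
  shows "contact_ge (pull f) (pull q) (kpt p) n"
proof -
  obtain g1 g2 g3 where b: "local_branch f p g1 g2 g3"
    and q: "\<forall>j<n. (deriv ^^ j) (\<lambda>t. q (g1 t) (g2 t) (g3 t)) 0 = 0"
    using assms unfolding contact_ge_def by blast
  obtain r where r: "r > 0" "g1 holomorphic_on ball 0 r" "g2 holomorphic_on ball 0 r" "g3 holomorphic_on ball 0 r"
    and p: "(g1 0, g2 0, g3 0) = p" and f: "\<forall>t\<in>ball 0 r. f (g1 t) (g2 t) (g3 t) = 0"
    and imm: "\<forall>c. (deriv g1 0, deriv g2 0, deriv g3 0) \<noteq> (c * fst p, c * fst (snd p), c * snd (snd p))"
    using b unfolding local_branch_def by blast
  interpret inv: linear_change k1 k2 k3 l1 l2 l3 by (rule inverse)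
  define h where "h k = (\<lambda>t. k (g1 t) (g2 t) (g3 t))" for k :: cpoly
  have lin: "h k holomorphic_on ball 0 r \<and> deriv (h k) 0 = k (deriv g1 0) (deriv g2 0) (deriv g3 0)"
    if "hom_poly 1 k" for k
  proof -
    obtain \<alpha> \<beta> \<gamma> where k: "k = (\<lambda>x y z. \<alpha> * x + \<beta> * y + \<gamma> * z)" using \<open>hom_poly 1 k\<close> by (rule hom_poly_1E)
    have "g field_differentiable at 0" if "g holomorphic_on ball 0 r" for g
      using that r(1) by (auto intro: holomorphic_on_imp_differentiable_at)
    from r(2-4)[THEN this]
    have g: "(g1 has_field_derivative deriv g1 0) (at 0)" "(g2 has_field_derivative deriv g2 0) (at 0)"
      "(g3 has_field_derivative deriv g3 0) (at 0)"
      by (simp_all add: DERIV_deriv_iff_field_differentiable)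
    have "((\<lambda>t. \<alpha> * g1 t + \<beta> * g2 t + \<gamma> * g3 t) has_field_derivative
        \<alpha> * deriv g1 0 + \<beta> * deriv g2 0 + \<gamma> * deriv g3 0) (at 0)"
      by (intro DERIV_add DERIV_cmult g)
    then have "deriv (h k) 0 = k (deriv g1 0) (deriv g2 0) (deriv g3 0)"
      unfolding h_def k by (rule DERIV_imp_deriv)
    moreover have "h k holomorphic_on ball 0 r" unfolding h_def k by (intro holomorphic_intros r)
    ultimately show ?thesis by blast
  qed
  have "local_branch (pull f) (kpt p) (h k1) (h k2) (h k3)"
    unfolding local_branch_def
  proof (intro exI[of _ r] conjI allI ballI)
    show "(h k1 0, h k2 0, h k3 0) = kpt p" by (simp add: h_def kpt_def ev_def flip: p)
    show "pull f (h k1 t) (h k2 t) (h k3 t) = 0" if "t \<in> ball 0 r" for t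
      using f that by (simp add: h_def pull_def lk)
    fix c
    show "(deriv (h k1) 0, deriv (h k2) 0, deriv (h k3) 0)
        \<noteq> (c * fst (kpt p), c * fst (snd (kpt p)), c * snd (snd (kpt p)))"
    proof
      assume "(deriv (h k1) 0, deriv (h k2) 0, deriv (h k3) 0)
        = (c * fst (kpt p), c * fst (snd (kpt p)), c * snd (snd (kpt p)))"
      \<comment> \<open>If the image velocity were a multiple of the image point, applying the
        inverse map would give the same for the original branch.\<close>
      then have "kpt (deriv g1 0, deriv g2 0, deriv g3 0)
          = kpt (c * fst p, c * fst (snd p), c * snd (snd p))"
        using lin hom_k by (simp add: kpt_scale) (simp add: kpt_def ev_def)
      then have "(deriv g1 0, deriv g2 0, deriv g3 0) = (c * fst p, c * fst (snd p), c * snd (snd p))"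
        by (metis lpt_kpt)
      then show False using imm by blast
    qed
  qed (use r lin hom_k in auto)
  moreover have "pull q (h k1 t) (h k2 t) (h k3 t) = q (g1 t) (g2 t) (g3 t)" for t
    by (simp add: h_def pull_def lk)
  ultimately show ?thesis unfolding contact_ge_def using q
    by (intro exI[of _ "h k1"] exI[of _ "h k2"] exI[of _ "h k3"]) simp
qed

lemma pull_eq_zero_iff: "pull q = zero_poly \<longleftrightarrow> q = zero_poly"
  by (metis pull_simps(3) inverse_pull linear_change.pull_simps(3)[OF inverse])

lemma flex_pt_kpt:
  assumes "is_poly f" "flex_pt f p" shows "flex_pt (pull f) (kpt p)"
  using assms smooth_pt_kpt contact_ge_kpt hom_poly_pull pull_eq_zero_iff
  unfolding flex_pt_def by meson

end

lemma (in linear_change) sextactic_pt_kpt: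
  assumes "is_poly f" "sextactic_pt f p" shows "sextactic_pt (pull f) (kpt p)"
proof -
  \<comment> \<open>A negative condition is transported by carrying a hypothetical flex back through
    the inverse change.\<close>
  have "\<not> flex_pt (pull f) (kpt p)"
    using linear_change.flex_pt_kpt[OF inverse is_poly_pull[OF assms(1)], of "kpt p"] assms(2)
    by (auto simp: inverse_pull lpt_kpt sextactic_pt_def)
  then show ?thesis
    using assms smooth_pt_kpt contact_ge_kpt hom_poly_pull pull_eq_zero_iff
    unfolding sextactic_pt_def by meson
qed

lemma (in linear_change) hyperosculating_kpt:
  assumes "is_poly f" "hyperosculating f p q" shows "hyperosculating (pull f) (kpt p) (pull q)"
  using assms sextactic_pt_kpt contact_ge_kpt hom_poly_pull pull_eq_zero_iff
  unfolding hyperosculating_def by meson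

text \<open>A hyperosculating conic is determined only up to a nonzero scalar; this removes that
  ambiguity from the freeness statements.\<close>

lemma is_syz_pscale:
  assumes "is_poly f" "c \<noteq> 0" shows "is_syz (pscale c f) = is_syz f"
proof -
  have 0: "dX (\<lambda>_ _ _. c) = (\<lambda>_ _ _. 0)" "dY (\<lambda>_ _ _. c) = (\<lambda>_ _ _. 0)" "dZ (\<lambda>_ _ _. c) = (\<lambda>_ _ _. 0)"
    by (simp_all add: dX_def dY_def dZ_def)
  have d: "dX (pscale c f) = (\<lambda>x y z. c * dX f x y z)" "dY (pscale c f) = (\<lambda>x y z. c * dY f x y z)"
    "dZ (pscale c f) = (\<lambda>x y z. c * dZ f x y z)"
    using partials_mult[OF is_poly_const[of c] assms(1)] by (simp_all add: pscale_def 0 mult.commute)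
  have "a * (c * u) + b * (c * v) + e * (c * w) = 0 \<longleftrightarrow> a * u + b * v + e * w = 0" for a b e u v w :: complex
  proof -
    have "a * (c * u) + b * (c * v) + e * (c * w) = c * (a * u + b * v + e * w)" by algebra
    then show ?thesis using assms(2) by simp
  qed
  then show ?thesis by (auto simp: is_syz_def d fun_eq_iff)
qed

lemma free_with_exponents_pscale:
  "is_poly f \<Longrightarrow> c \<noteq> 0 \<Longrightarrow> free_with_exponents f ds \<Longrightarrow> free_with_exponents (pscale c f) ds"
  by (simp add: free_with_exponents_def generates_AR_def is_syz_pscale)

lemma msyzygy_with_exponents_pscale:
  "is_poly f \<Longrightarrow> c \<noteq> 0 \<Longrightarrow> msyzygy_with_exponents f ds \<Longrightarrow> msyzygy_with_exponents (pscale c f) ds"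
  by (simp add: msyzygy_with_exponents_def generates_AR_def is_syz_pscale)

section \<open>Contact with the standard nodal cubic\<close>

lemma higher_deriv_power_0:
  "j < k \<Longrightarrow> (deriv ^^ j) (\<lambda>t::complex. t ^ k) 0 = 0"
  "(deriv ^^ k) (\<lambda>t::complex. t ^ k) 0 = fact k"
  using higher_deriv_power[of j "0::complex" k 0] higher_deriv_power[of k "0::complex" k 0] by (simp_all add: pochhammer_fact)

text \<open>Links contact, which is defined by vanishing derivatives, with the order of vanishing.
  By Leibniz, only derivatives falling k times on t^k survive at 0.\<close>

lemma higher_deriv_power_mult:
  assumes "G holomorphic_on ball 0 r" "r > 0"
  shows "j < k \<Longrightarrow> (deriv ^^ j) (\<lambda>t. t ^ k * G t) 0 = 0"
    "(deriv ^^ k) (\<lambda>t. t ^ k * G t) 0 = fact k * G 0"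
proof -
  have "(\<lambda>t::complex. t ^ k) holomorphic_on ball 0 r" by (intro holomorphic_intros)
  from higher_deriv_mult[OF this assms(1) open_ball, of 0] assms(2)
  have *: "(deriv ^^ n) (\<lambda>t. t ^ k * G t) 0 =
      (\<Sum>i = 0..n. of_nat (n choose i) * (deriv ^^ i) (\<lambda>t. t ^ k) 0 * (deriv ^^ (n - i)) G 0)" for n
    by simp
  have 0: "(deriv ^^ i) (\<lambda>t::complex. t ^ k) 0 = 0" if "i < k" for i
    using that by (rule higher_deriv_power_0(1))
  show "(deriv ^^ j) (\<lambda>t. t ^ k * G t) 0 = 0" if "j < k"
    unfolding * by (rule sum.neutral) (use that 0 in auto)
  have "(deriv ^^ k) (\<lambda>t. t ^ k * G t) 0 = (\<Sum>i\<in>{k}. of_nat (k choose i) * (deriv ^^ i) (\<lambda>t. t ^ k) 0 * (deriv ^^ (k - i)) G 0)"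
    unfolding * by (rule sum.mono_neutral_right) (auto simp: 0)
  also have "\<dots> = fact k * G 0" by (simp add: higher_deriv_power_0(2))
  finally show "(deriv ^^ k) (\<lambda>t. t ^ k * G t) 0 = fact k * G 0" .
qed

lemma is_poly_std_cubic: "is_poly std_cubic"
  unfolding std_cubic_def by (intro is_poly_intros)

lemma partials_std_cubic:
  "dX std_cubic = (\<lambda>x y z. y * z + 3 * x^2)"
  "dY std_cubic = (\<lambda>x y z. x * z + 3 * y^2)"
  "dZ std_cubic = (\<lambda>x y z. x * y)"
  unfolding dX_def dY_def dZ_def std_cubic_def
  by (intro ext DERIV_imp_deriv; auto intro!: derivative_eq_intros)+

lemma std_cubic_zero_axes:
  assumes "std_cubic x y z = 0" "x * y = 0" shows "x = 0 \<and> y = 0"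
  using assms by (auto simp: std_cubic_def)

lemma smooth_pt_std_cubic: "smooth_pt std_cubic (x,y,z) \<longleftrightarrow> std_cubic x y z = 0 \<and> x \<noteq> 0 \<and> y \<noteq> 0"
  using std_cubic_zero_axes[of x y z] by (auto simp: smooth_pt_def ev_def partials_std_cubic)

text \<open>The smooth locus is the image of \<open>u \<mapsto> (u, u\<^sup>2, -(1 + u\<^sup>3))\<close>, with \<open>u = y / x \<noteq> 0\<close>.\<close>

lemma std_cubic_parametrization:
  assumes "std_cubic x y z = 0" "x \<noteq> 0" "y \<noteq> 0"
  shows "x = x^2 / y * (y / x)" "y = x^2 / y * (y / x)^2" "z = x^2 / y * (-(1 + (y / x)^3))"
proof -
  have "x * y * z = -(x^3 + y^3)" using assms(1) by (simp add: std_cubic_def algebra_simps eq_neg_iff_add_eq_0)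
  then have "z = -(x^3 + y^3) / (x * y)" using assms by (simp add: field_simps)
  also have "\<dots> = x^2 / y * (-(1 + (y / x)^3))"
    using assms(2,3) by (simp add: field_simps power2_eq_square power3_eq_cube)
  finally show "z = x^2 / y * (-(1 + (y / x)^3))" .
qed (use assms in \<open>simp_all add: field_simps power2_eq_square\<close>)

text \<open>The parameter u = y / x is a local coordinate of the cubic at a smooth point, so every
  immersive branch moves it to first order. Otherwise the velocity would be proportional to the
  point in its first two coordinates, and the equation of the cubic would extend this to the
  third.\<close>

lemma local_branch_slope:
  assumes "local_branch std_cubic (x,y,z) g1 g2 g3" "x \<noteq> 0" "y \<noteq> 0"
  shows "deriv (\<lambda>t. g2 t / g1 t) 0 \<noteq> 0"
proof
  assume 0: "deriv (\<lambda>t. g2 t / g1 t) 0 = 0"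
  obtain r where r: "r > 0" "g1 holomorphic_on ball 0 r" "g2 holomorphic_on ball 0 r" "g3 holomorphic_on ball 0 r"
    and p: "g1 0 = x" "g2 0 = y" "g3 0 = z" and f: "\<forall>t\<in>ball 0 r. std_cubic (g1 t) (g2 t) (g3 t) = 0"
    and imm: "\<And>c. (deriv g1 0, deriv g2 0, deriv g3 0) \<noteq> (c * x, c * y, c * z)"
    using assms(1) unfolding local_branch_def by auto
  have "g field_differentiable at 0" if "g holomorphic_on ball 0 r" for g
    using that r(1) by (auto intro: holomorphic_on_imp_differentiable_at)
  from r(2-4)[THEN this]
  have g: "(g1 has_field_derivative deriv g1 0) (at 0)" "(g2 has_field_derivative deriv g2 0) (at 0)"
    "(g3 has_field_derivative deriv g3 0) (at 0)"
    by (simp_all add: DERIV_deriv_iff_field_differentiable)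
  have "((\<lambda>t. g2 t / g1 t) has_field_derivative (deriv g2 0 * g1 0 - g2 0 * deriv g1 0) / (g1 0 * g1 0)) (at 0)"
    by (rule DERIV_divide[OF g(2) g(1)]) (use p assms in simp)
  then have "(deriv g2 0 * g1 0 - g2 0 * deriv g1 0) / (g1 0 * g1 0) = 0"
    using 0 DERIV_imp_deriv by metis
  then have s: "deriv g2 0 * x = y * deriv g1 0" using p assms(2) by simp
  have ev: "eventually (\<lambda>t. std_cubic (g1 t) (g2 t) (g3 t) = 0) (nhds 0)"
    using f r(1) by (intro eventually_nhds_in_open[of "ball 0 r", THEN eventually_mono]) auto
  have "((\<lambda>t. std_cubic (g1 t) (g2 t) (g3 t)) has_field_derivative
      (y * z + 3 * x^2) * deriv g1 0 + (x * z + 3 * y^2) * deriv g2 0 + x * y * deriv g3 0) (at 0)"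
    using is_poly_has_field_derivative[OF is_poly_std_cubic g] by (simp add: partials_std_cubic p)
  moreover have "((\<lambda>t. std_cubic (g1 t) (g2 t) (g3 t)) has_field_derivative 0) (at 0)"
    by (subst DERIV_cong_ev[OF refl ev refl]) simp
  ultimately have d: "(y * z + 3 * x^2) * deriv g1 0 + (x * z + 3 * y^2) * deriv g2 0 + x * y * deriv g3 0 = 0"
    by (rule DERIV_unique)
  have F: "x * y * z + x^3 + y^3 = 0" using f r(1) p by (auto simp: std_cubic_def)
  define c where "c = deriv g1 0 / x"
  have c1: "deriv g1 0 = c * x" using assms(2) by (simp add: c_def)
  with s have c2: "deriv g2 0 = c * y" using assms(2) by simp
  \<comment> \<open>Subtracting c times Euler's identity x F_x + y F_y + z F_z = 3 F = 0 from the
    differentiated equation leaves F_z (g3' - c z), and F_z = x y.\<close>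
  have "x * y * (deriv g3 0 - c * z) = 0"
    using d F unfolding c1 c2 by algebra
  then have "deriv g3 0 = c * z" using assms by simp
  with c1 c2 imm show False by blast
qed

text \<open>For an arbitrary branch, u - u0 vanishes to first order in t. Hence q along the branch
  vanishes exactly to the order m of the root u0 of \<open>h\<close>, and contact k forces k <=
  m.\<close>

lemma contact_std_cubic_imp_dvd:
  assumes "contact_ge std_cubic q (x,y,z) k" "x \<noteq> 0" "y \<noteq> 0" and q: "hom_poly d q"
    and h: "\<And>u. q u (u^2) (-(1 + u^3)) = poly h u"
  shows "[:- (y / x), 1:] ^ k dvd h"
proof (cases "h = 0")
  case False
  define u0 where "u0 = y / x"
  define m where "m = order u0 h"
  obtain h1 where h1: "h = [:- u0, 1:] ^ m * h1" "\<not> [:- u0, 1:] dvd h1"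
    using order_decomp[OF False] unfolding m_def by blast
  have h1u: "poly h1 u0 \<noteq> 0" using h1(2) by (simp add: poly_eq_0_iff_dvd)
  obtain g1 g2 g3 where b: "local_branch std_cubic (x,y,z) g1 g2 g3"
    and z: "\<forall>j<k. (deriv ^^ j) (\<lambda>t. q (g1 t) (g2 t) (g3 t)) 0 = 0"
    using assms(1) unfolding contact_ge_def by blast
  obtain r where r: "r > 0" "g1 holomorphic_on ball 0 r" "g2 holomorphic_on ball 0 r" "g3 holomorphic_on ball 0 r"
    and p: "g1 0 = x" "g2 0 = y" "g3 0 = z" and f: "\<forall>t\<in>ball 0 r. std_cubic (g1 t) (g2 t) (g3 t) = 0"
    using b unfolding local_branch_def by auto
  \<comment> \<open>The disc is shrunk so that the branch stays in the smooth locus, where u = y / x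
    and the scale x^2 / y are holomorphic and nonzero.\<close>
  have "continuous_on (ball 0 r) (\<lambda>t. g1 t * g2 t)"
    using r by (intro continuous_intros holomorphic_on_imp_continuous_on)
  then have "open (ball 0 r \<inter> (\<lambda>t. g1 t * g2 t) -` (- {0}))"
    by (rule continuous_open_preimage) auto
  moreover have "0 \<in> ball 0 r \<inter> (\<lambda>t. g1 t * g2 t) -` (- {0})" using r(1) p assms by simp
  ultimately obtain s where s: "s > 0" "ball 0 s \<subseteq> ball 0 r \<inter> (\<lambda>t. g1 t * g2 t) -` (- {0})"
    using open_contains_ball by metis
  then have sub: "ball (0::complex) s \<subseteq> ball 0 r" by blast
  have nz: "g1 t \<noteq> 0 \<and> g2 t \<noteq> 0" if "t \<in> ball 0 s" for t
  proof -
    have "t \<in> (\<lambda>t. g1 t * g2 t) -` (- {0})" using s(2) that by blast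
    then show ?thesis by simp
  qed
  note g = r(2-4)[THEN holomorphic_on_subset, OF sub]
  define u where "u t = g2 t / g1 t" for t
  \<comment> \<open>The difference quotient of u with its removable singularity filled in, so that u
    t - u0 = t v(t) and v(0) = u'(0).\<close>
  define v where "v t = (if t = 0 then deriv u 0 else (u t - u 0) / (t - 0))" for t
  define G where "G t = (g1 t ^ 2 / g2 t) ^ d * (v t ^ m * poly h1 (u t))" for t
  have hu: "u holomorphic_on ball 0 s"
    unfolding u_def by (intro holomorphic_intros g) (use nz in auto)
  then have hv: "v holomorphic_on ball 0 s"
    unfolding v_def by (intro pole_lemma_open) auto
  have "(\<lambda>t. poly h1 (u t)) holomorphic_on ball 0 s" using hu by (intro holomorphic_intros)
  then have hG: "G holomorphic_on ball 0 s"
    unfolding G_def using nz by (intro holomorphic_intros g hv hu) auto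
  have eq: "q (g1 t) (g2 t) (g3 t) = t ^ m * G t" if t: "t \<in> ball 0 s" for t
  proof -
    have F: "std_cubic (g1 t) (g2 t) (g3 t) = 0" using f t sub by blast
    define c0 where "c0 = g1 t ^ 2 / g2 t"
    have "g1 t = c0 * u t" "g2 t = c0 * (u t)^2" "g3 t = c0 * (-(1 + (u t)^3))"
      using std_cubic_parametrization[OF F] nz[OF t] unfolding c0_def u_def by blast+
    then have "q (g1 t) (g2 t) (g3 t) = q (c0 * u t) (c0 * (u t)^2) (c0 * (-(1 + (u t)^3)))" by metis
    also have "\<dots> = c0 ^ d * poly h (u t)"
      unfolding hom_poly_scaling[OF q] h ..
    also have "poly h (u t) = (u t - u0) ^ m * poly h1 (u t)" unfolding h1(1) by simp
    also have "u t - u0 = t * v t"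
      by (auto simp: v_def u0_def u_def p)
    finally show ?thesis by (simp add: G_def c0_def power_mult_distrib)
  qed
  have "G 0 \<noteq> 0"
  proof -
    have "v 0 \<noteq> 0" using local_branch_slope[OF b assms(2,3)] unfolding v_def u_def by simp
    moreover have "poly h1 (u 0) \<noteq> 0" using h1u by (simp add: u_def u0_def p)
    ultimately show ?thesis using assms p by (simp add: G_def)
  qed
  have ev: "eventually (\<lambda>t. q (g1 t) (g2 t) (g3 t) = t ^ m * G t) (nhds 0)"
    using eq s(1) by (intro eventually_nhds_in_open[of "ball 0 s", THEN eventually_mono]) auto
  have "(deriv ^^ m) (\<lambda>t. q (g1 t) (g2 t) (g3 t)) 0 = fact m * G 0"
    using higher_deriv_cong_ev[OF ev refl, of m] higher_deriv_power_mult(2)[OF hG s(1)] by simp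
  with \<open>G 0 \<noteq> 0\<close> z have "k \<le> m" by (metis fact_nonzero mult_eq_0_iff not_le)
  then show ?thesis unfolding u0_def[symmetric] order_divides m_def by blast
qed simp

text \<open>Contact is witnessed by the parametrization itself, shifted to u0 and scaled by x^2 / y
  so that it starts at the given triple and not only at the same projective point.\<close>

lemma contact_std_cubic_if_dvd:
  assumes F: "std_cubic x y z = 0" and nz: "x \<noteq> 0" "y \<noteq> 0" and q: "hom_poly d q"
    and h: "\<And>u. q u (u^2) (-(1 + u^3)) = poly h u"
    and dvd: "[:- (y / x), 1:] ^ k dvd h"
  shows "contact_ge std_cubic q (x,y,z) k"
proof -
  define u0 c0 where "u0 = y / x" and "c0 = x^2 / y"
  have nz': "u0 \<noteq> 0" "c0 \<noteq> 0" using nz by (auto simp: u0_def c0_def)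
  note P = std_cubic_parametrization[OF F nz, folded u0_def c0_def]
  define g1 g2 g3 where "g1 t = c0 * (u0 + t)" and "g2 t = c0 * (u0 + t)^2" and "g3 t = c0 * (-(1 + (u0 + t)^3))" for t
  have d1: "deriv g1 0 = c0" unfolding g1_def by (rule DERIV_imp_deriv) (auto intro!: derivative_eq_intros)
  have d2: "deriv g2 0 = 2 * c0 * u0" unfolding g2_def by (rule DERIV_imp_deriv) (auto intro!: derivative_eq_intros)
  have "local_branch std_cubic (x,y,z) g1 g2 g3"
    unfolding local_branch_def
  proof (intro exI[of _ 1] conjI allI ballI)
    show "(g1 0, g2 0, g3 0) = (x, y, z)" using P by (simp add: g1_def g2_def g3_def)
    show "std_cubic (g1 t) (g2 t) (g3 t) = 0" for t unfolding std_cubic_def g1_def g2_def g3_def by algebra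
    fix c
    show "(deriv g1 0, deriv g2 0, deriv g3 0) \<noteq> (c * fst (x,y,z), c * fst (snd (x,y,z)), c * snd (snd (x,y,z)))"
    proof
      assume "(deriv g1 0, deriv g2 0, deriv g3 0) = (c * fst (x,y,z), c * fst (snd (x,y,z)), c * snd (snd (x,y,z)))"
      then have e: "c0 = c * x" "2 * c0 * u0 = c * y" 
        unfolding d1 d2 fst_conv snd_conv prod.inject by blast+
      \<comment> \<open>The velocity (1, 2 u0) and the position (u0, u0^2) are not proportional when
        u0 is nonzero.\<close>
      have "c0 * u0 = 0" using e P(1,2) by algebra
      then show False using nz' by simp
    qed
  qed (auto simp: g1_def[abs_def] g2_def[abs_def] g3_def[abs_def] intro!: holomorphic_intros)
  moreover have "(deriv ^^ j) (\<lambda>t. q (g1 t) (g2 t) (g3 t)) 0 = 0" if "j < k" for j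
  proof -
    obtain e where e: "h = [:- u0, 1:] ^ k * e" using dvd unfolding u0_def by (elim dvdE)
    have "q (g1 t) (g2 t) (g3 t) = t ^ k * (c0 ^ d * poly e (u0 + t))" for t
      unfolding g1_def g2_def g3_def hom_poly_scaling[OF q] h e by simp
    moreover have "(\<lambda>t. c0 ^ d * poly e (u0 + t)) holomorphic_on ball 0 1" by (intro holomorphic_intros)
    ultimately show ?thesis using higher_deriv_power_mult(1)[of _ 1] that by simp
  qed
  ultimately show ?thesis unfolding contact_ge_def by blast
qed

lemma hom_poly_2E:
  assumes "hom_poly 2 q"
  obtains a b c d e m where
    "q = (\<lambda>x y z. a * x^2 + b * x * y + c * y^2 + d * x * z + e * y * z + m * z^2)"
proof -
  obtain C where C: "\<And>x y z. q x y z = (\<Sum>(i,j)\<in>{(i,j). i + j \<le> 2}. C i j * x^i * y^j * z^(2-i-j))"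
    using assms unfolding hom_poly_def by blast
  have S: "{(i,j). i + j \<le> (2::nat)} = {(0,0), (0,1), (0,2), (1,0), (1,1), (2,0)}" by auto
  have "q = (\<lambda>x y z. C 2 0 * x^2 + C 1 1 * x * y + C 0 2 * y^2 + C 1 0 * x * z + C 0 1 * y * z + C 0 0 * z^2)"
    unfolding C S by (intro ext) (simp add: C S algebra_simps numeral_2_eq_2)
  then show ?thesis by (rule that)
qed

text \<open>For \<open>u\<^sup>3 = 1\<close> this conic restricts to \<open>(t - u)^6\<close> on the parametrization.\<close>

definition osc_conic :: "complex \<Rightarrow> cpoly" where
  "osc_conic u = (\<lambda>x y z. 21*u*x^2 - 22*x*y + 21*u^2*y^2 + 6*u^2*x*z + 6*u*y*z + z^2)"

lemma hom_poly_osc_conic: "hom_poly 2 (osc_conic u)"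
  unfolding osc_conic_def by (rule hom_polyI, intro is_poly_intros, algebra)

lemma osc_conic_nonzero: "osc_conic u \<noteq> zero_poly"
proof
  assume "osc_conic u = zero_poly"
  then have "osc_conic u 0 0 1 = zero_poly 0 0 1" by simp
  then show False by (simp add: osc_conic_def zero_poly_def)
qed

lemma linear_power_3: "[:-u, 1:] ^ 3 = [:-(u^3), 3*u^2, -3*u, 1::complex:]"
  by (simp add: power3_eq_cube power2_eq_square)

lemma linear_power_6: "[:-u, 1:] ^ 6 = [:u^6, -6*u^5, 15*u^4, -20*u^3, 15*u^2, -6*u, 1::complex:]"
proof -
  have "[:-u, 1:] ^ 6 = ([:-u, 1:] ^ 3) ^ 2" by (simp flip: power_mult)
  also have "\<dots> = [:u^6, -6*u^5, 15*u^4, -20*u^3, 15*u^2, -6*u, 1:]"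
    unfolding linear_power_3 by (simp add: power2_eq_square eval_nat_numeral)
  finally show ?thesis .
qed

lemma dvd_same_degree:
  fixes h p :: "complex poly"
  assumes "p dvd h" "degree h \<le> degree p" "p \<noteq> 0"
  obtains \<kappa> where "h = smult \<kappa> p"
proof -
  obtain g where g: "h = p * g" using assms(1) by (elim dvdE)
  have "degree g = 0"
    using assms(2,3) g by (cases "g = 0") (auto simp: degree_mult_eq)
  then obtain \<kappa> where "g = [:\<kappa>:]" using degree_eq_zeroE by blast
  then show ?thesis using g that by simp
qed

text \<open>A line restricts to a cubic in the parameter with equal constant and leading
  coefficients. The cube (t - u)^3 has this property exactly when u^3 = -1, and its coefficients
  then give the tangent line.\<close>

lemma flex_std_cubic_if:
  assumes F: "std_cubic x y z = 0" and nz: "x \<noteq> 0" "y \<noteq> 0" and u: "(y / x)^3 = -1"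
  shows "flex_pt std_cubic (x,y,z)"
proof -
  define u where "u = y / x"
  define l :: cpoly where "l = (\<lambda>x y z. 3 * u^2 * x + (-3 * u) * y + (-1) * z)"
  have "l v (v^2) (-(1 + v^3)) = poly [:-(u^3), 3*u^2, -3*u, 1:] v" for v
    using u unfolding l_def u_def by (simp add: algebra_simps power2_eq_square power3_eq_cube)
  moreover have hl: "hom_poly 1 l" unfolding l_def by (rule hom_poly_linear)
  ultimately have "contact_ge std_cubic l (x,y,z) 3"
    by (intro contact_std_cubic_if_dvd[OF F nz hl, of "[:-(u^3), 3*u^2, -3*u, 1:]"])
      (simp_all only: u_def[symmetric] linear_power_3 dvd_refl)
  moreover have "l \<noteq> zero_poly"
  proof
    assume "l = zero_poly"
    then have "l 0 0 1 = zero_poly 0 0 1" by simp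
    then show False by (simp add: l_def zero_poly_def)
  qed
  ultimately show ?thesis unfolding flex_pt_def smooth_pt_std_cubic using F nz hl by blast
qed

lemma flex_std_cubic_imp:
  assumes "flex_pt std_cubic (x,y,z)" shows "(y / x)^3 = -1"
proof -
  define u where "u = y / x"
  have nz: "x \<noteq> 0" "y \<noteq> 0" using assms by (auto simp: flex_pt_def smooth_pt_std_cubic)
  obtain l where l: "hom_poly 1 l" "l \<noteq> zero_poly" "contact_ge std_cubic l (x,y,z) 3"
    using assms unfolding flex_pt_def by blast
  obtain \<alpha> \<beta> \<gamma> where L: "l = (\<lambda>x y z. \<alpha> * x + \<beta> * y + \<gamma> * z)" using l(1) by (rule hom_poly_1E)
  have h: "l v (v^2) (-(1 + v^3)) = poly [:-\<gamma>, \<alpha>, \<beta>, -\<gamma>:] v" for v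
    by (simp add: L algebra_simps power2_eq_square power3_eq_cube)
  from contact_std_cubic_imp_dvd[OF l(3) nz l(1) h]
  have dvd: "[:-u, 1:] ^ 3 dvd [:-\<gamma>, \<alpha>, \<beta>, -\<gamma>:]" unfolding u_def .
  have "degree [:-\<gamma>, \<alpha>, \<beta>, -\<gamma>:] \<le> degree ([:-u, 1:] ^ 3)" by (simp add: linear_power_3)
  then obtain \<kappa> where "[:-\<gamma>, \<alpha>, \<beta>, -\<gamma>:] = smult \<kappa> ([:-u, 1:] ^ 3)"
    using dvd_same_degree[OF dvd] by auto
  then have e: "\<gamma> = \<kappa> * u^3" "\<alpha> = \<kappa> * (3 * u^2)" "\<beta> = \<kappa> * (-3 * u)" "-\<gamma> = \<kappa>"
    unfolding linear_power_3 by auto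
  have "\<kappa> \<noteq> 0"
  proof
    assume "\<kappa> = 0"
    with e L have "l = zero_poly" by (simp add: zero_poly_def)
    then show False using l(2) by blast
  qed
  moreover have "\<kappa> * (u^3 + 1) = 0" using e(1,4) by algebra
  ultimately show ?thesis unfolding u_def by (simp add: eq_neg_iff_add_eq_0)
qed

text \<open>The restriction of \<open>q\<close> has degree at most 6, so it is a multiple \<kappa>
  of (t - u)^6. Its coefficients determine \<open>q\<close> up to \<kappa>, and equality of the
  first and last gives u^6 = 1. When u^3 = -1 the conic is the squared flex tangent; this is why
  sextactic points exclude flexes.\<close>

lemma contact_6_std_cubic_imp:
  assumes "smooth_pt std_cubic (x,y,z)" "hom_poly 2 q" "q \<noteq> zero_poly" "contact_ge std_cubic q (x,y,z) 6"
  obtains "(y / x)^3 = -1" | \<kappa> where "(y / x)^3 = 1" "\<kappa> \<noteq> 0" "q = pscale \<kappa> (osc_conic (y / x))"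
proof -
  define u where "u = y / x"
  have nz: "x \<noteq> 0" "y \<noteq> 0" using assms by (auto simp: smooth_pt_std_cubic)
  obtain a b c d e m where
    Q: "q = (\<lambda>x y z. a * x^2 + b * x * y + c * y^2 + d * x * z + e * y * z + m * z^2)"
    using assms(2) by (rule hom_poly_2E)
  let ?h = "[:m, -d, a - e, b + 2 * m, c - d, -e, m:]"
  have h: "q v (v^2) (-(1 + v^3)) = poly ?h v" for v
    unfolding Q by simp algebra
  from contact_std_cubic_imp_dvd[OF assms(4) nz assms(2) h]
  have dvd: "[:-u, 1:] ^ 6 dvd ?h" unfolding u_def .
  have "degree ?h \<le> degree ([:-u, 1:] ^ 6)" by (simp add: linear_power_6)
  then obtain \<kappa> where "?h = smult \<kappa> ([:-u, 1:] ^ 6)"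
    using dvd_same_degree[OF dvd] by auto
  then have E: "m = \<kappa> * u^6" "-d = \<kappa> * (-6*u^5)" "a - e = \<kappa> * (15*u^4)" "b + 2 * m = \<kappa> * (-20*u^3)"
    "c - d = \<kappa> * (15*u^2)" "-e = \<kappa> * (-6*u)" "m = \<kappa>"
    unfolding linear_power_6 by auto
  have E': "d = 6 * \<kappa> * u^5" "e = 6 * \<kappa> * u" "a = 15 * \<kappa> * u^4 + 6 * \<kappa> * u" "b = -20 * \<kappa> * u^3 - 2 * \<kappa>"
    "c = 15 * \<kappa> * u^2 + 6 * \<kappa> * u^5"
    using E by algebra+
  have "\<kappa> \<noteq> 0"
  proof
    assume "\<kappa> = 0"
    with E' E Q have "q = zero_poly" by (simp add: zero_poly_def)
    then show False using assms(3) by blast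
  qed
  moreover have "\<kappa> * ((u^3 - 1) * (u^3 + 1)) = \<kappa> * u^6 - \<kappa>" by algebra
  then have "\<kappa> * ((u^3 - 1) * (u^3 + 1)) = 0" using E(1,7) by simp
  ultimately have "u^3 - 1 = 0 \<or> u^3 + 1 = 0" by simp
  then consider "u^3 = 1" | "u^3 = -1" by (auto simp: eq_neg_iff_add_eq_0)
  then show ?thesis
  proof cases
    case 1
    then have u: "u^4 = u" "u^5 = u^2" by algebra+
    have "q = pscale \<kappa> (osc_conic u)"
      unfolding Q osc_conic_def pscale_def E' u 1 E(7) by (intro ext) algebra
    then show ?thesis using that(2)[of \<kappa>] 1 \<open>\<kappa> \<noteq> 0\<close> by (simp add: u_def)
  next
    case 2
    then show ?thesis using that(1) by (simp add: u_def)
  qed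
qed

lemma contact_6_std_cubic_if:
  assumes F: "std_cubic x y z = 0" and nz: "x \<noteq> 0" "y \<noteq> 0" and 1: "(y / x)^3 = 1"
  shows "contact_ge std_cubic (osc_conic (y / x)) (x,y,z) 6"
proof (rule contact_std_cubic_if_dvd[OF F nz hom_poly_osc_conic])
  define u where "u = y / x"
  have u: "u^3 = 1" using 1 by (simp add: u_def)
  then have "u^4 = u" "u^5 = u^2" "u^6 = 1" by algebra+
  note u' = u this
  show "osc_conic (y / x) v (v^2) (-(1 + v^3)) = poly ([:-(y / x), 1:] ^ 6) v" for v
    unfolding u_def[symmetric] linear_power_6 u' osc_conic_def by simp algebra
qed simp

text \<open>The third coordinate -(1 + u^3) of the parametrization equals -2 when u^3 = 1.\<close>

definition sext_point :: "complex \<Rightarrow> complex \<Rightarrow> cpt" where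
  "sext_point c u = (c * u, c * u^2, - 2 * c)"

lemma hyperosculating_std_cubic_sext_point:
  assumes "c \<noteq> 0" "u^3 = 1"
  shows "hyperosculating std_cubic (sext_point c u) (osc_conic u)"
proof -
  have u: "u \<noteq> 0" using assms by auto
  have F: "std_cubic (c * u) (c * u^2) (- 2 * c) = 0"
    using assms(2) unfolding std_cubic_def by algebra
  have q: "c * u^2 / (c * u) = u" using assms u by (simp add: power2_eq_square)
  have nz: "c * u \<noteq> 0" "c * u^2 \<noteq> 0" using assms u by auto
  have "contact_ge std_cubic (osc_conic u) (sext_point c u) 6"
    using contact_6_std_cubic_if[OF F nz] unfolding q sext_point_def by (simp add: assms)
  moreover have "\<not> flex_pt std_cubic (sext_point c u)"
    using flex_std_cubic_imp[of "c * u" "c * u^2" "-2 * c"] unfolding q sext_point_def by (auto simp: assms)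
  moreover have "smooth_pt std_cubic (sext_point c u)" unfolding sext_point_def smooth_pt_std_cubic using F nz by blast
  ultimately show ?thesis
    unfolding hyperosculating_def sextactic_pt_def using hom_poly_osc_conic osc_conic_nonzero by blast
qed

lemma hyperosculating_std_cubic_imp:
  assumes "hyperosculating std_cubic p q"
  obtains c u \<kappa> where "c \<noteq> 0" "u^3 = 1" "\<kappa> \<noteq> 0" "p = sext_point c u" "q = pscale \<kappa> (osc_conic u)"
proof -
  obtain x y z where p: "p = (x,y,z)" by (metis prod_cases3)
  have s: "smooth_pt std_cubic (x,y,z)" "\<not> flex_pt std_cubic (x,y,z)" and q: "hom_poly 2 q" "q \<noteq> zero_poly" "contact_ge std_cubic q (x,y,z) 6"
    using assms by (auto simp: hyperosculating_def sextactic_pt_def p)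
  have F: "std_cubic x y z = 0" "x \<noteq> 0" "y \<noteq> 0" using s(1) by (auto simp: smooth_pt_std_cubic)
  have "(y / x)^3 \<noteq> -1" using flex_std_cubic_if[OF F] s(2) by blast
  then obtain \<kappa> where k: "(y / x)^3 = 1" "\<kappa> \<noteq> 0" "q = pscale \<kappa> (osc_conic (y / x))"
    using contact_6_std_cubic_imp[OF s(1) q] by blast
  have "p = sext_point (x^2 / y) (y / x)"
    using std_cubic_parametrization[OF F] unfolding p sext_point_def k(1) by simp
  then show ?thesis using that[of "x^2 / y" "y / x" \<kappa>] k F by simp
qed

section \<open>The normal form of a nodal cubic\<close>

lemma linear_change_diag:
  assumes "w^3 = (1::complex)"
  shows "linear_change (\<lambda>x y z. w^2 * x) (\<lambda>x y z. w * y) (\<lambda>x y z. z)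
    (\<lambda>x y z. w * x) (\<lambda>x y z. w^2 * y) (\<lambda>x y z. z)"
proof -
  have h: "hom_poly 1 (\<lambda>x y z. w^2 * x)" "hom_poly 1 (\<lambda>x y z. w * x)"
    "hom_poly 1 (\<lambda>x y z. w^2 * y)" "hom_poly 1 (\<lambda>x y z. w * y)" "hom_poly 1 (\<lambda>x y z. z)"
    using hom_poly_linear[of "w^2" 0 0] hom_poly_linear[of w 0 0] hom_poly_linear[of 0 "w^2" 0]
      hom_poly_linear[of 0 w 0] hom_poly_linear[of 0 0 1] by simp_all
  have e: "w^2 * (w * x) = x" "w * (w^2 * x) = x" for x
    using assms by algebra+
  show ?thesis by unfold_locales (rule h e refl)+
qed

lemma distinct_cube_roots:
  assumes "u^3 = (1::complex)" "v^3 = 1" "u \<noteq> v"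
  shows "u^2 + u * v + v^2 = 0"
proof -
  have "(u - v) * (u^2 + u * v + v^2) = u^3 - v^3" by algebra
  with assms show ?thesis by simp
qed

definition conic_pair :: cpoly where
  "conic_pair = (\<lambda>x y z. 441*x^4 + 462*x^3*y - 126*x^3*z + 43*x^2*y^2 + 384*x^2*y*z + 15*x^2*z^2 + 462*x*y^3 + 384*x*y^2*z - 80*x*y*z^2 - 6*x*z^3 + 441*y^4 - 126*y^3*z + 15*y^2*z^2 - 6*y*z^3 + z^4)"

text \<open>The symmetry attached to w divides curve parameters by w. If w is the remaining cube
  root of unity, it carries u and v to the two primitive cube roots, whose conics multiply to
  \<open>conic_pair\<close>.\<close>

lemma osc_conic_mult:
  assumes u: "u^2 + u * v + v^2 = 0" and w: "w = - (u + v)" "w^3 = 1"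
  shows "osc_conic u x y z * osc_conic v x y z = conic_pair (w^2 * x) (w * y) z"
proof -
  have 1: "v = - w - u" "u^2 = - (w * u) - w^2" using u w(1) by algebra+
  show ?thesis unfolding osc_conic_def conic_pair_def using 1 w(2) by algebra
qed

lemma osc_conic_1: "osc_conic 1 x y z = 21*x^2 - 22*x*y + 21*y^2 + 6*x*z + 6*y*z + z^2"
  by (simp add: osc_conic_def)

lemma osc_conic_diag:
  assumes "w^3 = 1" shows "osc_conic w x y z = osc_conic 1 (w^2 * x) (w * y) z"
  unfolding osc_conic_1 unfolding osc_conic_def using assms by algebra

lemma std_cubic_diag:
  assumes "w^3 = 1" shows "std_cubic x y z = std_cubic (w^2 * x) (w * y) z"
  unfolding std_cubic_def using assms by algebra

lemma free_std_cubic_osc_conic: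
  assumes "w^3 = 1" shows "free_with_exponents (pmult std_cubic (osc_conic w)) [2, 2]"
proof -
  interpret linear_change "\<lambda>x y z. w^2 * x" "\<lambda>x y z. w * y" "\<lambda>x y z. z"
      "\<lambda>x y z. w * x" "\<lambda>x y z. w^2 * y" "\<lambda>x y z. z"
    by (rule linear_change_diag[OF assms])
  have "quintic x y z = std_cubic x y z * osc_conic 1 x y z" for x y z
    unfolding quintic_def osc_conic_1 by algebra
  then have "pmult std_cubic (osc_conic w) = pull quintic"
    using std_cubic_diag[OF assms] osc_conic_diag[OF assms] by (auto simp: pmult_def pull_def fun_eq_iff)
  then show ?thesis using free_with_exponents_pull[OF is_poly_quintic free_quintic] by simp
qed

lemma third_cube_root:
  assumes "u^3 = (1::complex)" "v^3 = 1" "u \<noteq> v"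
  shows "(- (u + v))^3 = 1"
  using distinct_cube_roots[OF assms] assms(1) by algebra

lemma free_std_cubic_two_osc_conics:
  assumes "u^3 = 1" "v^3 = 1" "u \<noteq> v"
  shows "free_with_exponents (pmult (pmult std_cubic (osc_conic u)) (osc_conic v)) [3, 3]"
proof -
  define w where "w = - (u + v)"
  have w: "w^3 = 1" unfolding w_def by (rule third_cube_root[OF assms])
  interpret linear_change "\<lambda>x y z. w^2 * x" "\<lambda>x y z. w * y" "\<lambda>x y z. z"
      "\<lambda>x y z. w * x" "\<lambda>x y z. w^2 * y" "\<lambda>x y z. z"
    by (rule linear_change_diag[OF w])
  have "septic x y z = std_cubic x y z * conic_pair x y z" for x y z
    unfolding septic_def conic_pair_def ..
  then have "pmult (pmult std_cubic (osc_conic u)) (osc_conic v) = pull septic"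
    using std_cubic_diag[OF w] osc_conic_mult[OF distinct_cube_roots[OF assms] w_def w]
    by (auto simp: pmult_def pull_def fun_eq_iff mult.assoc)
  then show ?thesis using free_with_exponents_pull[OF is_poly_septic free_septic] by simp
qed

lemma msyzygy_std_cubic_three_osc_conics:
  assumes "u^3 = 1" "v^3 = 1" "w^3 = 1" "u \<noteq> v" "u \<noteq> w" "v \<noteq> w"
  shows "msyzygy_with_exponents (pmult (pmult (pmult std_cubic (osc_conic u)) (osc_conic v)) (osc_conic w)) [5, 5, 5, 5]"
proof -
  interpret linear_change "\<lambda>x y z. w^2 * x" "\<lambda>x y z. w * y" "\<lambda>x y z. z"
      "\<lambda>x y z. w * x" "\<lambda>x y z. w^2 * y" "\<lambda>x y z. z"
    by (rule linear_change_diag[OF assms(3)])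
  have uv: "u^2 + u * v + v^2 = 0" and uw: "u^2 + u * w + w^2 = 0"
    using distinct_cube_roots assms by blast+
  \<comment> \<open>This recovers that distinct cube roots of unity sum to zero, so the third root
    is the one by which \<open>osc_conic_mult\<close> normalizes the other two.\<close>
  have "(v - w) * (u + v + w) = (u^2 + u * v + v^2) - (u^2 + u * w + w^2)" by algebra
  then have "u + v + w = 0" using uv uw assms(6) by simp
  then have w: "w = - (u + v)" by algebra
  have "nonic x y z = std_cubic x y z * (conic_pair x y z * osc_conic 1 x y z)" for x y z
  proof -
    have "conic_pair x y z * osc_conic 1 x y z = 9261*x^6 + 16254*x^4*y*z + 18458*x^3*y^3 - 162*x^3*z^3 + 7041*x^2*y^2*z^2 + 16254*x*y^4*z - 174*x*y*z^4 + 9261*y^6 - 162*y^3*z^3 + z^6"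
      unfolding conic_pair_def osc_conic_1 by algebra
    then show ?thesis unfolding nonic_def by simp
  qed
  then have "pmult (pmult (pmult std_cubic (osc_conic u)) (osc_conic v)) (osc_conic w) = pull nonic"
    using std_cubic_diag[OF assms(3)] osc_conic_diag[OF assms(3)] osc_conic_mult[OF uv w assms(3)]
    by (auto simp: pmult_def pull_def fun_eq_iff mult.assoc)
  then show ?thesis using msyzygy_with_exponents_pull[OF is_poly_nonic msyzygy_nonic] by simp
qed

section \<open>Coordinates adapted to the node\<close>

lemma hom_poly_3E:
  assumes "hom_poly 3 f"
  obtains c1 c2 c3 c4 c5 c6 c7 c8 c9 c10 where
    "f = (\<lambda>x y z. c1 * x^3 + c2 * x^2 * y + c3 * x * y^2 + c4 * y^3 + c5 * x^2 * z + c6 * x * y * z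
      + c7 * y^2 * z + c8 * x * z^2 + c9 * y * z^2 + c10 * z^3)"
proof -
  obtain C where C: "\<And>x y z. f x y z = (\<Sum>(i,j)\<in>{(i,j). i + j \<le> 3}. C i j * x^i * y^j * z^(3-i-j))"
    using assms unfolding hom_poly_def by blast
  have S: "{(i,j). i + j \<le> (3::nat)} = Sigma {..3} (\<lambda>i. {..3 - i})" by auto
  have "f = (\<lambda>x y z. C 3 0 * x^3 + C 2 1 * x^2 * y + C 1 2 * x * y^2 + C 0 3 * y^3 + C 2 0 * x^2 * z + C 1 1 * x * y * z
      + C 0 2 * y^2 * z + C 1 0 * x * z^2 + C 0 1 * y * z^2 + C 0 0 * z^3)"
    unfolding C S by (intro ext) (simp add: C S sum.Sigma[symmetric] algebra_simps eval_nat_numeral)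
  then show ?thesis by (rule that)
qed

text \<open>The expansion of f(w p + v) in powers of w. It is doubled because
  \<open>hess_form\<close> is the full second derivative, without the Taylor factor 1/2.\<close>

lemma cubic_taylor:
  assumes "hom_poly 3 f"
  shows "2 * f (w * p1 + x) (w * p2 + y) (w * p3 + z) = 2 * w^3 * f p1 p2 p3
    + 2 * w^2 * (dX f p1 p2 p3 * x + dY f p1 p2 p3 * y + dZ f p1 p2 p3 * z)
    + w * hess_form f (p1,p2,p3) x y z + 2 * f x y z"
proof -
  obtain c1 c2 c3 c4 c5 c6 c7 c8 c9 c10 where
    f: "f = (\<lambda>x y z. c1 * x^3 + c2 * x^2 * y + c3 * x * y^2 + c4 * y^3 + c5 * x^2 * z + c6 * x * y * z
      + c7 * y^2 * z + c8 * x * z^2 + c9 * y * z^2 + c10 * z^3)"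
    using assms by (rule hom_poly_3E)
  have dX: "dX f = (\<lambda>x y z. 3 * c1 * x^2 + 2 * c2 * x * y + c3 * y^2 + 2 * c5 * x * z + c6 * y * z + c8 * z^2)"
    unfolding dX_def f by (intro ext DERIV_imp_deriv) (auto intro!: derivative_eq_intros)
  have dY: "dY f = (\<lambda>x y z. c2 * x^2 + 2 * c3 * x * y + 3 * c4 * y^2 + c6 * x * z + 2 * c7 * y * z + c9 * z^2)"
    unfolding dY_def f by (intro ext DERIV_imp_deriv) (auto intro!: derivative_eq_intros)
  have dZ: "dZ f = (\<lambda>x y z. c5 * x^2 + c6 * x * y + c7 * y^2 + 2 * c8 * x * z + 2 * c9 * y * z + 3 * c10 * z^2)"
    unfolding dZ_def f by (intro ext DERIV_imp_deriv) (auto intro!: derivative_eq_intros)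
  have dXX:
    "dX (dX f) = (\<lambda>x y z. 6 * c1 * x + 2 * c2 * y + 2 * c5 * z)"
    "dX (dY f) = (\<lambda>x y z. 2 * c2 * x + 2 * c3 * y + c6 * z)"
    "dX (dZ f) = (\<lambda>x y z. 2 * c5 * x + c6 * y + 2 * c8 * z)"
    unfolding dX dY dZ unfolding dX_def by (intro ext DERIV_imp_deriv; auto intro!: derivative_eq_intros)+
  have dYX:
    "dY (dX f) = (\<lambda>x y z. 2 * c2 * x + 2 * c3 * y + c6 * z)"
    "dY (dY f) = (\<lambda>x y z. 2 * c3 * x + 6 * c4 * y + 2 * c7 * z)"
    "dY (dZ f) = (\<lambda>x y z. c6 * x + 2 * c7 * y + 2 * c9 * z)"
    unfolding dX dY dZ unfolding dY_def by (intro ext DERIV_imp_deriv; auto intro!: derivative_eq_intros)+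
  have dZX:
    "dZ (dX f) = (\<lambda>x y z. 2 * c5 * x + c6 * y + 2 * c8 * z)"
    "dZ (dY f) = (\<lambda>x y z. c6 * x + 2 * c7 * y + 2 * c9 * z)"
    "dZ (dZ f) = (\<lambda>x y z. 2 * c8 * x + 2 * c9 * y + 6 * c10 * z)"
    unfolding dX dY dZ unfolding dZ_def by (intro ext DERIV_imp_deriv; auto intro!: derivative_eq_intros)+
  show ?thesis
    unfolding hess_form_def ev_def fst_conv snd_conv dXX dYX dZX
    unfolding dX dY dZ
    unfolding f by algebra
qed

text \<open>At a singular point only the Hessian and cubic terms remain. The two tangent lines pass
  through the node, so taking h1 and h2 as coordinates places it at (0:0:1).\<close>

lemma nodal_expansion:
  assumes "hom_poly 3 f" and sing: "singular_pt f (p1,p2,p3)" and hess: "hess_form f (p1,p2,p3) = pmult h1 h2"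
    and h1: "h1 = (\<lambda>x y z. a1 * x + a2 * y + a3 * z)" and h2: "h2 = (\<lambda>x y z. b1 * x + b2 * y + b3 * z)"
    and "h2 \<noteq> zero_poly" "\<forall>c. h1 \<noteq> pscale c h2"
  shows "2 * f (w * p1 + x) (w * p2 + y) (w * p3 + z) = w * (h1 x y z * h2 x y z) + 2 * f x y z"
    "h1 p1 p2 p3 = 0" "h2 p1 p2 p3 = 0"
proof -
  have s: "f p1 p2 p3 = 0" "dX f p1 p2 p3 = 0" "dY f p1 p2 p3 = 0" "dZ f p1 p2 p3 = 0"
    using sing by (auto simp: singular_pt_def ev_def)
  have E: "2 * f (w * p1 + x) (w * p2 + y) (w * p3 + z) = w * (h1 x y z * h2 x y z) + 2 * f x y z" for w x y z
    using cubic_taylor[OF assms(1), of w p1 x p2 y p3 z] by (simp add: s hess pmult_def)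
  then show "2 * f (w * p1 + x) (w * p2 + y) (w * p3 + z) = w * (h1 x y z * h2 x y z) + 2 * f x y z" .
  \<comment> \<open>Translating by a multiple of the singular point does not change the quadratic form.\<close>
  have Q: "h1 (p1 + x) (p2 + y) (p3 + z) * h2 (p1 + x) (p2 + y) (p3 + z) = h1 x y z * h2 x y z" for x y z
    using E[of 1 "p1 + x" "p2 + y" "p3 + z"] E[of 2 x y z] E[of 1 x y z]
    by (simp add: add.assoc[symmetric])
  have q0: "h1 p1 p2 p3 * h2 p1 p2 p3 = 0" using Q[of 0 0 0] by (simp add: h1 h2)
  have q1: "h1 p1 p2 p3 * h2 x y z + h2 p1 p2 p3 * h1 x y z = 0" for x y z
    using Q[of x y z] q0 unfolding h1 h2 by algebra
  show 1: "h1 p1 p2 p3 = 0"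
  proof (rule ccontr)
    assume "h1 p1 p2 p3 \<noteq> 0"
    then have "h2 x y z = 0" for x y z using q0 q1[of x y z] by simp
    then have "h2 = zero_poly" by (auto simp: zero_poly_def fun_eq_iff)
    then show False using assms(6) by blast
  qed
  show "h2 p1 p2 p3 = 0"
  proof (rule ccontr)
    assume "h2 p1 p2 p3 \<noteq> 0"
    then have "h1 x y z = 0" for x y z using 1 q1[of x y z] by simp
    then have "h1 = pscale 0 h2" by (auto simp: pscale_def fun_eq_iff)
    then show False using assms(7) by blast
  qed
qed

lemma complex_cube_root:
  obtains r where "r^3 = (a::complex)"
proof (cases "a = 0")
  case False
  then have "exp (Ln a / 3) ^ 3 = a" by (simp flip: exp_of_nat_mult)
  then show ?thesis using that by blast
qed (use that[of 0] in simp)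

lemma hom_poly_1_compose:
  assumes "hom_poly 1 k" "hom_poly 1 a" "hom_poly 1 b" "hom_poly 1 c"
  shows "hom_poly 1 (\<lambda>x y z. k (a x y z) (b x y z) (c x y z))"
proof (rule hom_polyI)
  show "is_poly (\<lambda>x y z. k (a x y z) (b x y z) (c x y z))"
    by (rule is_poly_subst[OF assms[THEN hom_poly_imp_is_poly]])
qed (simp only: assms[THEN hom_poly_scaling] power_one_right)

lemma nodal_cubic_coordinates:
  assumes "irreducible_nodal_cubic f"
  obtains l1 l2 l3 k1 k2 k3 A B C E \<kappa> where "linear_change l1 l2 l3 k1 k2 k3" "\<kappa> \<noteq> 0"
    "\<And>x y z. f (k1 x y z) (k2 x y z) (k3 x y z) = A * x^3 + B * x^2 * y + C * x * y^2 + E * y^3 + \<kappa> * x * y * z"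
proof -
  obtain p where f: "hom_poly 3 f" and p: "node_pt f p"
    using assms unfolding irreducible_nodal_cubic_def by blast
  obtain p1 p2 p3 where pp: "p = (p1,p2,p3)" by (metis prod_cases3)
  obtain h1 h2 where h: "hom_poly 1 h1" "hom_poly 1 h2" "h2 \<noteq> zero_poly" "\<forall>c. h1 \<noteq> pscale c h2"
    "hess_form f (p1,p2,p3) = pmult h1 h2" and sing: "singular_pt f (p1,p2,p3)"
    using p unfolding node_pt_def pp by blast
  obtain a1 a2 a3 where h1: "h1 = (\<lambda>x y z. a1 * x + a2 * y + a3 * z)" using h(1) by (rule hom_poly_1E)
  obtain b1 b2 b3 where h2: "h2 = (\<lambda>x y z. b1 * x + b2 * y + b3 * z)" using h(2) by (rule hom_poly_1E)
  note N = nodal_expansion[OF f sing h(5) h1 h2 h(3,4)]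
  \<comment> \<open>The cross product of the coefficient vectors of h1 and h2. It is nonzero because
    the tangent lines are distinct, so some vector g completes the two to a basis.\<close>
  define n1 n2 n3 where "n1 = a2 * b3 - a3 * b2" and "n2 = a3 * b1 - a1 * b3" and "n3 = a1 * b2 - a2 * b1"
  have "\<not> (n1 = 0 \<and> n2 = 0 \<and> n3 = 0)"
  proof
    assume n: "n1 = 0 \<and> n2 = 0 \<and> n3 = 0"
    have "b1 \<noteq> 0 \<or> b2 \<noteq> 0 \<or> b3 \<noteq> 0" using h(3) by (auto simp: h2 zero_poly_def)
    then obtain c where "a1 = c * b1 \<and> a2 = c * b2 \<and> a3 = c * b3"
    proof (elim disjE)
      assume "b1 \<noteq> 0"
      then show ?thesis using n that[of "a1 / b1"] by (simp add: n1_def n2_def n3_def field_simps)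
    next
      assume "b2 \<noteq> 0"
      then show ?thesis using n that[of "a2 / b2"] by (simp add: n1_def n2_def n3_def field_simps)
    next
      assume "b3 \<noteq> 0"
      then show ?thesis using n that[of "a3 / b3"] by (simp add: n1_def n2_def n3_def field_simps)
    qed
    then have "h1 = pscale c h2" by (auto simp: h1 h2 pscale_def fun_eq_iff algebra_simps)
    then show False using h(4) by blast
  qed
  then obtain g1 g2 g3 where D0: "g1 * n1 + g2 * n2 + g3 * n3 \<noteq> 0"
  proof -
    assume *: "\<And>g1 g2 g3. g1 * n1 + g2 * n2 + g3 * n3 \<noteq> 0 \<Longrightarrow> thesis"
    from \<open>\<not> (n1 = 0 \<and> n2 = 0 \<and> n3 = 0)\<close> show thesis using *[of 1 0 0] *[of 0 1 0] *[of 0 0 1] by auto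
  qed
  define D where "D = inverse (g1 * n1 + g2 * n2 + g3 * n3)"
  have D: "D * (g1 * n1 + g2 * n2 + g3 * n3) = 1" using D0 by (simp add: D_def)
  note D' = D[unfolded n1_def n2_def n3_def]
  define h3 :: cpoly where "h3 = (\<lambda>x y z. g1 * x + g2 * y + g3 * z)"
  \<comment> \<open>The inverse of the matrix with rows a, b, g: its columns are the cross products
    b x g, g x a and a x b, divided by the determinant.\<close>
  define k1 :: cpoly where "k1 = (\<lambda>x y z. D * (b2 * g3 - b3 * g2) * x + D * (g2 * a3 - g3 * a2) * y + D * n1 * z)"
  define k2 :: cpoly where "k2 = (\<lambda>x y z. D * (b3 * g1 - b1 * g3) * x + D * (g3 * a1 - g1 * a3) * y + D * n2 * z)"
  define k3 :: cpoly where "k3 = (\<lambda>x y z. D * (b1 * g2 - b2 * g1) * x + D * (g1 * a2 - g2 * a1) * y + D * n3 * z)"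
  have hk: "h1 (k1 x y z) (k2 x y z) (k3 x y z) = x" "h2 (k1 x y z) (k2 x y z) (k3 x y z) = y"
    "h3 (k1 x y z) (k2 x y z) (k3 x y z) = z" for x y z
    unfolding h1 h2 h3_def k1_def k2_def k3_def n1_def n2_def n3_def using D' by algebra+
  have kh: "k1 (h1 x y z) (h2 x y z) (h3 x y z) = x" "k2 (h1 x y z) (h2 x y z) (h3 x y z) = y"
    "k3 (h1 x y z) (h2 x y z) (h3 x y z) = z" for x y z
    unfolding h1 h2 h3_def k1_def k2_def k3_def n1_def n2_def n3_def using D' by algebra+
  have lc: "linear_change h1 h2 h3 k1 k2 k3"
  proof (unfold_locales)
    show "hom_poly 1 h3" unfolding h3_def by (rule hom_poly_linear)
    show "hom_poly 1 k1" unfolding k1_def by (rule hom_poly_linear)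
    show "hom_poly 1 k2" unfolding k2_def by (rule hom_poly_linear)
    show "hom_poly 1 k3" unfolding k3_def by (rule hom_poly_linear)
  qed (rule h hk kh)+
  define t where "t = h3 p1 p2 p3"
  have pk: "p1 = k1 0 0 t" "p2 = k2 0 0 t" "p3 = k3 0 0 t"
    using kh[of p1 p2 p3] unfolding N(2,3) t_def by simp_all
  have "t \<noteq> 0"
  proof
    assume "t = 0"
    then have "(p1,p2,p3) = (0,0,0)" using pk by (simp add: k1_def k2_def k3_def)
    then show False using sing by (simp add: singular_pt_def)
  qed
  define \<kappa> where "\<kappa> = 1 / (2 * t)"
  have "hom_poly 3 (\<lambda>x y z. f (k1 x y z) (k2 x y z) (k3 x y z))"
    using linear_change.hom_poly_pull[OF linear_change.inverse[OF lc] f]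
    by (simp add: linear_change.pull_def[OF linear_change.inverse[OF lc]])
  then obtain A B C E c5 c6 c7 c8 c9 c10 where
    G: "(\<lambda>x y z. f (k1 x y z) (k2 x y z) (k3 x y z)) = (\<lambda>x y z. A * x^3 + B * x^2 * y + C * x * y^2 + E * y^3
      + c5 * x^2 * z + c6 * x * y * z + c7 * y^2 * z + c8 * x * z^2 + c9 * y * z^2 + c10 * z^3)"
    by (rule hom_poly_3E)
  have "f (k1 x y z) (k2 x y z) (k3 x y z) = A * x^3 + B * x^2 * y + C * x * y^2 + E * y^3 + \<kappa> * x * y * z" for x y z
  proof -
    \<comment> \<open>In the new coordinates the node is (0,0,t), so varying z translates by a
      multiple of the node. By \<open>nodal_expansion\<close> z then occurs only in x y z / (2 t),
      which explains \<kappa>.\<close>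
    have "k1 x y z = z / t * p1 + k1 x y 0" "k2 x y z = z / t * p2 + k2 x y 0" "k3 x y z = z / t * p3 + k3 x y 0"
      unfolding pk k1_def k2_def k3_def using \<open>t \<noteq> 0\<close> by simp_all
    then have "2 * f (k1 x y z) (k2 x y z) (k3 x y z) = z / t * (x * y) + 2 * f (k1 x y 0) (k2 x y 0) (k3 x y 0)"
      using N(1)[of "z / t" "k1 x y 0" "k2 x y 0" "k3 x y 0"] by (simp add: hk)
    also have "f (k1 x y 0) (k2 x y 0) (k3 x y 0) = A * x^3 + B * x^2 * y + C * x * y^2 + E * y^3"
      using fun_cong[OF fun_cong[OF fun_cong[OF G, of x], of y], of 0] by simp
    finally show ?thesis using \<open>t \<noteq> 0\<close> by (simp add: \<kappa>_def field_simps)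
  qed
  moreover have "\<kappa> \<noteq> 0" using \<open>t \<noteq> 0\<close> by (simp add: \<kappa>_def)
  ultimately show ?thesis using that lc by blast
qed

text \<open>A factorization with a coordinate line contradicts irreducibility once the cofactor is
  not constant; a zero at the origin together with a nonzero value elsewhere shows that.\<close>

lemma not_divisible_by_line:
  assumes "irreducible_poly f" "linear_change l1 l2 l3 k1 k2 k3"
    and l: "l = l1 \<or> l = l2"
    and f: "\<And>x y z. f x y z = l x y z * m x y z"
    and m: "is_poly m" "m 0 0 0 = 0" "m a b c \<noteq> 0"
  shows False
proof -
  interpret linear_change l1 l2 l3 k1 k2 k3 by (rule assms(2))
  have l1: "hom_poly 1 l" using l hom_l by blast
  have "f = pmult l m" using f by (auto simp: pmult_def fun_eq_iff)
  then have "is_constant l \<or> is_constant m"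
    using assms(1) m hom_poly_imp_is_poly[OF l1] unfolding irreducible_poly_def by blast
  moreover have "\<not> is_constant m"
  proof
    assume "is_constant m"
    then obtain e where "m = (\<lambda>_ _ _. e)" unfolding is_constant_def by blast
    then show False using m by simp
  qed
  moreover have "\<not> is_constant l"
  proof
    assume "is_constant l"
    then obtain e where e: "l = (\<lambda>_ _ _. e)" unfolding is_constant_def by blast
    have "l 0 0 0 = 0" using hom_poly_scaling[OF l1, of 0 0 0 0] by simp
    moreover have "l (k1 1 1 0) (k2 1 1 0) (k3 1 1 0) = 1" using l lk by auto
    ultimately show False unfolding e by simp
  qed
  ultimately show False by blast
qed

text \<open>Irreducibility makes the coefficients A of x^3 and E of y^3 nonzero, since otherwise y
  or x would be a factor. Cube roots of A and E rescale x and y, and B x^2 y + C x y^2 = x y (B x +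
  C y) is absorbed into z.\<close>

lemma nodal_cubic_normal_form:
  assumes "irreducible_nodal_cubic f"
  obtains l1 l2 l3 k1 k2 k3 where "linear_change l1 l2 l3 k1 k2 k3"
    "f = linear_change.pull l1 l2 l3 std_cubic"
proof -
  obtain l1 l2 l3 k1 k2 k3 A B C E \<kappa> where lc: "linear_change l1 l2 l3 k1 k2 k3" and "\<kappa> \<noteq> 0"
    and G: "\<And>x y z. f (k1 x y z) (k2 x y z) (k3 x y z)
      = A * x^3 + B * x^2 * y + C * x * y^2 + E * y^3 + \<kappa> * x * y * z"
    using nodal_cubic_coordinates[OF assms] by metis
  have irr: "irreducible_poly f" using assms unfolding irreducible_nodal_cubic_def by blast
  interpret linear_change l1 l2 l3 k1 k2 k3 by (rule lc)
  have f: "f x y z = A * l1 x y z^3 + B * l1 x y z^2 * l2 x y z + C * l1 x y z * l2 x y z^2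
      + E * l2 x y z^3 + \<kappa> * l1 x y z * l2 x y z * l3 x y z" for x y z
    using G[of "l1 x y z" "l2 x y z" "l3 x y z"] by (simp add: kl)
  have l0: "l1 0 0 0 = 0" "l2 0 0 0 = 0" "l3 0 0 0 = 0"
    using hom_l[THEN hom_poly_scaling, of 0 0 0 0] by simp_all
  have "A \<noteq> 0"
  proof
    assume A: "A = 0"
    define m where "m = (\<lambda>x y z. B * l1 x y z^2 + C * l1 x y z * l2 x y z + E * l2 x y z^2 + \<kappa> * l1 x y z * l3 x y z)"
    have "f x y z = l2 x y z * m x y z" for x y z
      unfolding f A m_def by algebra
    moreover have pm: "is_poly m" unfolding m_def by (intro is_poly_intros polys)
    moreover have "m 0 0 0 = 0" by (simp add: m_def l0)
    ultimately have "m x y z = 0" for x y z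
      using not_divisible_by_line[OF irr lc, of l2 m x y z] by blast
    \<comment> \<open>In the coordinates (l1, l2, l3) the points (1,0,0) and (1,0,1) give B = 0 and
      B + \<kappa> = 0.\<close>
    from this[of "k1 1 0 0" "k2 1 0 0" "k3 1 0 0"] this[of "k1 1 0 1" "k2 1 0 1" "k3 1 0 1"]
    show False using \<open>\<kappa> \<noteq> 0\<close> by (simp add: m_def lk)
  qed
  have "E \<noteq> 0"
  proof
    assume E: "E = 0"
    define m where "m = (\<lambda>x y z. A * l1 x y z^2 + B * l1 x y z * l2 x y z + C * l2 x y z^2 + \<kappa> * l2 x y z * l3 x y z)"
    have "f x y z = l1 x y z * m x y z" for x y z
      unfolding f E m_def by algebra
    moreover have pm: "is_poly m" unfolding m_def by (intro is_poly_intros polys)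
    moreover have "m 0 0 0 = 0" by (simp add: m_def l0)
    ultimately have "m x y z = 0" for x y z
      using not_divisible_by_line[OF irr lc, of l1 m x y z] by blast
    from this[of "k1 0 1 0" "k2 0 1 0" "k3 0 1 0"] this[of "k1 0 1 1" "k2 0 1 1" "k3 0 1 1"]
    show False using \<open>\<kappa> \<noteq> 0\<close> by (simp add: m_def lk)
  qed
  obtain r where r: "r^3 = A" by (rule complex_cube_root)
  obtain s where s: "s^3 = E" by (rule complex_cube_root)
  have nz: "r \<noteq> 0" "s \<noteq> 0" using r s \<open>A \<noteq> 0\<close> \<open>E \<noteq> 0\<close> by auto
  define m3 :: cpoly where "m3 = (\<lambda>x y z. B / (r * s) * x + C / (r * s) * y + \<kappa> / (r * s) * z)"
  define n3 :: cpoly where "n3 = (\<lambda>x y z. - B / (r * \<kappa>) * x + - C / (s * \<kappa>) * y + r * s / \<kappa> * z)"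
  \<comment> \<open>M1 M2 M3 must equal l1 l2 (B l1 + C l2 + \<kappa> l3), and M1 M2 = r s l1 l2;
    hence the denominators r s in \<open>m3\<close>. The form \<open>n3\<close> solves M3 for
    l3.\<close>
  define M1 M2 M3 where "M1 = (\<lambda>x y z. r * l1 x y z)" and "M2 = (\<lambda>x y z. s * l2 x y z)"
    and "M3 = (\<lambda>x y z. m3 (l1 x y z) (l2 x y z) (l3 x y z))"
  define N1 N2 N3 where "N1 = (\<lambda>x y z. k1 (x / r) (y / s) (n3 x y z))"
    and "N2 = (\<lambda>x y z. k2 (x / r) (y / s) (n3 x y z))" and "N3 = (\<lambda>x y z. k3 (x / r) (y / s) (n3 x y z))"
  have "linear_change M1 M2 M3 N1 N2 N3"
  proof
    have hm: "hom_poly 1 m3" "hom_poly 1 n3" unfolding m3_def n3_def by (rule hom_poly_linear)+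
    have hx: "hom_poly 1 (\<lambda>x y z. r * x)" "hom_poly 1 (\<lambda>x y z. s * x)" "hom_poly 1 (\<lambda>x y z. x / r)" "hom_poly 1 (\<lambda>x y z. y / s)"
      using hom_poly_linear[of r 0 0] hom_poly_linear[of s 0 0] hom_poly_linear[of "1 / r" 0 0] hom_poly_linear[of 0 "1 / s" 0]
      by simp_all
    show "hom_poly 1 M1" unfolding M1_def using hom_poly_1_compose[OF hx(1) hom_l] .
    show "hom_poly 1 M2" unfolding M2_def using hom_poly_1_compose[OF hx(2) hom_l(2,1,3)] .
    show "hom_poly 1 M3" unfolding M3_def using hom_poly_1_compose[OF hm(1) hom_l] .
    show "hom_poly 1 N1" unfolding N1_def using hom_poly_1_compose[OF hom_k(1) hx(3,4) hm(2)] .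
    show "hom_poly 1 N2" unfolding N2_def using hom_poly_1_compose[OF hom_k(2) hx(3,4) hm(2)] .
    show "hom_poly 1 N3" unfolding N3_def using hom_poly_1_compose[OF hom_k(3) hx(3,4) hm(2)] .
    fix x y z
    show "M1 (N1 x y z) (N2 x y z) (N3 x y z) = x" "M2 (N1 x y z) (N2 x y z) (N3 x y z) = y"
      "M3 (N1 x y z) (N2 x y z) (N3 x y z) = z"
      using nz \<open>\<kappa> \<noteq> 0\<close> by (simp_all add: M1_def M2_def M3_def N1_def N2_def N3_def lk m3_def n3_def field_simps)
    have "n3 (M1 x y z) (M2 x y z) (M3 x y z) = l3 x y z"
      using nz \<open>\<kappa> \<noteq> 0\<close> by (simp add: M1_def M2_def M3_def m3_def n3_def field_simps)
    then show "N1 (M1 x y z) (M2 x y z) (M3 x y z) = x" "N2 (M1 x y z) (M2 x y z) (M3 x y z) = y"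
      "N3 (M1 x y z) (M2 x y z) (M3 x y z) = z"
      using nz by (simp_all add: N1_def N2_def N3_def) (simp_all add: M1_def M2_def kl)
  qed
  moreover have "f = linear_change.pull M1 M2 M3 std_cubic"
    unfolding linear_change.pull_def[OF calculation]
  proof (intro ext)
    fix x y z
    have m3: "r * s * M3 x y z = B * l1 x y z + C * l2 x y z + \<kappa> * l3 x y z"
      using nz by (simp add: M3_def m3_def field_simps)
    show "f x y z = std_cubic (M1 x y z) (M2 x y z) (M3 x y z)"
      unfolding f std_cubic_def M1_def M2_def using m3 r s by algebra
  qed
  ultimately show ?thesis by (rule that)
qed

lemma sext_point_inject: "sext_point c u = sext_point c' u' \<Longrightarrow> c \<noteq> 0 \<Longrightarrow> c = c' \<and> u = u'"
  by (auto simp: sext_point_def)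

lemma proportional_sext_point: "c \<noteq> 0 \<Longrightarrow> c' \<noteq> 0 \<Longrightarrow> proportional (sext_point c u) (sext_point c' u') \<longleftrightarrow> u = u'"
  unfolding proportional_def sext_point_def by (auto intro!: exI[of _ "c' / c"])

lemma cube_roots_of_unity:
  obtains \<omega> where "\<omega>^3 = (1::complex)" "\<omega> \<noteq> 1" "\<omega>^2 \<noteq> 1" "\<omega>^2 \<noteq> \<omega>"
    "\<And>u. u^3 = 1 \<Longrightarrow> u = 1 \<or> u = \<omega> \<or> u = \<omega>^2"
proof -
  define s where "s = csqrt (-3)"
  define \<omega> where "\<omega> = (s - 1) / 2"
  have "s^2 = -3" unfolding s_def by (rule power2_csqrt)
  then have w: "\<omega>^2 + \<omega> + 1 = 0" by (simp add: \<omega>_def field_simps power2_eq_square)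
  then have w3: "\<omega>^3 = 1" by algebra
  have 1: "\<omega> \<noteq> 1" using w by auto
  have 2: "\<omega>^2 \<noteq> 1" 
  proof
    assume "\<omega>^2 = 1"
    then have "\<omega> = 1" using w3 by algebra
    then show False using 1 by blast
  qed
  have 3: "\<omega>^2 \<noteq> \<omega>"
  proof
    assume *: "\<omega>^2 = \<omega>"
    then have "\<omega> * \<omega> = \<omega>" by (simp only: power2_eq_square)
    then have "\<omega>^3 = \<omega>" by (simp only: power3_eq_cube)
    then have "\<omega> = 1" using w3 by simp
    then show False using 1 by blast
  qed
  have "u = 1 \<or> u = \<omega> \<or> u = \<omega>^2" if "u^3 = 1" for u
  proof -
    have "(u - 1) * ((u - \<omega>) * (u - \<omega>^2)) = 0" using w w3 that by algebra
    then show ?thesis by auto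
  qed
  then show ?thesis using that w3 1 2 3 by blast
qed

theorem mainTheorem1:
  fixes f :: cpoly
  assumes "irreducible_nodal_cubic f"
  shows "(\<exists>p1 p2 p3. sextactic_pt f p1 \<and> sextactic_pt f p2 \<and> sextactic_pt f p3 \<and>
            \<not> proportional p1 p2 \<and> \<not> proportional p1 p3 \<and> \<not> proportional p2 p3 \<and>
            (\<forall>p. sextactic_pt f p \<longrightarrow>
                 proportional p1 p \<or> proportional p2 p \<or> proportional p3 p))
       \<and> (\<forall>p. sextactic_pt f p \<longrightarrow> (\<exists>q. hyperosculating f p q))
       \<and> (\<forall>p q q'. hyperosculating f p q \<and> hyperosculating f p q' \<longrightarrow>
            (\<exists>c. q' = pscale c q))
       \<and> (\<forall>p q. hyperosculating f p q \<longrightarrow> free_with_exponents (pmult f q) [2, 2])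
       \<and> (\<forall>p1 p2 q1 q2. hyperosculating f p1 q1 \<and> hyperosculating f p2 q2 \<and>
            \<not> proportional p1 p2 \<longrightarrow>
            free_with_exponents (pmult (pmult f q1) q2) [3, 3])
       \<and> (\<forall>p1 p2 p3 q1 q2 q3. hyperosculating f p1 q1 \<and> hyperosculating f p2 q2 \<and>
            hyperosculating f p3 q3 \<and> \<not> proportional p1 p2 \<and> \<not> proportional p1 p3 \<and>
            \<not> proportional p2 p3 \<longrightarrow>
            msyzygy_with_exponents (pmult (pmult (pmult f q1) q2) q3) [5, 5, 5, 5])"
proof -
  obtain l1 l2 l3 k1 k2 k3 where lc: "linear_change l1 l2 l3 k1 k2 k3"
    and f: "f = linear_change.pull l1 l2 l3 std_cubic"
    using nodal_cubic_normal_form[OF assms] by blast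
  interpret linear_change l1 l2 l3 k1 k2 k3 by (rule lc)
  interpret inv: linear_change k1 k2 k3 l1 l2 l3 by (rule inverse)
  have polyf: "is_poly f" unfolding f by (rule is_poly_pull[OF is_poly_std_cubic])
  have std_cubic: "std_cubic = inv.pull f" unfolding f by (simp add: inverse_pull)
  \<comment> \<open>All further claims go through this description: a hyperosculating pair of
    \<open>f\<close> is determined by a cube root of unity u, up to the scalars c of the point and
    \<kappa> of the conic.\<close>
  have hyp: "\<exists>c u \<kappa>. c \<noteq> 0 \<and> u^3 = 1 \<and> \<kappa> \<noteq> 0 \<and> inv.kpt p = sext_point c u \<and> q = pscale \<kappa> (pull (osc_conic u))"
    if pq: "hyperosculating f p q" for p q
  proof -
    have "hyperosculating std_cubic (inv.kpt p) (inv.pull q)"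
      using inv.hyperosculating_kpt[OF polyf pq] by (simp add: std_cubic)
    then obtain c u \<kappa> where "c \<noteq> 0" "u^3 = 1" "\<kappa> \<noteq> 0" "inv.kpt p = sext_point c u" "inv.pull q = pscale \<kappa> (osc_conic u)"
      by (rule hyperosculating_std_cubic_imp)
    moreover from this(5) have "q = pscale \<kappa> (pull (osc_conic u))"
      using pull_inverse[of q] by (simp add: pull_simps)
    ultimately show ?thesis by blast
  qed
  have prop_iff: "proportional (inv.kpt p) (inv.kpt p') \<longleftrightarrow> proportional p p'" for p p'
    using inv.proportional_kpt[of p p'] proportional_kpt[of "inv.kpt p" "inv.kpt p'"] inv.lpt_kpt by auto
  have distinct: "u \<noteq> u'"
    if "\<not> proportional p p'" "inv.kpt p = sext_point c u" "inv.kpt p' = sext_point c' u'" "c \<noteq> 0" "c' \<noteq> 0" for p p' c c' u u'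
    using that prop_iff[of p p'] by (auto simp: proportional_sext_point)
  have sext_point: "sextactic_pt f (kpt (sext_point 1 u))" if "u^3 = 1" for u
    unfolding f using sextactic_pt_kpt[OF is_poly_std_cubic] hyperosculating_std_cubic_sext_point[OF _ that, of 1]
    by (simp add: hyperosculating_def)
  have exq: "\<exists>q. hyperosculating f p q" if "sextactic_pt f p" for p
    using that unfolding hyperosculating_def sextactic_pt_def by blast
  have "\<exists>p1 p2 p3. sextactic_pt f p1 \<and> sextactic_pt f p2 \<and> sextactic_pt f p3 \<and>
            \<not> proportional p1 p2 \<and> \<not> proportional p1 p3 \<and> \<not> proportional p2 p3 \<and>
            (\<forall>p. sextactic_pt f p \<longrightarrow>
                 proportional p1 p \<or> proportional p2 p \<or> proportional p3 p)"
  proof -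
    obtain \<omega> where w: "\<omega>^3 = (1::complex)" "\<omega> \<noteq> 1" "\<omega>^2 \<noteq> 1" "\<omega>^2 \<noteq> \<omega>"
      and all: "\<And>u. u^3 = 1 \<Longrightarrow> u = 1 \<or> u = \<omega> \<or> u = \<omega>^2"
      using cube_roots_of_unity by blast
    have w2: "(\<omega>^2)^3 = 1" using w(1) by algebra
    have np: "\<not> proportional (kpt (sext_point 1 u)) (kpt (sext_point 1 u'))" if "u \<noteq> u'" for u u'
      using that prop_iff[of "kpt (sext_point 1 u)" "kpt (sext_point 1 u')"] by (simp add: lpt_kpt proportional_sext_point)
    have cover: "proportional (kpt (sext_point 1 1)) p \<or> proportional (kpt (sext_point 1 \<omega>)) p \<or> proportional (kpt (sext_point 1 (\<omega>^2))) p"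
      if s: "sextactic_pt f p" for p
    proof -
      obtain c u where u: "c \<noteq> 0" "u^3 = 1" "inv.kpt p = sext_point c u"
        using exq[OF s] hyp by blast
      have "proportional (kpt (sext_point 1 u)) p"
        using prop_iff[of "kpt (sext_point 1 u)" p] u by (simp add: lpt_kpt proportional_sext_point)
      then show ?thesis using all[OF u(2)] by auto
    qed
    show ?thesis
      using sext_point[of 1] sext_point[OF w(1)] sext_point[OF w2] np[of 1 \<omega>] np[of 1 "\<omega>^2"] np[of \<omega> "\<omega>^2"] w cover
      by (intro exI[of _ "kpt (sext_point 1 1)"] exI[of _ "kpt (sext_point 1 \<omega>)"] exI[of _ "kpt (sext_point 1 (\<omega>^2))"]) auto
  qed
  moreover have "\<exists>c. q' = pscale c q" if pq: "hyperosculating f p q" "hyperosculating f p q'" for p q q'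
  proof -
    obtain c u \<kappa> where 1: "c \<noteq> 0" "\<kappa> \<noteq> 0" "inv.kpt p = sext_point c u" "q = pscale \<kappa> (pull (osc_conic u))"
      using hyp[OF pq(1)] by blast
    obtain c' u' \<kappa>' where 2: "inv.kpt p = sext_point c' u'" "q' = pscale \<kappa>' (pull (osc_conic u'))"
      using hyp[OF pq(2)] by blast
    \<comment> \<open>The same triple determines u, so both conics are multiples of one pulled-back
      \<open>osc_conic\<close>, with quotient \<kappa>' / \<kappa>.\<close>
    have "u' = u" using sext_point_inject 1 2 by metis
    then have "q' = pscale (\<kappa>' / \<kappa>) q" using 1(2) unfolding 1(4) 2(2) by (simp add: pscale_def)
    then show ?thesis by blast
  qed
  moreover have "free_with_exponents (pmult f q) [2, 2]" if pq: "hyperosculating f p q" for p q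
  proof -
    obtain u \<kappa> where 1: "u^3 = 1" "\<kappa> \<noteq> 0" "q = pscale \<kappa> (pull (osc_conic u))" using hyp[OF pq] by blast
    let ?G = "pmult std_cubic (osc_conic u)"
    have poly: "is_poly ?G"
      unfolding pmult_def by (intro is_poly_intros is_poly_std_cubic hom_poly_imp_is_poly[OF hom_poly_osc_conic])
    have "pmult f q = pscale \<kappa> (pull ?G)"
      unfolding 1(3) f pull_simps by (simp add: pscale_def pmult_def ac_simps)
    then show ?thesis
      using free_with_exponents_pscale[OF is_poly_pull[OF poly] 1(2)
          free_with_exponents_pull[OF poly free_std_cubic_osc_conic[OF 1(1)]]] by simp
  qed
  moreover have "free_with_exponents (pmult (pmult f q1) q2) [3, 3]"
    if pq: "hyperosculating f p1 q1" "hyperosculating f p2 q2" "\<not> proportional p1 p2" for p1 p2 q1 q2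
  proof -
    obtain c u \<kappa> where 1: "c \<noteq> 0" "u^3 = 1" "\<kappa> \<noteq> 0" "inv.kpt p1 = sext_point c u" "q1 = pscale \<kappa> (pull (osc_conic u))"
      using hyp[OF pq(1)] by blast
    obtain c' v \<mu> where 2: "c' \<noteq> 0" "v^3 = 1" "\<mu> \<noteq> 0" "inv.kpt p2 = sext_point c' v" "q2 = pscale \<mu> (pull (osc_conic v))"
      using hyp[OF pq(2)] by blast
    have uv: "u \<noteq> v" using distinct[OF pq(3) 1(4) 2(4) 1(1) 2(1)] .
    let ?G = "pmult (pmult std_cubic (osc_conic u)) (osc_conic v)"
    have poly: "is_poly ?G"
      unfolding pmult_def by (intro is_poly_intros is_poly_std_cubic hom_poly_imp_is_poly[OF hom_poly_osc_conic])
    have "pmult (pmult f q1) q2 = pscale (\<kappa> * \<mu>) (pull ?G)"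
      unfolding 1(5) 2(5) f pull_simps by (simp add: pscale_def pmult_def ac_simps)
    then show ?thesis
      using free_with_exponents_pscale[OF is_poly_pull[OF poly] _
          free_with_exponents_pull[OF poly free_std_cubic_two_osc_conics[OF 1(2) 2(2) uv]], of "\<kappa> * \<mu>"] 1(3) 2(3) by simp
  qed
  moreover have "msyzygy_with_exponents (pmult (pmult (pmult f q1) q2) q3) [5, 5, 5, 5]"
    if pq: "hyperosculating f p1 q1" "hyperosculating f p2 q2" "hyperosculating f p3 q3"
      "\<not> proportional p1 p2" "\<not> proportional p1 p3" "\<not> proportional p2 p3" for p1 p2 p3 q1 q2 q3
  proof -
    obtain c u \<kappa> where 1: "c \<noteq> 0" "u^3 = 1" "\<kappa> \<noteq> 0" "inv.kpt p1 = sext_point c u" "q1 = pscale \<kappa> (pull (osc_conic u))"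
      using hyp[OF pq(1)] by blast
    obtain c' v \<mu> where 2: "c' \<noteq> 0" "v^3 = 1" "\<mu> \<noteq> 0" "inv.kpt p2 = sext_point c' v" "q2 = pscale \<mu> (pull (osc_conic v))"
      using hyp[OF pq(2)] by blast
    obtain c'' w \<nu> where 3: "c'' \<noteq> 0" "w^3 = 1" "\<nu> \<noteq> 0" "inv.kpt p3 = sext_point c'' w" "q3 = pscale \<nu> (pull (osc_conic w))"
      using hyp[OF pq(3)] by blast
    have ne: "u \<noteq> v" "u \<noteq> w" "v \<noteq> w"
      using distinct[OF pq(4) 1(4) 2(4) 1(1) 2(1)] distinct[OF pq(5) 1(4) 3(4) 1(1) 3(1)]
        distinct[OF pq(6) 2(4) 3(4) 2(1) 3(1)] by blast+
    let ?G = "pmult (pmult (pmult std_cubic (osc_conic u)) (osc_conic v)) (osc_conic w)"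
    have poly: "is_poly ?G"
      unfolding pmult_def by (intro is_poly_intros is_poly_std_cubic hom_poly_imp_is_poly[OF hom_poly_osc_conic])
    have "pmult (pmult (pmult f q1) q2) q3 = pscale (\<kappa> * \<mu> * \<nu>) (pull ?G)"
      unfolding 1(5) 2(5) 3(5) f pull_simps by (simp add: pscale_def pmult_def ac_simps)
    then show ?thesis
      using msyzygy_with_exponents_pscale[OF is_poly_pull[OF poly] _
          msyzygy_with_exponents_pull[OF poly msyzygy_std_cubic_three_osc_conics[OF 1(2) 2(2) 3(2) ne]], of "\<kappa> * \<mu> * \<nu>"] 1(3) 2(3) 3(3) by simp
  qed
  ultimately show ?thesis using exq by blast
qed

end
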